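(* Let $a, d$ be positive integers such that $ad \neq 1$. For $j=1,2$, let $\mathscr T^{(j)}=(V^{(j)},\mathcal E^{(j)})$ be the directed Cartesian product of locally finite rooted directed trees $\mathscr T^{(j)}_1,\ldots,\mathscr T^{(j)}_d$, and suppose $\mathscr T^{(j)}$ is of finite joint branching index. Let $\mathscr H_{\mathfrak c_a}(\mathscr T^{(j)})$ be the Drury-Arveson-type Hilbert module associated with $\mathscr T^{(j)}$, let $E^{(j)}$ be the subspace of constant functions in $\mathscr H_{\mathfrak c_a}(\mathscr T^{(j)})$, and let $\mathcal L^{(j)}_{u,F}$ be the subspaces in the decomposition $E^{(j)}=\bigoplus_{F\in\mathscr P}\bigoplus_{u\in\Omega^{(j)}_F}\mathcal L^{(j)}_{u,F}$. Then the following statements are equivalent: (i) The Hilbert modules $\mathscr H_{\mathfrak c_a}(\mathscr T^{(1)})$ and $\mathscr H_{\mathfrak c_a}(\mathscr T^{(2)})$ are isomorphic. (ii) For any $\alpha\in\mathbb N^d$ and $F\in\mathscr P$, $$\sum_{u\in\Omega^{(1)}_F,\ \mathsf d_u=\alpha}\dim\mathcal L^{(1)}_{u,F}=\sum_{v\in\Omega^{(2)}_F,\ \mathsf d_v=\alpha}\dim\mathcal L^{(2)}_{v,F}.$$ (iii) For any $n\in\mathbb N$ and $l=1,\ldots,d$, $$\sum_{u\in\Omega^{(1)}_{\{l\}},\ \mathsf d_u=n\epsilon_l}(\mathrm{card}(\mathsf{sib}_l(u))-1)=\sum_{u\in\Omega^{(2)}_{\{l\}},\ \mathsf d_u=n\epsilon_l}(\mathrm{card}(\mathsf{sib}_l(u))-1),$$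 where $\epsilon_l$ is the $d$-tuple with $1$ in the $l$-th place and zeros elsewhere. (iv) For any $n\in\mathbb N$ and $l=1,\ldots,d$, $$\mathrm{card}(\mathcal G_n(\mathscr T^{(1)}_l))=\mathrm{card}(\mathcal G_n(\mathscr T^{(2)}_l)),$$ where $\mathcal G_n(\mathscr T^{(j)}_l)$ is the $n$-th generation of $\mathscr T^{(j)}_l$, $j=1,2$.
   Context: Conventions: $\mathbb N=\{0,1,2,\ldots\}$; for $\alpha\in\mathbb N^d$, $\alpha!=\prod_j\alpha_j!$ and $|\alpha|=\sum_j\alpha_j$; empty sums are $0$, empty products are $1$. $\mathscr P$ is the set of all subsets of $\{1,\ldots,d\}$. $\mathbb B^d$ is the open unit ball of $\mathbb C^d$. Trees: a rooted directed tree is a connected directed graph without circuits in which every vertex has at most one parent and exactly one vertex (the root) has no parent. $\mathsf{Chi}(u)$ is the set of children of $u$; for a non-root $u$, $\mathsf{par}(u)$ is its parent and $\mathsf{sib}(u)=\mathsf{Chi}(\mathsf{par}(u))$ (so $u\in\mathsf{sib}(u)$). All directed trees are assumed countably infinite and leafless ($\mathrm{card}(\mathsf{Chi}(u))\geq 1$ for all $u$). Locally finite: every $\mathsf{Chi}(u)$ is finite. The depth of $u$ is the length of the path from the root to $u$; the $n$-th generation $\mathcal G_n$ of a tree is the set of vertices of depth $n$. Products: for rooted directed trees $\mathscr T_j=(V_j,\mathcal E_j)$ with roots $\mathsf{root}_j$ ($j=1,\ldots,d$), the directed Cartesian product $\mathscr T=(V,\mathcal E)$ has $V=V_1\times\cdots\times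 V_d$ and $(v,w)\in\mathcal E$ iff there is $k$ with $v_j=w_j$ for $j\neq k$ and $(v_k,w_k)\in\mathcal E_k$. Put $\mathsf{root}=(\mathsf{root}_1,\ldots,\mathsf{root}_d)$. The depth of $v\in V$ is $\mathsf d_v=(\mathsf d_{v_1},\ldots,\mathsf d_{v_d})\in\mathbb N^d$ with $\mathsf d_{v_j}$ the depth of $v_j$ in $\mathscr T_j$. $\mathsf{Chi}_j(v)$ (resp. $\mathsf{sib}_j(v)$, for $v_j\neq\mathsf{root}_j$) is the set of $w\in V$ with $w_i=v_i$ for $i\ne j$ and $w_j\in\mathsf{Chi}(v_j)$ (resp. $w_j\in\mathsf{sib}(v_j)$). $\mathscr T$ is of finite joint branching index if, for each $j$, the set of depths of the branching vertices of $\mathscr T_j$ (vertices with at least two children) is bounded (possibly empty). Weights: for $a>0$, let $\lambda_j(w)=\frac{1}{\sqrt{\mathrm{card}(\mathsf{Chi}_j(v))}}\sqrt{\frac{\mathsf d_{v_j}+1}{|\mathsf d_v|+a}}$ for $w\in\mathsf{Chi}_j(v)$, $v\in V$, $j=1,\ldots,d$. On $l^2(V)$ with orthonormal basis $\{e_v\}_{v\in V}$ of indicator functions, the Drury-Arveson-type multishift is the commuting $d$-tuple $S_{\boldsymbol\lambda_{\mathfrak c_a}}=(S_1,\ldots,S_d)$ with $S_je_v=\sum_{w\in\mathsf{Chi}_j(v)}\lambda_j(w)e_w$. Spaces $\mathcal L_{u,F}$: for $F\in\mathscr P$ let $\Phi_F=\{v\in V: v_j\neq\mathsf{root}_j\text{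 if }j\in F,\ v_j=\mathsf{root}_j\text{ if }j\notin F\}$. For $u\in\Phi_F$, $\mathsf{sib}_F(u)$ is the set of $w\in V$ with $w_j\in\mathsf{sib}(u_j)$ for $j\in F$ and $w_j=u_j$ for $j\notin F$. These sets partition $\Phi_F$, and $\Omega_F$ is any set containing exactly one element of each class. For $G\in\mathscr P$, $v_G$ is $v$ with all coordinates $v_j$, $j\notin G$, replaced by $\mathsf{root}_j$; $\mathsf{sib}_{F,G}(u)=\{v_G: v\in\mathsf{sib}_F(u)\}$ for $G\subseteq F$; and for $j\notin G$, $v_G|u_j$ is $v_G$ with $j$-th coordinate replaced by $u_j$. $\mathcal L_{u,F}\subseteq l^2(\mathsf{sib}_F(u))$ is the space of $f$ with $\sum_{w\in\mathsf{sib}_j(v_G|u_j)}f(w)\lambda_j(w)=0$ for all $j\in F$, $G=F\setminus\{j\}$, $v_G\in\mathsf{sib}_{F,G}(u)$ (for $F=\emptyset$, $\mathcal L_{\mathsf{root},\emptyset}$ is the span of $e_{\mathsf{root}}$). The joint kernel $E=\bigcap_j\ker S_j^*$ equals $\bigoplus_{F\in\mathscr P}\bigoplus_{u\in\Omega_F}\mathcal L_{u,F}$ and is finite dimensional when $\mathscr T$ is of finite joint branching index. Superscript $(j)$ denotes the object attached to $\mathscr T^{(j)}$. Hilbert module: for $\mathscr T$ of finite joint branching index, $\mathscr H_{\mathfrak c_a}(\mathscr T)$ is the reproducing kernel Hilbert space of $E$-valued holomorphic functions on $\mathbb B^d$ with $B(E)$-valued kernel $$\kappa(z,w)=\sum_{F\in\mathscr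 P}\sum_{u\in\Omega_F}\Big(\sum_{\alpha\in\mathbb N^d}\frac{\mathsf d_u!}{(\mathsf d_u+\alpha)!}\prod_{i=0}^{|\alpha|-1}(|\mathsf d_u|+a+i)\,z^\alpha\overline w^\alpha\Big)P_{\mathcal L_{u,F}},$$ $P_{\mathcal L_{u,F}}$ being the orthogonal projection of $E$ onto $\mathcal L_{u,F}$. It is a module over $\mathbb C[z_1,\ldots,z_d]$ through $p\cdot h=p(\mathscr M_z)h$, $\mathscr M_z=(\mathscr M_{z_1},\ldots,\mathscr M_{z_d})$ being the (bounded) multiplication operators by coordinate functions; $\mathscr M_z$ is unitarily equivalent to $S_{\boldsymbol\lambda_{\mathfrak c_a}}$, and its joint cokernel $\bigcap_i\ker\mathscr M_{z_i}^*$ is the subspace of constant functions, identified with $E$. Two such modules are isomorphic if there is a unitary $U$ between them with $U\mathscr M^{(1)}_{z_k}=\mathscr M^{(2)}_{z_k}U$ for $k=1,\ldots,d$. *)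

theory Defs
  imports
    "Graph_Theory.Pair_Digraph"
    "Graph_Theory.Digraph_Component"
    "HOL-Library.Function_Algebras"
    "HOL-Analysis.Analysis"
begin

section \<open>Rooted directed trees\<close>

text \<open>
  The library's \<^const>\<open>tree\<close> is "connected (after forgetting orientation) and without directed
  circuits".
\<close>

definition rooted_directed_tree :: "'a pair_pre_digraph \<Rightarrow> bool" where
  "rooted_directed_tree G \<longleftrightarrow>
     pair_wf_digraph G \<and> tree (with_proj G) \<and>
     (\<forall>u\<in>pverts G. \<forall>p q. (p, u) \<in> parcs G \<longrightarrow> (q, u) \<in> parcs G \<longrightarrow> p = q) \<and>
     (\<exists>!r. r \<in> pverts G \<and> \<not> (\<exists>p. (p, r) \<in> parcs G))"

definition tree_root :: "'a pair_pre_digraph \<Rightarrow> 'a" where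
  "tree_root G = (THE r. r \<in> pverts G \<and> \<not> (\<exists>p. (p, r) \<in> parcs G))"

definition Chi :: "'a pair_pre_digraph \<Rightarrow> 'a \<Rightarrow> 'a set" where
  "Chi G u = {w. (u, w) \<in> parcs G}"

definition par :: "'a pair_pre_digraph \<Rightarrow> 'a \<Rightarrow> 'a" where
  "par G u = (THE p. (p, u) \<in> parcs G)"

definition sib :: "'a pair_pre_digraph \<Rightarrow> 'a \<Rightarrow> 'a set" where
  "sib G u = Chi G (par G u)"

definition depth :: "'a pair_pre_digraph \<Rightarrow> 'a \<Rightarrow> nat" where
  "depth G u = (THE n. \<exists>p. pre_digraph.apath (with_proj G) (tree_root G) p u \<and> length p = n)"

definition generation :: "nat \<Rightarrow> 'a pair_pre_digraph \<Rightarrow> 'a set" where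
  "generation n G = {v \<in> pverts G. depth G v = n}"

text \<open>All directed trees are countably infinite and leafless.\<close>

definition directed_tree :: "'a pair_pre_digraph \<Rightarrow> bool" where
  "directed_tree G \<longleftrightarrow> rooted_directed_tree G \<and> countable (pverts G) \<and> infinite (pverts G) \<and>
     (\<forall>u\<in>pverts G. Chi G u \<noteq> {})"

definition locally_finite :: "'a pair_pre_digraph \<Rightarrow> bool" where
  "locally_finite G \<longleftrightarrow> (\<forall>u\<in>pverts G. finite (Chi G u))"

definition branching_vertices :: "'a pair_pre_digraph \<Rightarrow> 'a set" where
  "branching_vertices G = {u \<in> pverts G. \<exists>x\<in>Chi G u. \<exists>y\<in>Chi G u. x \<noteq> y}"


section \<open>Multi-indices\<close>

definition mlen :: "('d::finite \<Rightarrow> nat) \<Rightarrow> nat" where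
  "mlen \<alpha> = (\<Sum>j\<in>UNIV. \<alpha> j)"

definition mfact :: "('d::finite \<Rightarrow> nat) \<Rightarrow> nat" where
  "mfact \<alpha> = (\<Prod>j\<in>UNIV. fact (\<alpha> j))"

definition mpow :: "complex ^ 'd \<Rightarrow> ('d::finite \<Rightarrow> nat) \<Rightarrow> complex" where
  "mpow z \<alpha> = (\<Prod>j\<in>UNIV. z $ j ^ \<alpha> j)"


section \<open>Directed Cartesian products\<close>

text \<open>
  A family of trees indexed by \<open>{1, \<dots>, d}\<close> is a function on a finite type \<open>'d\<close> with \<open>d\<close> elements;
  a vertex of the product is a choice function, and a member of \<open>\<P>({1, \<dots>, d})\<close> is a term of
  type \<open>'d set\<close>.
\<close>

definition dcprod :: "('d::finite \<Rightarrow> 'a pair_pre_digraph) \<Rightarrow> ('d \<Rightarrow> 'a) pair_pre_digraph" where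
  "dcprod T =
     (let V = {v. \<forall>j. v j \<in> pverts (T j)}
      in \<lparr> pverts = V,
           parcs = {(v, w). v \<in> V \<and> w \<in> V \<and>
                      (\<exists>k. (\<forall>j. j \<noteq> k \<longrightarrow> v j = w j) \<and> (v k, w k) \<in> parcs (T k))} \<rparr>)"

abbreviation pV :: "('d::finite \<Rightarrow> 'a pair_pre_digraph) \<Rightarrow> ('d \<Rightarrow> 'a) set" where
  "pV T \<equiv> pverts (dcprod T)"

definition proot :: "('d::finite \<Rightarrow> 'a pair_pre_digraph) \<Rightarrow> 'd \<Rightarrow> 'a" where
  "proot T = (\<lambda>j. tree_root (T j))"

definition pdepth :: "('d::finite \<Rightarrow> 'a pair_pre_digraph) \<Rightarrow> ('d \<Rightarrow> 'a) \<Rightarrow> 'd \<Rightarrow> nat" where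
  "pdepth T v = (\<lambda>j. depth (T j) (v j))"

definition pChi :: "('d::finite \<Rightarrow> 'a pair_pre_digraph) \<Rightarrow> 'd \<Rightarrow> ('d \<Rightarrow> 'a) \<Rightarrow> ('d \<Rightarrow> 'a) set" where
  "pChi T j v = {w \<in> pV T. (\<forall>i. i \<noteq> j \<longrightarrow> w i = v i) \<and> w j \<in> Chi (T j) (v j)}"

text \<open>Only meaningful if the \<open>j\<close>-th coordinate of \<open>v\<close> is not a root.\<close>

definition psib :: "('d::finite \<Rightarrow> 'a pair_pre_digraph) \<Rightarrow> 'd \<Rightarrow> ('d \<Rightarrow> 'a) \<Rightarrow> ('d \<Rightarrow> 'a) set" where
  "psib T j v = {w \<in> pV T. (\<forall>i. i \<noteq> j \<longrightarrow> w i = v i) \<and> w j \<in> sib (T j) (v j)}"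

definition finite_joint_branching_index :: "('d::finite \<Rightarrow> 'a pair_pre_digraph) \<Rightarrow> bool" where
  "finite_joint_branching_index T \<longleftrightarrow>
     (\<forall>j. bdd_above (depth (T j) ` branching_vertices (T j)))"

definition Phi :: "('d::finite \<Rightarrow> 'a pair_pre_digraph) \<Rightarrow> 'd set \<Rightarrow> ('d \<Rightarrow> 'a) set" where
  "Phi T F = {v \<in> pV T. (\<forall>j. j \<in> F \<longrightarrow> v j \<noteq> tree_root (T j)) \<and>
                         (\<forall>j. j \<notin> F \<longrightarrow> v j = tree_root (T j))}"

definition sibF :: "('d::finite \<Rightarrow> 'a pair_pre_digraph) \<Rightarrow> 'd set \<Rightarrow> ('d \<Rightarrow> 'a) \<Rightarrow> ('d \<Rightarrow> 'a) set" where
  "sibF T F u = {w \<in> pV T. (\<forall>j. j \<in> F \<longrightarrow> w j \<in> sib (T j) (u j)) \<and> (\<forall>j. j \<notin> F \<longrightarrow> w j = u j)}"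

definition transversal :: "('d::finite \<Rightarrow> 'a pair_pre_digraph) \<Rightarrow> ('d set \<Rightarrow> ('d \<Rightarrow> 'a) set) \<Rightarrow> bool" where
  "transversal T \<Omega> \<longleftrightarrow> (\<forall>F. \<Omega> F \<subseteq> Phi T F \<and> (\<forall>u\<in>Phi T F. \<exists>!w. w \<in> \<Omega> F \<and> w \<in> sibF T F u))"

definition vrestr :: "('d::finite \<Rightarrow> 'a pair_pre_digraph) \<Rightarrow> 'd set \<Rightarrow> ('d \<Rightarrow> 'a) \<Rightarrow> 'd \<Rightarrow> 'a" where
  "vrestr T G v = (\<lambda>j. if j \<in> G then v j else proot T j)"

definition sibFG ::
  "('d::finite \<Rightarrow> 'a pair_pre_digraph) \<Rightarrow> 'd set \<Rightarrow> 'd set \<Rightarrow> ('d \<Rightarrow> 'a) \<Rightarrow> ('d \<Rightarrow> 'a) set" where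
  "sibFG T F G u = vrestr T G ` sibF T F u"


section \<open>Square-summable functions\<close>

text \<open>
  The space \<open>l\<^sup>2(A)\<close> is a set of functions on the whole type that vanish off \<open>A\<close>, so
  \<open>l\<^sup>2(A) \<subseteq> l\<^sup>2(B)\<close> for \<open>A \<subseteq> B\<close> and one inner product serves for all \<open>A\<close>.
\<close>

definition l2 :: "'v set \<Rightarrow> ('v \<Rightarrow> complex) set" where
  "l2 A = {f. (\<forall>v. v \<notin> A \<longrightarrow> f v = 0) \<and> (\<lambda>v. (cmod (f v))\<^sup>2) summable_on A}"

definition l2_inner :: "('v \<Rightarrow> complex) \<Rightarrow> ('v \<Rightarrow> complex) \<Rightarrow> complex" where
  "l2_inner f g = (\<Sum>\<^sub>\<infinity>v. f v * cnj (g v))"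

definition l2_adjoint ::
  "'v set \<Rightarrow> (('v \<Rightarrow> complex) \<Rightarrow> 'v \<Rightarrow> complex) \<Rightarrow> ('v \<Rightarrow> complex) \<Rightarrow> 'v \<Rightarrow> complex" where
  "l2_adjoint A S f = (THE h. h \<in> l2 A \<and> (\<forall>g\<in>l2 A. l2_inner (S g) f = l2_inner g h))"

definition l2_proj :: "('v \<Rightarrow> complex) set \<Rightarrow> ('v \<Rightarrow> complex) \<Rightarrow> 'v \<Rightarrow> complex" where
  "l2_proj M x = (THE y. y \<in> M \<and> (\<forall>g\<in>M. l2_inner (x - y) g = 0))"

definition cdim :: "('v \<Rightarrow> complex) set \<Rightarrow> nat" where
  "cdim M = vector_space.dim (\<lambda>(c::complex) f v. c * f v) M"


section \<open>The multishift and its joint cokernel\<close>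

definition wt :: "real \<Rightarrow> ('d::finite \<Rightarrow> 'a pair_pre_digraph) \<Rightarrow> 'd \<Rightarrow> ('d \<Rightarrow> 'a) \<Rightarrow> real" where
  "wt a T j w =
     (let v = w(j := par (T j) (w j))
      in 1 / sqrt (real (card (pChi T j v))) *
         sqrt ((real (pdepth T v j) + 1) / (real (mlen (pdepth T v)) + a)))"

text \<open>
  The continuous linear extension of \<open>S\<^sub>j e\<^sub>v = (\<Sum>w\<in>Chi\<^sub>j(v). \<lambda>\<^sub>j(w) e\<^sub>w)\<close>, evaluated at \<open>w\<close>;
  at most one \<open>v\<close> contributes to the sum.
\<close>

definition mshift ::
  "real \<Rightarrow> ('d::finite \<Rightarrow> 'a pair_pre_digraph) \<Rightarrow> 'd \<Rightarrow> (('d \<Rightarrow> 'a) \<Rightarrow> complex) \<Rightarrow> ('d \<Rightarrow> 'a) \<Rightarrow> complex"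
  where
  "mshift a T j f = (\<lambda>w. \<Sum>v | v \<in> pV T \<and> w \<in> pChi T j v. f v * complex_of_real (wt a T j w))"

definition joint_kernel ::
  "real \<Rightarrow> ('d::finite \<Rightarrow> 'a pair_pre_digraph) \<Rightarrow> (('d \<Rightarrow> 'a) \<Rightarrow> complex) set" where
  "joint_kernel a T = {f \<in> l2 (pV T). \<forall>j. l2_adjoint (pV T) (mshift a T j) f = 0}"

definition Lsp ::
  "real \<Rightarrow> ('d::finite \<Rightarrow> 'a pair_pre_digraph) \<Rightarrow> ('d \<Rightarrow> 'a) \<Rightarrow> 'd set \<Rightarrow> (('d \<Rightarrow> 'a) \<Rightarrow> complex) set"
  where
  "Lsp a T u F =
     {f \<in> l2 (sibF T F u).
        \<forall>j\<in>F. \<forall>x\<in>sibFG T F (F - {j}) u.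
          (\<Sum>w\<in>psib T j (x(j := u j)). f w * complex_of_real (wt a T j w)) = 0}"


section \<open>Reproducing kernel Hilbert spaces of vector-valued functions\<close>

record 'f hspace =
  hcarrier :: "'f set"
  hinner :: "'f \<Rightarrow> 'f \<Rightarrow> complex"

definition hnorm :: "'f hspace \<Rightarrow> 'f \<Rightarrow> real" where
  "hnorm H f = sqrt (Re (hinner H f f))"

locale complex_hilbert_space = vector_space scale
  for scale :: "complex \<Rightarrow> 'f \<Rightarrow> 'f::ab_group_add" +
  fixes H :: "'f hspace"
  assumes carrier_subspace: "subspace (hcarrier H)"
    and inner_add: "\<lbrakk>f \<in> hcarrier H; g \<in> hcarrier H; h \<in> hcarrier H\<rbrakk>
          \<Longrightarrow> hinner H (f + g) h = hinner H f h + hinner H g h"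
    and inner_scale: "\<lbrakk>f \<in> hcarrier H; g \<in> hcarrier H\<rbrakk>
          \<Longrightarrow> hinner H (scale c f) g = c * hinner H f g"
    and inner_commute: "\<lbrakk>f \<in> hcarrier H; g \<in> hcarrier H\<rbrakk>
          \<Longrightarrow> hinner H g f = cnj (hinner H f g)"
    and inner_nonneg: "f \<in> hcarrier H \<Longrightarrow> 0 \<le> Re (hinner H f f)"
    and inner_definite: "\<lbrakk>f \<in> hcarrier H; hinner H f f = 0\<rbrakk> \<Longrightarrow> f = 0"
    and complete: "\<lbrakk>\<And>n. X n \<in> hcarrier H;
           \<forall>e>0. \<exists>N. \<forall>m\<ge>N. \<forall>n\<ge>N. hnorm H (X m - X n) < e\<rbrakk>
          \<Longrightarrow> \<exists>L\<in>hcarrier H. (\<lambda>n. hnorm H (X n - L)) \<longlonglongrightarrow> 0"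

text \<open>
  \<open>H\<close> is the Hilbert space of \<open>E\<close>-valued functions on \<open>X\<close> with reproducing kernel \<open>K\<close>, where
  \<open>K z w\<close> is an operator on the subspace \<open>E\<close> of an \<open>l\<^sup>2\<close> space. Functions on \<open>X\<close> are represented
  by their extension by \<open>0\<close>. By the Moore--Aronszajn theorem there is at most one such pair of a
  carrier and an inner product on it, and exactly one if \<open>K\<close> is positive definite.
\<close>

definition ksection ::
  "'z set \<Rightarrow> ('z \<Rightarrow> 'z \<Rightarrow> ('v \<Rightarrow> complex) \<Rightarrow> 'v \<Rightarrow> complex) \<Rightarrow> 'z \<Rightarrow> ('v \<Rightarrow> complex) \<Rightarrow> 'z \<Rightarrow> 'v \<Rightarrow> complex"
  where
  "ksection X K w x = (\<lambda>z. if z \<in> X then K z w x else 0)"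

definition is_rkhs ::
  "'z set \<Rightarrow> ('v \<Rightarrow> complex) set \<Rightarrow> ('z \<Rightarrow> 'z \<Rightarrow> ('v \<Rightarrow> complex) \<Rightarrow> 'v \<Rightarrow> complex) \<Rightarrow>
   ('z \<Rightarrow> 'v \<Rightarrow> complex) hspace \<Rightarrow> bool" where
  "is_rkhs X E K H \<longleftrightarrow>
     complex_hilbert_space (\<lambda>c h z v. c * h z v) H \<and>
     (\<forall>h\<in>hcarrier H. (\<forall>z\<in>X. h z \<in> E) \<and> (\<forall>z. z \<notin> X \<longrightarrow> h z = 0)) \<and>
     (\<forall>w\<in>X. \<forall>x\<in>E. ksection X K w x \<in> hcarrier H \<and>
        (\<forall>h\<in>hcarrier H. hinner H h (ksection X K w x) = l2_inner (h w) x))"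

text \<open>Holomorphy in several variables: complex differentiability at every point of an open set.\<close>

definition sv_holomorphic_on :: "(complex ^ 'd::finite \<Rightarrow> complex) \<Rightarrow> (complex ^ 'd) set \<Rightarrow> bool" where
  "sv_holomorphic_on f X \<longleftrightarrow>
     (\<forall>z\<in>X. \<exists>D. (f has_derivative D) (at z) \<and> (\<forall>c x. D (c *s x) = c * D x))"


section \<open>Drury-Arveson-type Hilbert modules\<close>

definition kcoeff :: "real \<Rightarrow> ('d::finite \<Rightarrow> nat) \<Rightarrow> complex ^ 'd \<Rightarrow> complex ^ 'd \<Rightarrow> complex" where
  "kcoeff a \<delta> z w =
     (\<Sum>\<^sub>\<infinity>\<alpha>. complex_of_real
         (real (mfact \<delta>) / real (mfact (\<lambda>j. \<delta> j + \<alpha> j)) *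
          (\<Prod>i<mlen \<alpha>. real (mlen \<delta>) + a + real i)) *
        mpow z \<alpha> * cnj (mpow w \<alpha>))"

text \<open>
  The operator \<open>\<kappa>(z, w)\<close> applied to \<open>x \<in> E\<close> is computed pointwise. Although \<open>\<Omega> F\<close> may be infinite,
  only finitely many of the spaces \<^term>\<open>Lsp a T u F\<close> are nonzero if the trees are locally finite
  and of finite joint branching index.
\<close>

definition da_kernel ::
  "real \<Rightarrow> ('d::finite \<Rightarrow> 'a pair_pre_digraph) \<Rightarrow> ('d set \<Rightarrow> ('d \<Rightarrow> 'a) set) \<Rightarrow>
   complex ^ 'd \<Rightarrow> complex ^ 'd \<Rightarrow> (('d \<Rightarrow> 'a) \<Rightarrow> complex) \<Rightarrow> ('d \<Rightarrow> 'a) \<Rightarrow> complex" where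
  "da_kernel a T \<Omega> z w x =
     (\<lambda>v. \<Sum>F\<in>UNIV. \<Sum>\<^sub>\<infinity>u\<in>\<Omega> F. kcoeff a (pdepth T u) z w * l2_proj (Lsp a T u F) x v)"

text \<open>
  As \<open>E\<close> is finite dimensional, an \<open>E\<close>-valued function is holomorphic iff its coordinate functions
  are. (Here this is automatic, the kernel being holomorphic in \<open>z\<close> and antiholomorphic in \<open>w\<close>.)
\<close>

definition is_da_space ::
  "real \<Rightarrow> ('d::finite \<Rightarrow> 'a pair_pre_digraph) \<Rightarrow> ('d set \<Rightarrow> ('d \<Rightarrow> 'a) set) \<Rightarrow>
   (complex ^ 'd \<Rightarrow> ('d \<Rightarrow> 'a) \<Rightarrow> complex) hspace \<Rightarrow> bool" where
  "is_da_space a T \<Omega> H \<longleftrightarrow>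
     is_rkhs (ball 0 1) (joint_kernel a T) (da_kernel a T \<Omega>) H \<and>
     (\<forall>h\<in>hcarrier H. \<forall>v. sv_holomorphic_on (\<lambda>z. h z v) (ball 0 1))"

definition Mz :: "'d::finite \<Rightarrow> (complex ^ 'd \<Rightarrow> 'v \<Rightarrow> complex) \<Rightarrow> complex ^ 'd \<Rightarrow> 'v \<Rightarrow> complex" where
  "Mz k h = (\<lambda>z v. z $ k * h z v)"

definition unitary_between ::
  "('z \<Rightarrow> 'v \<Rightarrow> complex) hspace \<Rightarrow> ('z \<Rightarrow> 'w \<Rightarrow> complex) hspace \<Rightarrow>
   (('z \<Rightarrow> 'v \<Rightarrow> complex) \<Rightarrow> 'z \<Rightarrow> 'w \<Rightarrow> complex) \<Rightarrow> bool" where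
  "unitary_between H1 H2 U \<longleftrightarrow>
     bij_betw U (hcarrier H1) (hcarrier H2) \<and>
     (\<forall>f\<in>hcarrier H1. \<forall>g\<in>hcarrier H1. U (f + g) = U f + U g) \<and>
     (\<forall>c. \<forall>f\<in>hcarrier H1. U (\<lambda>z v. c * f z v) = (\<lambda>z v. c * U f z v)) \<and>
     (\<forall>f\<in>hcarrier H1. \<forall>g\<in>hcarrier H1. hinner H2 (U f) (U g) = hinner H1 f g)"

definition hilbert_modules_isomorphic ::
  "(complex ^ 'd::finite \<Rightarrow> 'v \<Rightarrow> complex) hspace \<Rightarrow> (complex ^ 'd \<Rightarrow> 'w \<Rightarrow> complex) hspace \<Rightarrow> bool" where
  "hilbert_modules_isomorphic H1 H2 \<longleftrightarrow>
     (\<exists>U. unitary_between H1 H2 U \<and> (\<forall>k. \<forall>h\<in>hcarrier H1. U (Mz k h) = Mz k (U h)))"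

end

theory Submission
  imports Defs
begin

text \<open>
  On the joint kernel the weights are constant on siblings, so it consists of the functions whose
  sums over siblings vanish, and there the kernel acts as the diagonal operator
  \<open>x \<mapsto> (v \<mapsto> kcoeff a (pdepth T v) z w * x v)\<close>. Hence the module is a direct sum of scalar weighted
  power series modules indexed by degrees \<open>\<delta>\<close>, where \<open>\<delta>\<close> occurs as often as the dimension of the part of
  the joint kernel at depth \<open>\<delta>\<close>. An isomorphism restricts to a unitary between the constants. It
  intertwines the compressions of \<open>M\<^sub>k\<^sup>* M\<^sub>k\<close> and \<open>M\<^sub>k\<^sup>*\<^sup>2 M\<^sub>k\<^sup>2\<close>, which are diagonal and, as \<open>a d \<noteq> 1\<close>,
  determine \<open>\<delta>\<close>; so isomorphism means equal multiplicities. The multiplicity of \<open>\<delta>\<close> is the product over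
  the \<open>j\<close> with \<open>\<delta> j \<noteq> 0\<close> of the growth from generation \<open>\<delta> j - 1\<close> to generation \<open>\<delta> j\<close> of the \<open>j\<close>-th tree.
\<close>

section \<open>Abstract Hilbert spaces\<close>

text \<open>The excluded case is a genuine obstruction: for \<open>a = 1\<close> and one variable
  every \<open>kernel_coeff\<close> equals 1, each summand is the unilateral shift, and degrees
  leave no trace. Away from it two orders of compression are needed. The first-order entries only
  see the numbers (|\<delta>| + a) / (\<delta> k + 1); if a equals the number of variables, they
  agree for \<delta> = (0, ..., 0) and \<delta> = (1, ..., 1). Adding the second order closes this
  gap as soon as there are at least two variables. The given \<open>H1\<close> and \<open>H2\<close>
  are known only through their reproducing property, so nothing can be computed in them until they
  are identified with a concrete space; hence the uniqueness argument for reproducing kernel spaces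
  and the density of kernel sections behind it. The concrete space consists of square-summable
  coefficient families indexed by an exponent and a basis index. The basis indices are pairs
  (\<delta>, k) with k below the multiplicity of \<delta>, so equal multiplicities make two
  coefficient spaces literally equal, and the isomorphism is the identity on coefficients.\<close>

context complex_hilbert_space
begin

abbreviation "C \<equiv> hcarrier H"
abbreviation "ip \<equiv> hinner H"
abbreviation "nm \<equiv> hnorm H"

lemma carrier_intros [intro, simp]:
  "0 \<in> C" "f \<in> C \<Longrightarrow> g \<in> C \<Longrightarrow> f + g \<in> C" "f \<in> C \<Longrightarrow> scale c f \<in> C" "f \<in> C \<Longrightarrow> g \<in> C \<Longrightarrow> f - g \<in> C"
  using carrier_subspace by (auto intro: subspace_0 subspace_add subspace_scale subspace_diff)

lemma diff_conv_scale: "f - g = f + scale (-1) g"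
  by simp

lemma inner_diff: "\<lbrakk>f \<in> C; g \<in> C; h \<in> C\<rbrakk> \<Longrightarrow> ip (f - g) h = ip f h - ip g h"
  unfolding diff_conv_scale by (subst inner_add) (auto simp: inner_scale simp del: scale_minus_left)

lemma inner_zero [simp]: "f \<in> C \<Longrightarrow> ip 0 f = 0" "f \<in> C \<Longrightarrow> ip f 0 = 0"
proof -
  assume "f \<in> C"
  then show "ip 0 f = 0" using inner_scale[of 0 f 0] by simp
  then show "ip f 0 = 0" using inner_commute[of 0 f] \<open>f \<in> C\<close> by simp
qed

lemma inner_add_right: "\<lbrakk>f \<in> C; g \<in> C; h \<in> C\<rbrakk> \<Longrightarrow> ip h (f + g) = ip h f + ip h g"
  using inner_commute[of "f + g" h] inner_add[of f g h] inner_commute[of f h] inner_commute[of g h] by simp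

lemma inner_scale_right: "\<lbrakk>f \<in> C; g \<in> C\<rbrakk> \<Longrightarrow> ip g (scale c f) = cnj c * ip g f"
  using inner_commute[of "scale c f" g] inner_scale[of f g c] inner_commute[of f g] by simp

lemma inner_diff_right: "\<lbrakk>f \<in> C; g \<in> C; h \<in> C\<rbrakk> \<Longrightarrow> ip h (f - g) = ip h f - ip h g"
  unfolding diff_conv_scale
  by (subst inner_add_right) (auto simp: inner_scale_right simp del: scale_minus_left)

lemma norm_sq: "f \<in> C \<Longrightarrow> (nm f)\<^sup>2 = Re (ip f f)"
  by (simp add: hnorm_def inner_nonneg)

lemma inner_self: assumes "f \<in> C" shows "ip f f = complex_of_real ((nm f)\<^sup>2)"
proof -
  have "Im (ip f f) = 0" using inner_commute[OF assms assms] by (metis cnj.simps(2) add.inverse_inverse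
    equal_neg_zero)
  then show ?thesis using norm_sq[OF assms] by (simp add: complex_eq_iff)
qed

lemma norm_nonneg [simp]: "f \<in> C \<Longrightarrow> 0 \<le> nm f"
  by (simp add: hnorm_def inner_nonneg)

lemma norm_eq_0: assumes "f \<in> C" shows "nm f = 0 \<longleftrightarrow> f = 0"
proof
  assume "nm f = 0"
  then have "ip f f = 0" unfolding inner_self[OF assms] by simp
  then show "f = 0" by (rule inner_definite[OF assms])
qed (simp add: hnorm_def)

text \<open>Pythagoras for removing the component of \<open>f\<close> along \<open>g\<close>.
  Nonnegativity of the left side is Cauchy-Schwarz; the strict decrease for a nonzero inner product
  makes the defect of a best approximation orthogonal.\<close>

lemma norm_diff_proj_sq:
  assumes "f \<in> C" "g \<in> C" "g \<noteq> 0"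
  shows "(nm (f - scale (ip f g / ip g g) g))\<^sup>2 = (nm f)\<^sup>2 - (cmod (ip f g))\<^sup>2 / (nm g)\<^sup>2"
proof -
  define t where "t = ip f g / ip g g"
  have g: "nm g \<noteq> 0" using norm_eq_0 assms by simp
  have 1: "t * cnj (ip f g) = complex_of_real ((cmod (ip f g))\<^sup>2 / (nm g)\<^sup>2)"
    unfolding t_def inner_self[OF assms(2)] of_real_divide complex_norm_square by simp
  have 2: "cnj t * ip f g = complex_of_real ((cmod (ip f g))\<^sup>2 / (nm g)\<^sup>2)"
    using arg_cong[OF 1, of cnj] by (simp del: of_real_divide)
  have 3: "t * (cnj t * ip g g) = complex_of_real ((cmod (ip f g))\<^sup>2 / (nm g)\<^sup>2)"
  proof -
    have "t * ip g g = ip f g" using g by (simp add: t_def inner_self[OF assms(2)])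
    then show ?thesis using 2 by (metis mult.commute mult.left_commute)
  qed
  have "ip (f - scale t g) (f - scale t g) = ip f f - complex_of_real ((cmod (ip f g))\<^sup>2 / (nm g)\<^sup>2)"
    using assms 1 2 3 inner_commute[OF assms(1,2)]
    by (simp add: inner_diff inner_diff_right inner_scale inner_scale_right algebra_simps
          del: of_real_divide)
  then show ?thesis using norm_sq assms unfolding t_def by simp
qed

lemma Cauchy_Schwarz: assumes "f \<in> C" "g \<in> C" shows "cmod (ip f g) \<le> nm f * nm g"
proof (cases "g = 0")
  case False
  have g: "nm g > 0" using norm_eq_0 norm_nonneg False assms by (metis less_eq_real_def)
  have "0 \<le> (nm f)\<^sup>2 - (cmod (ip f g))\<^sup>2 / (nm g)\<^sup>2"
    unfolding norm_diff_proj_sq[OF assms False, symmetric] by simp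
  then have "(cmod (ip f g))\<^sup>2 \<le> (nm f * nm g)\<^sup>2" using g by (simp add: field_simps)
  then show ?thesis by (rule power2_le_imp_le) (use assms in simp)
qed (use assms in \<open>simp add: hnorm_def\<close>)

lemma norm_triangle: assumes "f \<in> C" "g \<in> C" shows "nm (f + g) \<le> nm f + nm g"
proof -
  have "(nm (f + g))\<^sup>2 = (nm f)\<^sup>2 + (nm g)\<^sup>2 + 2 * Re (ip f g)"
    using assms inner_commute[OF assms] by (simp add: norm_sq inner_add inner_add_right)
  also have "Re (ip f g) \<le> nm f * nm g"
    using Cauchy_Schwarz[OF assms] complex_Re_le_cmod order_trans by blast
  finally have "(nm (f + g))\<^sup>2 \<le> (nm f + nm g)\<^sup>2" by (simp add: power2_sum)
  then show ?thesis by (rule power2_le_imp_le) (use assms in simp)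
qed

lemma norm_scale: assumes "f \<in> C" shows "nm (scale c f) = cmod c * nm f"
proof -
  have "ip (scale c f) (scale c f) = complex_of_real ((cmod c * nm f)\<^sup>2)"
    using assms inner_self[OF assms] by (simp only: inner_scale inner_scale_right power_mult_distrib
        carrier_intros of_real_mult complex_norm_square mult_ac)
  then have "(nm (scale c f))\<^sup>2 = (cmod c * nm f)\<^sup>2" using assms by (simp add: norm_sq del: of_real_power)
  then show ?thesis using assms by (metis carrier_intros(3) mult_nonneg_nonneg norm_ge_zero norm_nonneg power2_eq_imp_eq)
qed

lemma norm_minus_commute: "f \<in> C \<Longrightarrow> g \<in> C \<Longrightarrow> nm (f - g) = nm (g - f)"
  using norm_scale[of "g - f" "-1"] by simp

lemma parallelogram:
  assumes "f \<in> C" "g \<in> C" shows "(nm (f + g))\<^sup>2 + (nm (f - g))\<^sup>2 = 2 * (nm f)\<^sup>2 + 2 * (nm g)\<^sup>2"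
  using assms by (simp add: norm_sq inner_add inner_add_right inner_diff inner_diff_right)

lemma inner_tendsto:
  assumes "\<And>n. X n \<in> C" "\<And>n. Y n \<in> C" "f \<in> C" "g \<in> C"
    and "(\<lambda>n. nm (X n - f)) \<longlonglongrightarrow> 0" "(\<lambda>n. nm (Y n - g)) \<longlonglongrightarrow> 0"
  shows "(\<lambda>n. ip (X n) (Y n)) \<longlonglongrightarrow> ip f g"
proof -
  have "norm (ip (X n) (Y n) - ip f g) \<le> nm (X n - f) * nm (Y n - g) + nm f * nm (Y n - g) + nm (X n - f) * nm g" for n
  proof -
    have "ip (X n) (Y n) - ip f g = ip (X n - f) (Y n - g) + ip f (Y n - g) + ip (X n - f) g"
      using assms by (simp add: inner_diff inner_diff_right)
    also have "cmod \<dots> \<le> cmod (ip (X n - f) (Y n - g)) + cmod (ip f (Y n - g)) + cmod (ip (X n - f) g)"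
      by (meson norm_triangle_mono order_refl Real_Vector_Spaces.norm_triangle_ineq)
    also have "\<dots> \<le> nm (X n - f) * nm (Y n - g) + nm f * nm (Y n - g) + nm (X n - f) * nm g"
      by (intro add_mono Cauchy_Schwarz) (use assms in auto)
    finally show ?thesis .
  qed
  then have "\<forall>\<^sub>F n in sequentially. norm (ip (X n) (Y n) - ip f g)
      \<le> nm (X n - f) * nm (Y n - g) + nm f * nm (Y n - g) + nm (X n - f) * nm g"
    by (rule always_eventually[OF allI])
  moreover have "(\<lambda>n. nm (X n - f) * nm (Y n - g) + nm f * nm (Y n - g) + nm (X n - f) * nm g) \<longlonglongrightarrow> 0"
    using tendsto_add[OF tendsto_add[OF tendsto_mult[OF assms(5,6)]
        tendsto_mult[OF tendsto_const[of "nm f"] assms(6)]] tendsto_mult[OF assms(5) tendsto_const[of "nm g"]]]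
    by simp
  ultimately have "(\<lambda>n. ip (X n) (Y n) - ip f g) \<longlonglongrightarrow> 0"
    by (rule Lim_null_comparison)
  then show ?thesis by (simp add: LIM_zero_iff)
qed

text \<open>The limit of a minimising sequence of distances from \<open>h\<close> is the projection of \<open>h\<close>, and
  \<open>h\<close> minus its projection is orthogonal to \<open>S\<close>.\<close>

lemma dense_if_orthogonal_trivial:
  assumes S: "subspace S" "S \<subseteq> C" and orth: "\<And>f. \<lbrakk>f \<in> C; \<forall>s\<in>S. ip f s = 0\<rbrakk> \<Longrightarrow> f = 0"
    and h: "h \<in> C"
  obtains X where "\<And>n. X n \<in> S" "(\<lambda>n. nm (X n - h)) \<longlonglongrightarrow> 0"
proof -
  define d where "d = (INF s\<in>S. (nm (h - s))\<^sup>2)"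
  have SC: "s \<in> C" if "s \<in> S" for s using S that by auto
  have ne: "S \<noteq> {}" using subspace_0[OF S(1)] by auto
  have bdd: "bdd_below ((\<lambda>s. (nm (h - s))\<^sup>2) ` S)" by (rule bdd_belowI[of _ 0]) auto
  have d_le: "d \<le> (nm (h - s))\<^sup>2" if "s \<in> S" for s
    unfolding d_def by (rule cINF_lower[OF bdd that])
  have "\<exists>s\<in>S. (nm (h - s))\<^sup>2 < d + inverse (real (Suc n))" for n
    using cINF_less_iff[OF ne bdd, of "d + inverse (real (Suc n))"] unfolding d_def by simp
  then obtain X where X: "\<And>n. X n \<in> S" "\<And>n. (nm (h - X n))\<^sup>2 < d + inverse (real (Suc n))" by metis
  have XC: "X n \<in> C" for n using X SC by auto
  have cau: "(nm (X m - X n))\<^sup>2 \<le> 2 * inverse (real (Suc m)) + 2 * inverse (real (Suc n))" for m n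
  proof -
    \<comment> \<open>The midpoint lies in \<open>S\<close>, so its squared distance from
      \<open>h\<close> is at least \<open>d\<close>; by the parallelogram law two near-minimisers
      are then as close as their excesses over \<open>d\<close> allow.\<close>
    let ?M = "scale (1/2) (X m + X n)"
    have M: "?M \<in> S" using X S by (auto intro: subspace_scale subspace_add)
    have e1: "(h - X n) + (h - X m) = scale 2 (h - ?M)"
    proof -
      have "scale 2 h = h + h" using scale_left_distrib[of 1 1 h] by simp
      then show ?thesis by (simp add: scale_right_diff_distrib)
    qed
    have e2: "(h - X n) - (h - X m) = X m - X n" by simp
    have "(nm (scale 2 (h - ?M)))\<^sup>2 + (nm (X m - X n))\<^sup>2 = 2 * (nm (h - X n))\<^sup>2 + 2 * (nm (h - X m))\<^sup>2"
      using parallelogram[of "h - X n" "h - X m"] e1 e2 XC h by simp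
    moreover have "(nm (scale 2 (h - ?M)))\<^sup>2 = 4 * (nm (h - ?M))\<^sup>2"
      using norm_scale[of "h - ?M" 2] M SC h by (simp add: power_mult_distrib del: scale_right_diff_distrib)
    ultimately show ?thesis using d_le[OF M] X(2)[of m] X(2)[of n] by linarith
  qed
  have Cau: "\<forall>e>0. \<exists>N. \<forall>m\<ge>N. \<forall>n\<ge>N. nm (X m - X n) < e"
  proof (intro allI impI)
    fix e :: real assume e: "e > 0"
    obtain N where N: "inverse (real (Suc N)) < e\<^sup>2 / 4" using reals_Archimedean[of "e\<^sup>2/4"] e by auto
    have "nm (X m - X n) < e" if "m \<ge> N" "n \<ge> N" for m n
    proof -
      have "inverse (real (Suc m)) \<le> inverse (real (Suc N))" "inverse (real (Suc n)) \<le> inverse (real (Suc N))"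
        using that by (auto simp: field_simps)
      then have "(nm (X m - X n))\<^sup>2 < e\<^sup>2" using cau[of m n] N by linarith
      then show ?thesis using e by (simp add: power2_less_imp_less)
    qed
    then show "\<exists>N. \<forall>m\<ge>N. \<forall>n\<ge>N. nm (X m - X n) < e" by auto
  qed
  obtain L where L: "L \<in> C" "(\<lambda>n. nm (X n - L)) \<longlonglongrightarrow> 0" using complete[OF XC Cau] by auto
  have lim: "(\<lambda>n. (nm (h - X n - g))\<^sup>2) \<longlonglongrightarrow> (nm (h - L - g))\<^sup>2" if g: "g \<in> C" for g
  proof -
    have *: "(\<lambda>n. nm ((h - X n - g) - (h - L - g))) \<longlonglongrightarrow> 0"
      using L norm_minus_commute[OF L(1) XC] by simp
    have "(\<lambda>n. Re (ip (h - X n - g) (h - X n - g))) \<longlonglongrightarrow> Re (ip (h - L - g) (h - L - g))"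
      by (intro tendsto_Re inner_tendsto *) (use g L XC h in auto)
    then show ?thesis using g L XC h by (simp add: norm_sq)
  qed
  have "ip (h - L) s = 0" if s: "s \<in> S" for s
  proof (cases "s = 0")
    case False
    have sC: "s \<in> C" using s SC by auto
    \<comment> \<open>For a nonzero inner product, moving from \<open>L\<close> by
      \<open>scale t s\<close> would lower the squared distance below \<open>d\<close>. As
      \<open>L\<close> need not lie in \<open>S\<close>, the bound by \<open>d\<close> is taken from
      the elements \<open>X n + scale t s\<close> in the limit.\<close>
    define t where "t = ip (h - L) s / ip s s"
    have "d \<le> (nm (h - L - scale t s))\<^sup>2"
    proof (rule LIMSEQ_le_const[OF lim])
      show "scale t s \<in> C" using sC by simp
      have "d \<le> (nm (h - X n - scale t s))\<^sup>2" for n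
        using d_le[of "X n + scale t s"] X(1)[of n] s S by (simp add: diff_diff_eq subspace_add subspace_scale)
      then show "\<exists>N. \<forall>n\<ge>N. d \<le> (nm (h - X n - scale t s))\<^sup>2" by auto
    qed
    moreover have "(nm (h - L))\<^sup>2 \<le> d"
    proof (rule LIMSEQ_le[of "\<lambda>n. (nm (h - X n - 0))\<^sup>2" _ "\<lambda>n. d + inverse (real (Suc n))"])
      show "(\<lambda>n. (nm (h - X n - 0))\<^sup>2) \<longlonglongrightarrow> (nm (h - L))\<^sup>2" using lim[of 0] by simp
      show "(\<lambda>n. d + inverse (real (Suc n))) \<longlonglongrightarrow> d"
        by (rule LIMSEQ_inverse_real_of_nat_add)
    qed (use X(2) less_imp_le in auto)
    ultimately have "(cmod (ip (h - L) s))\<^sup>2 / (nm s)\<^sup>2 \<le> 0"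
      using norm_diff_proj_sq[of "h - L" s] False sC L h unfolding t_def by simp
    moreover have "nm s > 0" using norm_eq_0 norm_nonneg False sC by (metis less_eq_real_def)
    ultimately show ?thesis by (simp add: divide_le_0_iff zero_less_power)
  qed (use L h in simp)
  then have "h - L = 0" using orth[of "h - L"] L h by auto
  then have "h = L" by simp
  with L(2) have "(\<lambda>n. nm (X n - h)) \<longlonglongrightarrow> 0" by simp
  with X(1) show ?thesis by (rule that)
qed

end

text \<open>Lets a space of functions inherit completeness from its coefficient space. Linearity of
  \<open>J\<close> is asked only on the carrier, because sums of series can be added only where the
  series converge.\<close>

lemma hilbert_space_transport:
  assumes "complex_hilbert_space s H" "vector_space s'"
    and add: "\<And>f g. \<lbrakk>f \<in> hcarrier H; g \<in> hcarrier H\<rbrakk> \<Longrightarrow> J (f + g) = J f + J g"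
    and scl: "\<And>c f. f \<in> hcarrier H \<Longrightarrow> J (s c f) = s' c (J f)"
    and H': "hcarrier H' = J ` hcarrier H"
      "\<And>f g. \<lbrakk>f \<in> hcarrier H; g \<in> hcarrier H\<rbrakk> \<Longrightarrow> hinner H' (J f) (J g) = hinner H f g"
  shows "complex_hilbert_space s' H'"
proof -
  interpret complex_hilbert_space s H by (rule assms(1))
  interpret V: vector_space s' by (rule assms(2))
  have J0: "J 0 = 0" using add[of 0 0] carrier_intros(1) by (metis add_cancel_right_left)
  have diff: "J (f - g) = J f - J g" if "f \<in> C" "g \<in> C" for f g
    using add[of "f - g" g] carrier_intros(4)[OF that] that(2) by (metis add_diff_cancel_right' diff_add_cancel)
  have norm: "hnorm H' (J f) = nm f" if "f \<in> C" for f using that H'(2) by (simp add: hnorm_def)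
  show ?thesis
  proof
    show "V.subspace (hcarrier H')"
      unfolding V.subspace_def H'(1)
    proof (intro conjI ballI allI)
      show "0 \<in> J ` C" using J0 by (metis carrier_intros(1) imageI)
    next
      fix x y assume "x \<in> J ` C" "y \<in> J ` C"
      then show "x + y \<in> J ` C" using add by (metis (no_types, lifting) carrier_intros(2) image_iff)
    next
      fix c x assume "x \<in> J ` C"
      then show "s' c x \<in> J ` C" using scl by (metis (no_types, lifting) carrier_intros(3) image_iff)
    qed
  next
    fix f g h assume "f \<in> hcarrier H'" "g \<in> hcarrier H'" "h \<in> hcarrier H'"
    then obtain f' g' h' where [simp]: "f = J f'" "g = J g'" "h = J h'" "f' \<in> C" "g' \<in> C" "h' \<in> C"
      by (auto simp: H'(1))
    show "hinner H' (f + g) h = hinner H' f h + hinner H' g h"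
      by (simp add: H'(2) add[symmetric] inner_add)
  next
    fix c f g assume "f \<in> hcarrier H'" "g \<in> hcarrier H'"
    then obtain f' g' where [simp]: "f = J f'" "g = J g'" "f' \<in> C" "g' \<in> C" by (auto simp: H'(1))
    show "hinner H' (s' c f) g = c * hinner H' f g"
      by (simp add: H'(2) scl[symmetric] inner_scale)
    show "hinner H' g f = cnj (hinner H' f g)"
      by (simp add: H'(2) inner_commute[of f' g'])
  next
    fix f assume "f \<in> hcarrier H'"
    then obtain f' where [simp]: "f = J f'" "f' \<in> C" by (auto simp: H'(1))
    show "0 \<le> Re (hinner H' f f)" by (simp add: H'(2) inner_nonneg)
    assume "hinner H' f f = 0"
    then show "f = 0" using J0 inner_definite[of f'] by (simp add: H'(2))
  next
    fix X :: "nat \<Rightarrow> _" assume X: "\<And>n. X n \<in> hcarrier H'"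
      and c: "\<forall>e>0. \<exists>N. \<forall>m\<ge>N. \<forall>n\<ge>N. hnorm H' (X m - X n) < e"
    have "\<exists>Y. \<forall>n. Y n \<in> C \<and> X n = J (Y n)" using X unfolding H'(1) by (intro choice) auto
    then obtain Y where Y: "\<And>n. Y n \<in> C" "\<And>n. X n = J (Y n)" by auto
    have eq: "hnorm H' (J f - J g) = nm (f - g)" if "f \<in> C" "g \<in> C" for f g
      using that by (simp add: diff[symmetric] norm)
    obtain L where "L \<in> C" "(\<lambda>n. nm (Y n - L)) \<longlonglongrightarrow> 0"
      using complete[of Y] Y c eq by auto
    then show "\<exists>L\<in>hcarrier H'. (\<lambda>n. hnorm H' (X n - L)) \<longlonglongrightarrow> 0"
      using Y eq by (intro bexI[of _ "J L"]) (auto simp: H'(1))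
  qed
qed

section \<open>Square-summable functions\<close>

lemma sum_fun_apply: "(\<Sum>i\<in>I. f i) x = (\<Sum>i\<in>I. f i x)"
  by (induction I rule: infinite_finite_induct) auto

lemma vector_space_fun: "vector_space (\<lambda>(c::complex) f (v::'v). c * f v)"
  by unfold_locales (auto simp: fun_eq_iff algebra_simps)

lemma vector_space_fun2: "vector_space (\<lambda>(c::complex) f (z::'z) (v::'v). c * f z v)"
  by unfold_locales (auto simp: fun_eq_iff algebra_simps)

lemma l2_sq_summable:
  assumes "f \<in> l2 A" shows "(\<lambda>v. (cmod (f v))\<^sup>2) summable_on B"
proof -
  have "(\<lambda>v. (cmod (f v))\<^sup>2) summable_on UNIV"
    by (subst summable_on_cong_neutral[of A UNIV "\<lambda>v. (cmod (f v))\<^sup>2" "\<lambda>v. (cmod (f v))\<^sup>2"])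
      (use assms in \<open>auto simp: l2_def\<close>)
  then show ?thesis by (rule summable_on_subset_banach) auto
qed

lemma l2I: "\<lbrakk>\<And>v. v \<notin> A \<Longrightarrow> f v = 0; (\<lambda>v. (cmod (f v))\<^sup>2) summable_on A\<rbrakk> \<Longrightarrow> f \<in> l2 A"
  by (simp add: l2_def)

lemma l2_off: "f \<in> l2 A \<Longrightarrow> v \<notin> A \<Longrightarrow> f v = 0"
  by (simp add: l2_def)

lemma l2_finite_support: "\<lbrakk>finite S; \<And>v. v \<notin> S \<Longrightarrow> f v = 0; S \<subseteq> A\<rbrakk> \<Longrightarrow> f \<in> l2 A"
  by (rule l2I, blast, subst summable_on_cong_neutral[of S A "\<lambda>v. (cmod (f v))\<^sup>2" "\<lambda>v. (cmod (f v))\<^sup>2"]) auto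

lemma l2_mult_abs_summable:
  assumes "f \<in> l2 A" "g \<in> l2 B" shows "(\<lambda>v. norm (f v * g v)) summable_on C"
proof (rule summable_on_comparison_test)
  show "(\<lambda>v. (cmod (f v))\<^sup>2 + (cmod (g v))\<^sup>2) summable_on C"
    by (intro summable_on_add l2_sq_summable[OF assms(1)] l2_sq_summable[OF assms(2)])
  show "norm (f v * g v) \<le> (cmod (f v))\<^sup>2 + (cmod (g v))\<^sup>2" for v
    using sum_squares_bound[of "cmod (f v)" "cmod (g v)"]
      mult_nonneg_nonneg[of "cmod (f v)" "cmod (g v)"] norm_ge_zero[of "f v"] norm_ge_zero[of "g v"]
    unfolding norm_mult by linarith
qed simp

lemma l2_cnj: "f \<in> l2 A \<Longrightarrow> (\<lambda>v. cnj (f v)) \<in> l2 A"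
  by (simp add: l2_def)

lemma l2_inner_summable: "\<lbrakk>f \<in> l2 A; g \<in> l2 B\<rbrakk> \<Longrightarrow> (\<lambda>v. f v * cnj (g v)) summable_on C"
  by (rule Infinite_Sum.abs_summable_summable[OF l2_mult_abs_summable[OF _ l2_cnj]])

lemma l2_zero: "0 \<in> l2 A" by (simp add: l2_def)

lemma l2_add: assumes "f \<in> l2 A" "g \<in> l2 A" shows "f + g \<in> l2 A"
proof (rule l2I)
  show "(f + g) v = 0" if "v \<notin> A" for v using assms[THEN l2_off, OF that] by simp
  have "(cmod ((f + g) v))\<^sup>2 \<le> 2 * (cmod (f v))\<^sup>2 + 2 * (cmod (g v))\<^sup>2" for v
  proof -
    have "(cmod ((f + g) v))\<^sup>2 \<le> (cmod (f v) + cmod (g v))\<^sup>2"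
      by (intro power_mono) (auto simp: norm_triangle_ineq)
    then show ?thesis using sum_squares_bound[of "cmod (f v)" "cmod (g v)"] by (simp add: power2_sum)
  qed
  note le = this
  have "(\<lambda>v. 2 * (cmod (f v))\<^sup>2 + 2 * (cmod (g v))\<^sup>2) summable_on A"
    by (intro summable_on_add summable_on_cmult_right l2_sq_summable[OF assms(1)] l2_sq_summable[OF assms(2)])
  then show "(\<lambda>v. (cmod ((f + g) v))\<^sup>2) summable_on A"
    by (rule summable_on_comparison_test[OF _ le]) simp
qed

lemma l2_scale: assumes "f \<in> l2 A" shows "(\<lambda>v. c * f v) \<in> l2 A"
  using assms by (auto simp: l2_def norm_mult power_mult_distrib intro!: summable_on_cmult_right)

lemma l2_diff: assumes "f \<in> l2 A" "g \<in> l2 A" shows "f - g \<in> l2 A"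
proof -
  have "f - g = f + (\<lambda>v. (-1) * g v)" by (auto simp: fun_eq_iff)
  then show ?thesis using l2_add[OF assms(1) l2_scale[OF assms(2)]] by metis
qed

lemma l2_inner_add: "\<lbrakk>f \<in> l2 A; g \<in> l2 A; h \<in> l2 B\<rbrakk> \<Longrightarrow> l2_inner (f + g) h = l2_inner f h + l2_inner g h"
  by (simp add: l2_inner_def distrib_right infsum_add l2_inner_summable)

lemma l2_inner_diff: "\<lbrakk>f \<in> l2 A; g \<in> l2 A; h \<in> l2 B\<rbrakk> \<Longrightarrow> l2_inner (f - g) h = l2_inner f h - l2_inner g h"
  using l2_inner_add[of "f - g" A g h] l2_diff by fastforce

lemma l2_inner_scale: "l2_inner (\<lambda>v. c * f v) g = c * l2_inner f g"
  by (simp add: l2_inner_def mult.assoc infsum_cmult_right')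

lemma l2_inner_commute: "l2_inner g f = cnj (l2_inner f g)"
  by (simp add: l2_inner_def mult.commute flip: infsum_cnj)

lemma infsum_of_real_complex: "(\<Sum>\<^sub>\<infinity>v\<in>A. complex_of_real (f v)) = complex_of_real (\<Sum>\<^sub>\<infinity>v\<in>A. f v)"
proof (cases "f summable_on A")
  case True
  then show ?thesis by (intro infsumI has_sum_of_real has_sum_infsum)
next
  \<comment> \<open>Without summability both infinite sums are the default value 0.\<close>
  case False
  moreover from this have "\<not> (\<lambda>v. complex_of_real (f v)) summable_on A"
    using summable_on_Re by fastforce
  ultimately show ?thesis by (simp add: infsum_not_exists)
qed

lemma l2_inner_self: "l2_inner f f = complex_of_real (\<Sum>\<^sub>\<infinity>v. (cmod (f v))\<^sup>2)"
proof -
  have "(\<Sum>\<^sub>\<infinity>v. complex_of_real ((cmod (f v))\<^sup>2)) = complex_of_real (\<Sum>\<^sub>\<infinity>v. (cmod (f v))\<^sup>2)"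
    by (rule infsum_of_real_complex)
  then show ?thesis by (simp add: l2_inner_def flip: complex_norm_square)
qed

lemma l2_inner_definite: assumes "f \<in> l2 A" "l2_inner f f = 0" shows "f = 0"
proof
  fix v
  have "(\<Sum>\<^sub>\<infinity>v. (cmod (f v))\<^sup>2) = 0" using assms(2) unfolding l2_inner_self by simp
  then have "(cmod (f v))\<^sup>2 = 0"
    using nonneg_infsum_le_0D[of "\<lambda>v. (cmod (f v))\<^sup>2" UNIV v] l2_sq_summable[OF assms(1)] by auto
  then show "f v = 0 v" by simp
qed

lemma l2_inner_finite:
  assumes "finite S" "\<And>v. v \<notin> S \<Longrightarrow> f v = 0 \<or> g v = 0" shows "l2_inner f g = (\<Sum>v\<in>S. f v * cnj (g v))"
  unfolding l2_inner_def using assms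
  by (subst infsum_cong_neutral[of S UNIV "\<lambda>v. f v * cnj (g v)" "\<lambda>v. f v * cnj (g v)"]) auto

lemma l2_sum: "\<lbrakk>\<And>i. i \<in> J \<Longrightarrow> f i \<in> l2 A\<rbrakk> \<Longrightarrow> (\<Sum>i\<in>J. f i) \<in> l2 A"
  by (induction J rule: infinite_finite_induct) (auto simp: l2_zero l2_add)

lemma l2_inner_sum:
  assumes "x \<in> l2 A" "\<And>i. i \<in> J \<Longrightarrow> f i \<in> l2 A"
  shows "l2_inner (\<Sum>i\<in>J. f i) x = (\<Sum>i\<in>J. l2_inner (f i) x)"
  using assms(2)
proof (induction J rule: infinite_finite_induct)
  case (insert i J)
  then have "f i \<in> l2 A" "(\<Sum>i\<in>J. f i) \<in> l2 A" by (auto intro: l2_sum)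
  from l2_inner_add[OF this assms(1)] show ?case
    unfolding sum.insert[OF insert.hyps] using insert by (simp del: plus_fun_apply)
qed (simp_all add: l2_inner_finite[of "{}"])

section \<open>Completeness of the space of square-summable functions\<close>

definition l2_space :: "'v set \<Rightarrow> ('v \<Rightarrow> complex) hspace" where
  "l2_space A = \<lparr>hcarrier = l2 A, hinner = l2_inner\<rparr>"

lemma l2_space_simps [simp]: "hcarrier (l2_space A) = l2 A" "hinner (l2_space A) = l2_inner"
  by (simp_all add: l2_space_def)

lemma l2_norm_sq: "(hnorm (l2_space A) f)\<^sup>2 = (\<Sum>\<^sub>\<infinity>v. (cmod (f v))\<^sup>2)"
  by (simp add: hnorm_def l2_inner_self infsum_nonneg)

lemma l2_finite_sum_le: "\<lbrakk>f \<in> l2 A; finite F\<rbrakk> \<Longrightarrow> (\<Sum>v\<in>F. (cmod (f v))\<^sup>2) \<le> (hnorm (l2_space A) f)\<^sup>2"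
  unfolding l2_norm_sq by (rule finite_sum_le_infsum) (auto intro: l2_sq_summable)

lemma l2_norm_leI:
  assumes "\<And>v. v \<notin> A \<Longrightarrow> f v = 0" "\<And>F. finite F \<Longrightarrow> (\<Sum>v\<in>F. (cmod (f v))\<^sup>2) \<le> e\<^sup>2" "e \<ge> 0"
  shows "f \<in> l2 A" "hnorm (l2_space A) f \<le> e"
proof -
  have "(\<lambda>v. (cmod (f v))\<^sup>2) summable_on A"
    by (rule nonneg_bdd_above_summable_on) (auto intro!: bdd_aboveI[of _ "e\<^sup>2"] assms(2))
  then show f: "f \<in> l2 A" using assms(1) by (intro l2I) auto
  have "(hnorm (l2_space A) f)\<^sup>2 \<le> e\<^sup>2" unfolding l2_norm_sq
    by (rule infsum_le_finite_sums) (use l2_sq_summable[OF f] assms(2) in auto)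
  then show "hnorm (l2_space A) f \<le> e" using assms(3) by (rule power2_le_imp_le)
qed

lemma l2_complete:
  assumes X: "\<And>n. X n \<in> l2 A"
    and cau: "\<forall>e>0. \<exists>N. \<forall>m\<ge>N. \<forall>n\<ge>N. hnorm (l2_space A) (X m - X n) < e"
  shows "\<exists>L\<in>l2 A. (\<lambda>n. hnorm (l2_space A) (X n - L)) \<longlonglongrightarrow> 0"
proof -
  let ?n = "hnorm (l2_space A)"
  have nn: "0 \<le> ?n f" for f by (simp add: hnorm_def l2_inner_self infsum_nonneg)
  have pt: "cmod (f v) \<le> ?n f" if "f \<in> l2 A" for f v
    by (rule power2_le_imp_le[OF _ nn]) (use l2_finite_sum_le[OF that, of "{v}"] in simp)
  have "Cauchy (\<lambda>n. X n v)" for v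
  proof (rule metric_CauchyI)
    fix e :: real assume "e > 0"
    then obtain N where N: "\<And>m n. m \<ge> N \<Longrightarrow> n \<ge> N \<Longrightarrow> ?n (X m - X n) < e" using cau by blast
    have "dist (X m v) (X n v) < e" if "m \<ge> N" "n \<ge> N" for m n
      using pt[OF l2_diff[OF X[of m] X[of n]], of v] N[OF that] by (simp add: dist_norm)
    then show "\<exists>M. \<forall>m\<ge>M. \<forall>n\<ge>M. dist (X m v) (X n v) < e" by blast
  qed
  then have "\<exists>L. \<forall>v. (\<lambda>n. X n v) \<longlonglongrightarrow> L v"
    by (intro choice) (auto simp: Cauchy_convergent_iff convergent_def)
  then obtain L where L: "\<And>v. (\<lambda>n. X n v) \<longlonglongrightarrow> L v" by blast
  have L0: "L v = 0" if "v \<notin> A" for v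
    using L[of v] l2_off[OF X that] LIMSEQ_unique[of "\<lambda>_. 0"] by auto
  \<comment> \<open>Each finite partial sum is bounded before the pointwise limit is taken. This
    yields membership and smallness of the difference at once, without knowing beforehand that
    \<open>L\<close> is square-summable.\<close>
  have key: "X n - L \<in> l2 A \<and> ?n (X n - L) \<le> e"
    if e: "e > 0" and N: "\<And>m. m \<ge> N \<Longrightarrow> ?n (X n - X m) < e" for e n N
  proof -
    have "(\<Sum>v\<in>F. (cmod ((X n - L) v))\<^sup>2) \<le> e\<^sup>2" if F: "finite F" for F
    proof (rule LIMSEQ_le_const2)
      show "(\<lambda>m. \<Sum>v\<in>F. (cmod ((X n - X m) v))\<^sup>2) \<longlonglongrightarrow> (\<Sum>v\<in>F. (cmod ((X n - L) v))\<^sup>2)"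
        unfolding fun_diff_def by (intro tendsto_sum tendsto_power tendsto_norm tendsto_diff tendsto_const L)
      have "(\<Sum>v\<in>F. (cmod ((X n - X m) v))\<^sup>2) \<le> e\<^sup>2" if m: "m \<ge> N" for m
      proof -
        have "(?n (X n - X m))\<^sup>2 \<le> e\<^sup>2" by (intro power_mono nn less_imp_le[OF N[OF m]])
        with l2_finite_sum_le[OF l2_diff[OF X[of n] X[of m]] F] show ?thesis by linarith
      qed
      then show "\<exists>N. \<forall>m\<ge>N. (\<Sum>v\<in>F. (cmod ((X n - X m) v))\<^sup>2) \<le> e\<^sup>2" by blast
    qed
    then show ?thesis using l2_norm_leI[of A "X n - L" e] e L0 l2_off[OF X] by simp
  qed
  obtain N1 where N1: "\<And>m. m \<ge> N1 \<Longrightarrow> ?n (X N1 - X m) < 1" using cau[rule_format, of 1] by auto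
  have "X N1 - L \<in> l2 A" using key[OF zero_less_one N1] by blast
  from l2_diff[OF X[of N1] this] have LA: "L \<in> l2 A" by (simp only: diff_diff_eq2 add_diff_cancel_left')
  have "(\<lambda>n. ?n (X n - L)) \<longlonglongrightarrow> 0"
  proof (rule LIMSEQ_I)
    fix r :: real assume r: "r > 0"
    obtain N where N: "\<And>m n. m \<ge> N \<Longrightarrow> n \<ge> N \<Longrightarrow> ?n (X m - X n) < r / 2"
      using cau[rule_format, of "r/2"] r by auto
    have "norm (?n (X n - L) - 0) < r" if "n \<ge> N" for n
      using key[of "r/2" N n] N[OF that] r nn[of "X n - L"] by fastforce
    then show "\<exists>N. \<forall>n\<ge>N. norm (?n (X n - L) - 0) < r" by blast
  qed
  then show ?thesis using LA by blast
qed

lemma l2_hilbert: "complex_hilbert_space (\<lambda>c f v. c * f v) (l2_space A)"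
proof -
  interpret vector_space "\<lambda>(c::complex) f (v::'a). c * f v" by (rule vector_space_fun)
  show ?thesis
  proof
    show "subspace (hcarrier (l2_space A))"
      by (simp add: subspace_def l2_zero l2_add l2_scale)
    show "\<exists>L\<in>hcarrier (l2_space A). (\<lambda>n. hnorm (l2_space A) (X n - L)) \<longlonglongrightarrow> 0"
      if "\<And>n. X n \<in> hcarrier (l2_space A)"
        "\<forall>e>0. \<exists>N. \<forall>m\<ge>N. \<forall>n\<ge>N. hnorm (l2_space A) (X m - X n) < e" for X
      using l2_complete[of X A] that by simp
    show "hinner (l2_space A) g f = cnj (hinner (l2_space A) f g)" for f g
      by (simp only: l2_space_simps l2_inner_commute[of g f])
    show "f = 0" if "f \<in> hcarrier (l2_space A)" "hinner (l2_space A) f f = 0" for f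
      using that l2_inner_definite by simp
  qed (simp_all add: l2_inner_scale l2_inner_self infsum_nonneg l2_inner_add)
qed

section \<open>Uniqueness of reproducing kernel Hilbert spaces\<close>

text \<open>Half of the uniqueness of a reproducing kernel space; the other half is the same lemma
  with the spaces exchanged. The span of the kernel sections lies in both spaces with the same inner
  product and is dense in \<open>H\<close>. A sequence from it that converges in \<open>H\<close> is
  Cauchy in \<open>M\<close>, and the two limits agree because point evaluations are
  continuous.\<close>

lemma rkhs_subset:
  assumes H: "is_rkhs X E K H" and M: "is_rkhs X E K M"
    and E: "E \<subseteq> l2 A" "\<And>x y. \<lbrakk>x \<in> E; y \<in> E\<rbrakk> \<Longrightarrow> x - y \<in> E"
  shows "hcarrier H \<subseteq> hcarrier M \<and> (\<forall>f\<in>hcarrier H. \<forall>g\<in>hcarrier H. hinner M f g = hinner H f g)"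
proof -
  interpret H: complex_hilbert_space "\<lambda>c h z v. c * h z v" H using H by (simp add: is_rkhs_def)
  interpret M: complex_hilbert_space "\<lambda>c h z v. c * h z v" M using M by (simp add: is_rkhs_def)
  define Q where "Q = {ksection X K w x |w x. w \<in> X \<and> x \<in> E}"
  define S where "S = H.span Q"
  have QH: "Q \<subseteq> H.C" and QM: "Q \<subseteq> M.C" using H M by (auto simp: Q_def is_rkhs_def)
  have SH: "S \<subseteq> H.C" unfolding S_def by (rule H.span_minimal[OF QH H.carrier_subspace])
  have SM: "S \<subseteq> M.C" unfolding S_def by (rule H.span_minimal[OF QM M.carrier_subspace])
  have repH: "H.ip h (ksection X K w x) = l2_inner (h w) x" if "h \<in> H.C" "w \<in> X" "x \<in> E" for h w x
    using H that by (auto simp: is_rkhs_def)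
  have repM: "M.ip h (ksection X K w x) = l2_inner (h w) x" if "h \<in> M.C" "w \<in> X" "x \<in> E" for h w x
    using M that by (auto simp: is_rkhs_def)
  have valH: "h w \<in> E" if "h \<in> H.C" "w \<in> X" for h w using H that by (auto simp: is_rkhs_def)
  have valM: "h w \<in> E" if "h \<in> M.C" "w \<in> X" for h w using M that by (auto simp: is_rkhs_def)
  have offH: "h w = 0" if "h \<in> H.C" "w \<notin> X" for h w using H that by (auto simp: is_rkhs_def)
  have offM: "h w = 0" if "h \<in> M.C" "w \<notin> X" for h w using M that by (auto simp: is_rkhs_def)
  have ip_eq: "M.ip f g = H.ip f g" if f: "f \<in> S" and g: "g \<in> S" for f g
  proof -
    have fH: "f \<in> H.C" and fM: "f \<in> M.C" using f SH SM by auto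
    have "g \<in> H.C \<and> g \<in> M.C \<and> M.ip f g = H.ip f g"
      using g unfolding S_def
    proof (rule H.span_induct)
      fix x assume "x \<in> Q"
      then obtain w y where wy: "w \<in> X" "y \<in> E" "x = ksection X K w y" by (auto simp: Q_def)
      then show "x \<in> H.C \<and> x \<in> M.C \<and> M.ip f x = H.ip f x"
        using QH QM \<open>x \<in> Q\<close> repH[OF fH wy(1,2)] repM[OF fM wy(1,2)] by auto
    next
      show "H.subspace {g. g \<in> H.C \<and> g \<in> M.C \<and> M.ip f g = H.ip f g}"
        unfolding H.subspace_def
        using fH fM by (auto simp: H.inner_add_right M.inner_add_right H.inner_scale_right M.inner_scale_right)
    qed
    then show ?thesis by simp
  qed
  have nm_eq: "M.nm f = H.nm f" if "f \<in> S" for f using ip_eq that by (simp add: hnorm_def)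
  have Ssub: "H.subspace S" unfolding S_def by (rule H.subspace_span)
  have orth: "f = 0" if f: "f \<in> H.C" "\<forall>s\<in>S. H.ip f s = 0" for f
  proof
    fix w show "f w = 0 w"
    proof (cases "w \<in> X")
      case True
      \<comment> \<open>The section at \<open>w\<close> in the direction \<open>f w\<close> tests
        \<open>f\<close> against its own value there.\<close>
      have "ksection X K w (f w) \<in> S" unfolding S_def
        by (rule H.span_base) (use True valH[OF f(1)] in \<open>auto simp: Q_def\<close>)
      then have "l2_inner (f w) (f w) = 0" using f(2) repH[OF f(1) True valH[OF f(1) True]] by simp
      then show ?thesis using l2_inner_definite[of "f w" A] valH[OF f(1) True] E(1) by auto
    qed (use offH[OF f(1)] in \<open>simp add: fun_eq_iff\<close>)
  qed
  have approx: "\<exists>Y. (\<forall>n. Y n \<in> S) \<and> (\<lambda>n. H.nm (Y n - h)) \<longlonglongrightarrow> 0 \<and> h \<in> M.C \<and> (\<lambda>n. M.nm (Y n - h)) \<longlonglongrightarrow> 0"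
    if h: "h \<in> H.C" for h
  proof -
    obtain Y where Y: "\<And>n. Y n \<in> S" "(\<lambda>n. H.nm (Y n - h)) \<longlonglongrightarrow> 0"
      using H.dense_if_orthogonal_trivial[OF Ssub SH orth h] by blast
    have YH: "Y n \<in> H.C" and YM: "Y n \<in> M.C" for n using Y(1) SH SM by auto
    have "\<forall>e>0. \<exists>N. \<forall>m\<ge>N. \<forall>n\<ge>N. M.nm (Y m - Y n) < e"
    proof (intro allI impI)
      fix e :: real assume e: "e > 0"
      obtain N where N: "\<And>n. n \<ge> N \<Longrightarrow> norm (H.nm (Y n - h)) < e / 2"
        using LIMSEQ_D[OF Y(2), of "e / 2"] e by auto
      have "M.nm (Y m - Y n) < e" if "m \<ge> N" "n \<ge> N" for m n
      proof -
        have "H.nm ((Y m - h) + (h - Y n)) \<le> H.nm (Y m - h) + H.nm (h - Y n)"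
          by (rule H.norm_triangle) (use YH h in auto)
        moreover have "(Y m - h) + (h - Y n) = Y m - Y n" by (simp only: diff_add_cancel add_diff_eq)
        moreover have "M.nm (Y m - Y n) = H.nm (Y m - Y n)" using nm_eq Y(1) Ssub by (simp add: H.subspace_diff)
        moreover have "H.nm (h - Y n) = H.nm (Y n - h)" by (rule H.norm_minus_commute) (use YH h in auto)
        ultimately show ?thesis using N[OF that(1)] N[OF that(2)] unfolding real_norm_def by simp
      qed
      then show "\<exists>N. \<forall>m\<ge>N. \<forall>n\<ge>N. M.nm (Y m - Y n) < e" by blast
    qed
    from M.complete[OF YM this] obtain L where L: "L \<in> M.C" "(\<lambda>n. M.nm (Y n - L)) \<longlonglongrightarrow> 0"
      by blast
    have "h w = L w" for w
    proof (cases "w \<in> X")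
      case True
      \<comment> \<open>The difference of the two limits at \<open>w\<close> serves as its own test
        vector; this is where \<open>E\<close> has to be closed under subtraction.\<close>
      define x where "x = h w - L w"
      have x: "x \<in> E" unfolding x_def using E valH[OF h True] valM[OF L(1) True] by auto
      have kH: "ksection X K w x \<in> H.C" and kM: "ksection X K w x \<in> M.C"
        using QH QM x True by (auto simp: Q_def)
      have c: "(\<lambda>n. H.nm (ksection X K w x - ksection X K w x)) \<longlonglongrightarrow> 0"
        "(\<lambda>n. M.nm (ksection X K w x - ksection X K w x)) \<longlonglongrightarrow> 0" by (simp_all add: hnorm_def)
      have "(\<lambda>n. H.ip (Y n) (ksection X K w x)) \<longlonglongrightarrow> H.ip h (ksection X K w x)"
        by (rule H.inner_tendsto[OF YH kH h kH Y(2) c(1)])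
      then have 1: "(\<lambda>n. l2_inner (Y n w) x) \<longlonglongrightarrow> l2_inner (h w) x"
        using repH[OF _ True x] YH h by simp
      have "(\<lambda>n. M.ip (Y n) (ksection X K w x)) \<longlonglongrightarrow> M.ip L (ksection X K w x)"
        by (rule M.inner_tendsto[OF YM kM L(1) kM L(2) c(2)])
      then have "(\<lambda>n. l2_inner (Y n w) x) \<longlonglongrightarrow> l2_inner (L w) x"
        using repM[OF _ True x] YM L by simp
      with 1 have "l2_inner (h w) x = l2_inner (L w) x" by (rule LIMSEQ_unique)
      then have "l2_inner x x = 0"
        using l2_inner_diff[of "h w" A "L w" x A] valH[OF h True] valM[OF L(1) True] x E(1) unfolding x_def by auto
      then have "x = 0" using l2_inner_definite[of x A] x E(1) by blast
      then show ?thesis by (simp add: x_def)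
    qed (use offH offM h L in simp)
    then have "h = L" by (rule ext)
    then show ?thesis using Y L by blast
  qed
  show ?thesis
  proof (intro conjI ballI subsetI)
    show "h \<in> M.C" if "h \<in> H.C" for h using approx[OF that] by blast
    fix f g assume f: "f \<in> H.C" and g: "g \<in> H.C"
    obtain Y where Y: "\<And>n. Y n \<in> S" "(\<lambda>n. H.nm (Y n - f)) \<longlonglongrightarrow> 0" "f \<in> M.C" "(\<lambda>n. M.nm (Y n - f)) \<longlonglongrightarrow> 0"
      using approx[OF f] by blast
    obtain Z where Z: "\<And>n. Z n \<in> S" "(\<lambda>n. H.nm (Z n - g)) \<longlonglongrightarrow> 0" "g \<in> M.C" "(\<lambda>n. M.nm (Z n - g)) \<longlonglongrightarrow> 0"
      using approx[OF g] by blast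
    have SH': "s \<in> H.C" and SM': "s \<in> M.C" if "s \<in> S" for s using SH SM that by auto
    have 1: "(\<lambda>n. H.ip (Y n) (Z n)) \<longlonglongrightarrow> H.ip f g"
      by (rule H.inner_tendsto[OF SH'[OF Y(1)] SH'[OF Z(1)] f g Y(2) Z(2)])
    have "(\<lambda>n. M.ip (Y n) (Z n)) \<longlonglongrightarrow> M.ip f g"
      by (rule M.inner_tendsto[OF SM'[OF Y(1)] SM'[OF Z(1)] Y(3) Z(3) Y(4) Z(4)])
    then have "(\<lambda>n. H.ip (Y n) (Z n)) \<longlonglongrightarrow> M.ip f g" using ip_eq Y(1) Z(1) by simp
    then show "M.ip f g = H.ip f g" using 1 LIMSEQ_unique by blast
  qed
qed

section \<open>The coefficients of the kernel\<close>

lemma finite_mlen_eq: "finite {\<alpha> :: 'd::finite \<Rightarrow> nat. mlen \<alpha> = n}"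
proof (rule finite_subset)
  show "{\<alpha> :: 'd \<Rightarrow> nat. mlen \<alpha> = n} \<subseteq> PiE UNIV (\<lambda>_. {..n})"
    by (auto simp: mlen_def intro!: member_le_sum)
  show "finite (PiE UNIV (\<lambda>_. {..n}) :: ('d \<Rightarrow> nat) set)" by (intro finite_PiE) auto
qed

lemma mlen_zero [simp]: "mlen (\<lambda>_. 0) = 0" by (simp add: mlen_def)
lemma mpow_zero [simp]: "mpow z (\<lambda>_. 0) = 1" by (simp add: mpow_def)

lemma mlen_upd_Suc: "mlen (\<alpha>(k := Suc (\<alpha> k))) = Suc (mlen \<alpha>)"
proof -
  have "mlen (\<alpha>(k := Suc (\<alpha> k))) = (\<Sum>j\<in>UNIV. \<alpha> j + (if j = k then 1 else 0))"
    unfolding mlen_def by (intro sum.cong) auto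
  then show ?thesis by (simp add: sum.distrib mlen_def)
qed

lemma prod_upd_Suc:
  fixes g :: "'d::finite \<Rightarrow> nat \<Rightarrow> 'b::comm_monoid_mult"
  assumes "g k (Suc (\<alpha> k)) = c * g k (\<alpha> k)"
  shows "(\<Prod>j\<in>UNIV. g j ((\<alpha>(k := Suc (\<alpha> k))) j)) = c * (\<Prod>j\<in>UNIV. g j (\<alpha> j))"
proof -
  have "(\<Prod>j\<in>UNIV. g j ((\<alpha>(k := Suc (\<alpha> k))) j)) = (\<Prod>j\<in>UNIV. (if j = k then c else 1) * g j (\<alpha> j))"
    using assms by (intro prod.cong) auto
  then show ?thesis by (simp add: prod.distrib)
qed

lemma mpow_upd_Suc: "mpow z (\<alpha>(k := Suc (\<alpha> k))) = z $ k * mpow z \<alpha>"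
  unfolding mpow_def by (rule prod_upd_Suc) simp

lemma mfact_upd_Suc: "mfact (\<lambda>j. \<delta> j + (\<alpha>(k := Suc (\<alpha> k))) j) = (\<delta> k + Suc (\<alpha> k)) * mfact (\<lambda>j. \<delta> j + \<alpha> j)"
  unfolding mfact_def by (rule prod_upd_Suc[of "\<lambda>j n. fact (\<delta> j + n)"]) simp

lemma mfact_pos: "mfact \<alpha> > 0" by (simp add: mfact_def prod_pos)

text \<open>For \<open>a = 1\<close> and \<delta> = 0 this is the multinomial coefficient
  |\<alpha>|! / \<alpha>!, and the series is the Drury-Arveson kernel 1 / (1 - <z, w>).\<close>

definition kernel_coeff :: "real \<Rightarrow> ('d::finite \<Rightarrow> nat) \<Rightarrow> ('d \<Rightarrow> nat) \<Rightarrow> real" where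
  "kernel_coeff a \<delta> \<alpha> = real (mfact \<delta>) / real (mfact (\<lambda>j. \<delta> j + \<alpha> j)) * (\<Prod>i<mlen \<alpha>. real (mlen \<delta>) + a + real i)"

lemma kcoeff_eq: "kcoeff a \<delta> z w = (\<Sum>\<^sub>\<infinity>\<alpha>. of_real (kernel_coeff a \<delta> \<alpha>) * mpow z \<alpha> * cnj (mpow w \<alpha>))"
  by (simp add: kcoeff_def kernel_coeff_def)

lemma kernel_coeff_zero [simp]: "kernel_coeff a \<delta> (\<lambda>_. 0) = 1"
  using mfact_pos[of \<delta>] by (simp add: kernel_coeff_def)

lemma kernel_coeff_pos: "a > 0 \<Longrightarrow> kernel_coeff a \<delta> \<alpha> > 0"
  unfolding kernel_coeff_def by (intro mult_pos_pos divide_pos_pos prod_pos) (auto simp: mfact_pos add_nonneg_pos add_pos_nonneg)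

lemma kernel_coeff_upd_Suc:
  "kernel_coeff a \<delta> (\<alpha>(k := Suc (\<alpha> k))) = kernel_coeff a \<delta> \<alpha> * ((real (mlen \<delta>) + a + real (mlen \<alpha>)) / real (\<delta> k + \<alpha> k + 1))"
  unfolding kernel_coeff_def mlen_upd_Suc mfact_upd_Suc by (simp add: field_simps)

section \<open>Convergence of the kernel series on the unit ball\<close>

definition rpow :: "('d::finite \<Rightarrow> real) \<Rightarrow> ('d \<Rightarrow> nat) \<Rightarrow> real" where
  "rpow x \<alpha> = (\<Prod>j\<in>UNIV. x j ^ \<alpha> j)"

lemma rpow_upd_Suc: "rpow x (\<alpha>(k := Suc (\<alpha> k))) = x k * rpow x \<alpha>"
  unfolding rpow_def by (rule prod_upd_Suc) simp

text \<open>Weighting each term of degree \<open>n + 1\<close> with \<open>\<alpha>\<^sub>k\<close> and summing over \<open>k\<close> turns the recursion of the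
  coefficients into a ratio test for the sums over homogeneous terms.\<close>

lemma kernel_coeff_homogeneous_le:
  fixes x :: "'d::finite \<Rightarrow> real"
  assumes a: "a > 0" and x: "\<And>j. x j \<ge> 0"
  shows "real (Suc n) * (\<Sum>\<alpha> | mlen \<alpha> = Suc n. kernel_coeff a \<delta> \<alpha> * rpow x \<alpha>)
    \<le> (real (mlen \<delta>) + a + real n) * (\<Sum>j\<in>UNIV. x j) * (\<Sum>\<alpha> | mlen \<alpha> = n. kernel_coeff a \<delta> \<alpha> * rpow x \<alpha>)"
proof -
  let ?t = "\<lambda>\<alpha>. kernel_coeff a \<delta> \<alpha> * rpow x \<alpha>"
  have nn: "?t \<alpha> \<ge> 0" for \<alpha>
    using kernel_coeff_pos[OF a, of \<delta> \<alpha>] x by (simp add: rpow_def prod_nonneg)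
  have "real (Suc n) * (\<Sum>\<alpha> | mlen \<alpha> = Suc n. ?t \<alpha>) = (\<Sum>\<alpha> | mlen \<alpha> = Suc n. \<Sum>k\<in>UNIV. real (\<alpha> k) * ?t \<alpha>)"
    unfolding sum_distrib_left
  proof (intro sum.cong refl)
    fix \<alpha> :: "'d \<Rightarrow> nat" assume "\<alpha> \<in> {\<alpha>. mlen \<alpha> = Suc n}"
    then have "real (Suc n) = (\<Sum>k\<in>UNIV. real (\<alpha> k))" by (simp add: mlen_def flip: of_nat_sum)
    then show "real (Suc n) * ?t \<alpha> = (\<Sum>k\<in>UNIV. real (\<alpha> k) * ?t \<alpha>)" by (simp only: sum_distrib_right)
  qed
  also have "\<dots> = (\<Sum>k\<in>UNIV. \<Sum>\<alpha> | mlen \<alpha> = Suc n. real (\<alpha> k) * ?t \<alpha>)" by (rule sum.swap)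
  also have "\<dots> \<le> (\<Sum>k\<in>UNIV. \<Sum>\<beta> | mlen \<beta> = n. (real (mlen \<delta>) + a + real n) * x k * ?t \<beta>)"
  proof (rule sum_mono)
    fix k :: 'd
    let ?A = "{\<alpha> :: 'd \<Rightarrow> nat. mlen \<alpha> = Suc n \<and> \<alpha> k > 0}"
    have "(\<Sum>\<alpha> | mlen \<alpha> = Suc n. real (\<alpha> k) * ?t \<alpha>) = (\<Sum>\<alpha>\<in>?A. real (\<alpha> k) * ?t \<alpha>)"
      by (rule sum.mono_neutral_right) (auto simp: finite_mlen_eq)
    \<comment> \<open>Raising the weight from \<open>\<alpha> k\<close> to
      \<open>\<delta> k + \<alpha> k\<close> costs an inequality but cancels the denominator in the
      recursion of the coefficients.\<close>
    also have "\<dots> \<le> (\<Sum>\<alpha>\<in>?A. real (\<delta> k + \<alpha> k) * ?t \<alpha>)"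
      by (intro sum_mono mult_right_mono nn) auto
    also have "\<dots> = (\<Sum>\<beta> | mlen \<beta> = n. (real (mlen \<delta>) + a + real n) * x k * ?t \<beta>)"
    proof (rule sum.reindex_bij_witness[of _ "\<lambda>\<beta>. \<beta>(k := Suc (\<beta> k))" "\<lambda>\<alpha>. \<alpha>(k := \<alpha> k - 1)"])
      fix \<alpha> assume \<alpha>: "\<alpha> \<in> ?A"
      define \<beta> where "\<beta> = \<alpha>(k := \<alpha> k - 1)"
      have e: "\<alpha> = \<beta>(k := Suc (\<beta> k))" using \<alpha> by (auto simp: \<beta>_def fun_eq_iff)
      show "\<beta>(k := Suc (\<beta> k)) = \<alpha>" using e by simp
      have m: "mlen \<beta> = n" using \<alpha> mlen_upd_Suc[of \<beta> k] unfolding e[symmetric] by simp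
      then show "\<beta> \<in> {\<beta>. mlen \<beta> = n}" by simp
      show "(real (mlen \<delta>) + a + real n) * x k * ?t \<beta> = real (\<delta> k + \<alpha> k) * ?t \<alpha>"
        unfolding e kernel_coeff_upd_Suc rpow_upd_Suc m by (simp add: field_simps)
    next
      fix \<beta> :: "'d \<Rightarrow> nat" assume "\<beta> \<in> {\<beta>. mlen \<beta> = n}"
      then show "\<beta>(k := Suc (\<beta> k)) \<in> ?A" by (simp add: mlen_upd_Suc)
      show "(\<beta>(k := Suc (\<beta> k)))(k := (\<beta>(k := Suc (\<beta> k))) k - 1) = \<beta>" by auto
    qed
    finally show "(\<Sum>\<alpha> | mlen \<alpha> = Suc n. real (\<alpha> k) * ?t \<alpha>)
      \<le> (\<Sum>\<beta> | mlen \<beta> = n. (real (mlen \<delta>) + a + real n) * x k * ?t \<beta>)" .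
  qed
  also have "\<dots> = (real (mlen \<delta>) + a + real n) * (\<Sum>j\<in>UNIV. x j) * (\<Sum>\<alpha> | mlen \<alpha> = n. ?t \<alpha>)"
    by (simp add: sum_distrib_left sum_distrib_right mult_ac sum.swap[of _ UNIV])
  finally show ?thesis .
qed

lemma kernel_coeff_rpow_summable:
  fixes x :: "'d::finite \<Rightarrow> real"
  assumes a: "a > 0" and x: "\<And>j. x j \<ge> 0" and s: "(\<Sum>j\<in>UNIV. x j) < 1"
  shows "(\<lambda>\<alpha>. kernel_coeff a \<delta> \<alpha> * rpow x \<alpha>) summable_on UNIV"
proof -
  let ?t = "\<lambda>\<alpha>. kernel_coeff a \<delta> \<alpha> * rpow x \<alpha>"
  define s where "s = (\<Sum>j\<in>UNIV. x j)"
  define M where "M = real (mlen \<delta>) + a"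
  define B where "B n = (\<Sum>\<alpha> | mlen \<alpha> = n. ?t \<alpha>)" for n
  have s0: "s \<ge> 0" unfolding s_def using x by (simp add: sum_nonneg)
  have s1: "s < 1" using s by (simp add: s_def)
  have M0: "M > 0" using a by (simp add: M_def add_nonneg_pos)
  have nn: "?t \<alpha> \<ge> 0" for \<alpha>
    using kernel_coeff_pos[OF a, of \<delta> \<alpha>] x by (simp add: rpow_def prod_nonneg)
  have B0: "B n \<ge> 0" for n unfolding B_def by (rule sum_nonneg) (use nn in auto)
  \<comment> \<open>Consecutive homogeneous sums have ratio at most (M + n) s / (n + 1), which tends
    to s < 1. The midpoint \<open>c\<close> of s and 1 bounds this ratio for all n from
    \<open>N\<close> on.\<close>
  define c where "c = (s + 1) / 2"
  have c: "c < 1" "c > s" "c > 0" using s0 s1 by (auto simp: c_def)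
  obtain N :: nat where N: "s * M / (c - s) \<le> real N" using real_arch_simple by blast
  have "summable B"
  proof (rule summable_ratio_test[OF c(1)])
    fix n assume n: "n \<ge> N"
    have "s * M \<le> (c - s) * real N" using N c by (simp add: field_simps)
    also have "\<dots> \<le> (c - s) * real n" using n c by (intro mult_left_mono) auto
    finally have le: "(M + real n) * s \<le> c * real (Suc n)" using c by (simp add: algebra_simps)
    have "real (Suc n) * B (Suc n) \<le> (M + real n) * s * B n"
      using kernel_coeff_homogeneous_le[where n = n and \<delta> = \<delta>, OF a x] unfolding B_def M_def s_def by simp
    also have "\<dots> \<le> c * real (Suc n) * B n" by (intro mult_right_mono le B0)
    finally have "real (Suc n) * B (Suc n) \<le> real (Suc n) * (c * B n)" by (simp only: mult_ac)
    then have "B (Suc n) \<le> c * B n" by (subst (asm) mult_le_cancel_left_pos) auto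
    then show "norm (B (Suc n)) \<le> c * norm (B n)" using B0 by simp
  qed
  show ?thesis
  proof (rule nonneg_bdd_above_summable_on[OF nn], rule bdd_aboveI2)
    fix F :: "('d \<Rightarrow> nat) set" assume "F \<in> {F. F \<subseteq> UNIV \<and> finite F}"
    then have F: "finite F" by simp
    have "sum ?t F = (\<Sum>n\<in>mlen ` F. sum ?t {\<alpha>\<in>F. mlen \<alpha> = n})"
      by (rule sum.group[symmetric]) (use F in auto)
    also have "\<dots> \<le> (\<Sum>n\<in>mlen ` F. B n)"
      unfolding B_def by (intro sum_mono sum_mono2) (use nn finite_mlen_eq in auto)
    also have "\<dots> \<le> suminf B" by (rule sum_le_suminf[OF \<open>summable B\<close>]) (use F B0 in auto)
    finally show "sum ?t F \<le> suminf B" .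
  qed
qed

text \<open>With the squared moduli of the coordinates as \<open>x\<close>, the requirement that
  their sum be below 1 is membership in the Euclidean ball.\<close>

lemma kernel_coeff_mpow_summable:
  fixes z :: "complex ^ 'd::finite"
  assumes a: "a > 0" and z: "norm z < 1"
  shows "(\<lambda>\<alpha>. kernel_coeff a \<delta> \<alpha> * (cmod (mpow z \<alpha>))\<^sup>2) summable_on UNIV"
proof -
  have "(\<Sum>j\<in>UNIV. (cmod (z $ j))\<^sup>2) = (norm z)\<^sup>2"
    by (simp add: norm_vec_def L2_set_def sum_nonneg)
  also have "\<dots> < 1" using z by (simp add: abs_square_less_1)
  finally have "(\<lambda>\<alpha>. kernel_coeff a \<delta> \<alpha> * rpow (\<lambda>j. (cmod (z $ j))\<^sup>2) \<alpha>) summable_on UNIV"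
    by (intro kernel_coeff_rpow_summable a) auto
  also have "(\<lambda>\<alpha>. rpow (\<lambda>j. (cmod (z $ j))\<^sup>2) \<alpha>) = (\<lambda>\<alpha>. (cmod (mpow z \<alpha>))\<^sup>2)"
    unfolding rpow_def mpow_def prod_norm[symmetric] norm_power prod_power_distrib
    by (simp add: mult.commute flip: power_mult)
  finally show ?thesis by (simp add: fun_eq_iff)
qed


section \<open>Identity theorem for power series in several variables\<close>

lemma power_series_zero_coeffs:
  fixes c :: "nat \<Rightarrow> complex"
  assumes r: "r > 0" and sums: "\<And>t. norm t \<le> r \<Longrightarrow> (\<lambda>n. c n * t ^ n) sums 0"
  shows "c n = 0"
proof -
  have "summable (\<lambda>n. c n * complex_of_real r ^ n)"
    using sums[of "complex_of_real r"] r by (auto simp: sums_iff)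
  then have "conv_radius c \<ge> norm (complex_of_real r)" by (rule conv_radius_geI)
  then have rad: "fps_conv_radius (Abs_fps c) > 0"
    using r by (simp add: fps_conv_radius_def) (metis ereal_less(2) less_le_trans)
  have "Abs_fps c = 0"
  proof (rule eval_fps_eqD[OF rad])
    have "eventually (\<lambda>t. t \<in> ball (0::complex) r) (nhds 0)"
      by (rule eventually_nhds_in_open) (use r in auto)
    then show "eventually (\<lambda>t. eval_fps (Abs_fps c) t = eval_fps 0 t) (nhds 0)"
      by eventually_elim (use sums in \<open>auto simp: eval_fps_def sums_iff\<close>)
  qed auto
  then show ?thesis by (metis fps_nth_Abs_fps fps_zero_nth)
qed

text \<open>The coordinates are removed one at a time: \<open>S\<close> is the set of those already treated.\<close>

lemma power_series_zero_coeffs_except: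
  fixes f :: "('d::finite \<Rightarrow> nat) \<Rightarrow> complex"
  assumes r: "r > 0"
    and sm: "\<And>z. (\<And>j. norm (z $ j) \<le> r) \<Longrightarrow> (\<lambda>\<alpha>. norm (f \<alpha> * mpow z \<alpha>)) summable_on UNIV"
    and zero: "\<And>z. (\<And>j. norm (z $ j) \<le> r) \<Longrightarrow> (\<Sum>\<^sub>\<infinity>\<alpha>. f \<alpha> * mpow z \<alpha>) = 0"
    and "finite S"
  shows "\<forall>\<gamma> z. (\<forall>j. norm (z j) \<le> r) \<longrightarrow>
    ((\<lambda>\<alpha>. f \<alpha> * (\<Prod>i\<in>UNIV - S. z i ^ \<alpha> i)) has_sum 0) {\<alpha>. \<forall>i\<in>S. \<alpha> i = \<gamma> i}"
  using \<open>finite S\<close>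
proof (induction S)
  case empty
  have "((\<lambda>\<alpha>. f \<alpha> * (\<Prod>i\<in>UNIV. z i ^ \<alpha> i)) has_sum 0) UNIV" if "\<forall>j. norm (z j) \<le> r" for z
  proof -
    have e: "(\<Prod>i\<in>UNIV. z i ^ \<alpha> i) = mpow (\<chi> i. z i) \<alpha>" for \<alpha> by (simp add: mpow_def)
    have "(\<lambda>\<alpha>. f \<alpha> * mpow (\<chi> i. z i) \<alpha>) summable_on UNIV"
      by (rule Infinite_Sum.abs_summable_summable[OF sm]) (use that in simp)
    moreover have "(\<Sum>\<^sub>\<infinity>\<alpha>. f \<alpha> * mpow (\<chi> i. z i) \<alpha>) = 0" by (rule zero) (use that in simp)
    ultimately show ?thesis unfolding e by (simp add: has_sum_iff)
  qed
  then show ?case by simp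
next
  case (insert k S)
  show ?case
  proof (intro allI impI)
    fix \<gamma> :: "'d \<Rightarrow> nat" and z :: "'d \<Rightarrow> complex" assume z: "\<forall>j. norm (z j) \<le> r"
    define D where "D n = {\<alpha>. \<forall>i\<in>insert k S. \<alpha> i = (\<gamma>(k := n)) i}" for n
    define h where "h \<alpha> = f \<alpha> * (\<Prod>i\<in>UNIV - insert k S. z i ^ \<alpha> i)" for \<alpha>
    have sumD: "h summable_on D n" for n
    proof -
      \<comment> \<open>Summability on the slice \<open>D n\<close> comes from a single evaluation
        point: where the treated coordinates equal \<open>r\<close>, they contribute the same factor
        \<open>C > 0\<close> to every monomial of the slice, and it can be divided out.\<close>
      define z' where "z' = (\<chi> i. if i \<in> insert k S then complex_of_real r else z i)"
      define C where "C = (\<Prod>i\<in>insert k S. r ^ (\<gamma>(k := n)) i)"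
      have C: "C > 0" unfolding C_def using r by (intro prod_pos) auto
      have "(\<lambda>\<alpha>. norm (f \<alpha> * mpow z' \<alpha>)) summable_on UNIV"
        by (rule sm) (use z r in \<open>simp add: z'_def\<close>)
      then have "(\<lambda>\<alpha>. inverse C * norm (f \<alpha> * mpow z' \<alpha>)) summable_on D n"
        by (intro summable_on_cmult_right) (rule summable_on_subset_banach, auto)
      also have "(\<lambda>\<alpha>. inverse C * norm (f \<alpha> * mpow z' \<alpha>)) summable_on D n \<longleftrightarrow> (\<lambda>\<alpha>. norm (h \<alpha>)) summable_on D n"
      proof (rule summable_on_cong)
        fix \<alpha> assume \<alpha>: "\<alpha> \<in> D n"
        have "mpow z' \<alpha> = (\<Prod>i\<in>UNIV - insert k S. z' $ i ^ \<alpha> i) * (\<Prod>i\<in>insert k S. z' $ i ^ \<alpha> i)"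
          unfolding mpow_def by (rule prod.subset_diff) (use insert in auto)
        also have "(\<Prod>i\<in>insert k S. z' $ i ^ \<alpha> i) = complex_of_real C"
          unfolding C_def of_real_prod using \<alpha> by (intro prod.cong) (auto simp: D_def z'_def)
        also have "(\<Prod>i\<in>UNIV - insert k S. z' $ i ^ \<alpha> i) = (\<Prod>i\<in>UNIV - insert k S. z i ^ \<alpha> i)"
          by (intro prod.cong) (auto simp: z'_def)
        finally have "f \<alpha> * mpow z' \<alpha> = h \<alpha> * complex_of_real C" by (simp add: h_def)
        then show "inverse C * norm (f \<alpha> * mpow z' \<alpha>) = norm (h \<alpha>)" using C by (simp add: norm_mult)
      qed
      finally show ?thesis by (rule Infinite_Sum.abs_summable_summable)
    qed
    define c where "c n = infsum h (D n)" for n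
    have hc: "(h has_sum c n) (D n)" for n unfolding c_def by (rule has_sum_infsum[OF sumD])
    have "c n = 0" for n
    proof (rule power_series_zero_coeffs[OF r])
      fix t :: complex assume t: "norm t \<le> r"
      \<comment> \<open>The k-th coordinate becomes a free variable \<open>t\<close>. Grouping the
        vanishing sum by the value n of \<open>\<alpha> k\<close> gives a power series in
        \<open>t\<close> whose coefficients are the slice sums \<open>c n\<close>.\<close>
      define g where "g \<alpha> = f \<alpha> * (\<Prod>i\<in>UNIV - S. (z(k := t)) i ^ \<alpha> i)" for \<alpha>
      have g: "g \<alpha> = h \<alpha> * t ^ \<alpha> k" for \<alpha>
      proof -
        have "UNIV - S = insert k (UNIV - insert k S)" using insert by auto
        moreover have "(\<Prod>i\<in>UNIV - insert k S. (z(k := t)) i ^ \<alpha> i) = (\<Prod>i\<in>UNIV - insert k S. z i ^ \<alpha> i)"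
          by (intro prod.cong) auto
        ultimately show ?thesis by (simp add: g_def h_def)
      qed
      have "(g has_sum 0) {\<alpha>. \<forall>i\<in>S. \<alpha> i = \<gamma> i}"
        using insert.IH[rule_format, of "z(k := t)" \<gamma>] z t unfolding g_def by simp
      moreover have "bij_betw snd (Sigma UNIV D) {\<alpha>. \<forall>i\<in>S. \<alpha> i = \<gamma> i}"
        by (rule bij_betw_byWitness[where f' = "\<lambda>\<alpha>. (\<alpha> k, \<alpha>)"]) (use insert in \<open>auto simp: D_def\<close>)
      ultimately have "((\<lambda>p. g (snd p)) has_sum 0) (Sigma UNIV D)"
        using has_sum_reindex_bij_betw[of snd "Sigma UNIV D" _ g 0] by blast
      then have "((\<lambda>n. c n * t ^ n) has_sum 0) UNIV"
      proof (rule has_sum_SigmaD)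
        fix n :: nat
        have "((\<lambda>\<alpha>. h \<alpha> * t ^ n) has_sum c n * t ^ n) (D n)" by (rule has_sum_cmult_left[OF hc])
        also have "((\<lambda>\<alpha>. h \<alpha> * t ^ n) has_sum c n * t ^ n) (D n) \<longleftrightarrow> ((\<lambda>\<alpha>. g (snd (n, \<alpha>))) has_sum c n * t ^ n) (D n)"
          by (rule has_sum_cong) (simp add: g D_def)
        finally show "((\<lambda>\<alpha>. g (snd (n, \<alpha>))) has_sum c n * t ^ n) (D n)" .
      qed
      then show "(\<lambda>n. c n * t ^ n) sums 0" by (rule has_sum_imp_sums)
    qed
    then have "(h has_sum 0) (D (\<gamma> k))" using hc[of "\<gamma> k"] by simp
    then show "((\<lambda>\<alpha>. f \<alpha> * (\<Prod>i\<in>UNIV - insert k S. z i ^ \<alpha> i)) has_sum 0) {\<alpha>. \<forall>i\<in>insert k S. \<alpha> i = \<gamma> i}"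
      by (simp add: h_def[abs_def] D_def)
  qed
qed

lemma power_series_zero_coeffs_multi:
  fixes f :: "('d::finite \<Rightarrow> nat) \<Rightarrow> complex"
  assumes sm: "\<And>z. norm z < 1 \<Longrightarrow> (\<lambda>\<alpha>. norm (f \<alpha> * mpow z \<alpha>)) summable_on UNIV"
    and zero: "\<And>z. norm z < 1 \<Longrightarrow> (\<Sum>\<^sub>\<infinity>\<alpha>. f \<alpha> * mpow z \<alpha>) = 0"
  shows "f \<gamma> = 0"
proof -
  \<comment> \<open>The closed polydisc of this radius lies in the open ball: the Euclidean norm is
    at most the sum of the coordinate moduli, here at most d / (d + 1).\<close>
  define r where "r = 1 / (real CARD('d) + 1)"
  have r: "r > 0" by (simp add: r_def add_pos_pos)
  have nz: "norm z < 1" if "\<And>j. norm (z $ j) \<le> r" for z :: "complex ^ 'd"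
  proof -
    have "norm z \<le> (\<Sum>j\<in>UNIV. norm (z $ j))" unfolding norm_vec_def by (rule L2_set_le_sum) auto
    also have "\<dots> \<le> real CARD('d) * r" using sum_bounded_above[of UNIV "\<lambda>j. norm (z $ j)" r] that by simp
    also have "\<dots> < 1" by (simp add: r_def field_simps)
    finally show ?thesis .
  qed
  have "((\<lambda>\<alpha>. f \<alpha> * (\<Prod>i\<in>UNIV - UNIV. 0 ^ \<alpha> i)) has_sum 0) {\<alpha>. \<forall>i\<in>UNIV. \<alpha> i = \<gamma> i}"
    using power_series_zero_coeffs_except[OF r sm[OF nz] zero[OF nz] finite[of UNIV], rule_format, of "\<lambda>_. 0" \<gamma>] r
    by simp
  moreover have "{\<alpha>. \<forall>i\<in>UNIV. \<alpha> i = \<gamma> i} = {\<gamma>}" by auto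
  ultimately show ?thesis by (simp add: has_sum_finite_iff)
qed

section \<open>Power series model of a diagonal kernel\<close>

text \<open>The normalising factor of a monomial: in the space whose kernel has coefficients
  c_\<alpha>, the monomial of exponent \<alpha> has norm 1 / sqrt c_\<alpha>. Coefficients with
  respect to the normalised monomials are square-summable families.\<close>

definition mscale :: "real \<Rightarrow> ('i \<Rightarrow> 'd::finite \<Rightarrow> nat) \<Rightarrow> 'i \<Rightarrow> ('d \<Rightarrow> nat) \<Rightarrow> real" where
  "mscale a \<delta> i \<alpha> = sqrt (kernel_coeff a (\<delta> i) \<alpha>)"

definition coeff_fun :: "real \<Rightarrow> ('i \<Rightarrow> 'd::finite \<Rightarrow> nat) \<Rightarrow> (('d \<Rightarrow> nat) \<times> 'i \<Rightarrow> complex) \<Rightarrow> 'i \<Rightarrow> complex ^ 'd \<Rightarrow> complex"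
  where "coeff_fun a \<delta> g i z = (\<Sum>\<^sub>\<infinity>\<alpha>. g (\<alpha>, i) * (of_real (mscale a \<delta> i \<alpha>) * mpow z \<alpha>))"

text \<open>Multiplication by the k-th coordinate, written in normalised monomials; the weight is
  the quotient of two normalising factors. The guard matters because truncated subtraction would
  otherwise send an exponent with \<open>\<alpha> k = 0\<close> to itself.\<close>

definition wshift :: "real \<Rightarrow> ('i \<Rightarrow> 'd::finite \<Rightarrow> nat) \<Rightarrow> 'd \<Rightarrow> (('d \<Rightarrow> nat) \<times> 'i \<Rightarrow> complex) \<Rightarrow> ('d \<Rightarrow> nat) \<times> 'i \<Rightarrow> complex"
  where "wshift a \<delta> k g = (\<lambda>(\<alpha>, i). if \<alpha> k = 0 then 0 else
    g (\<alpha>(k := \<alpha> k - 1), i) * of_real (mscale a \<delta> i (\<alpha>(k := \<alpha> k - 1)) / mscale a \<delta> i \<alpha>))"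

lemma mscale_pos: "a > 0 \<Longrightarrow> mscale a \<delta> i \<alpha> > 0"
  by (simp add: mscale_def kernel_coeff_pos)

lemma mscale_zero [simp]: "mscale a \<delta> i (\<lambda>_. 0) = 1"
  by (simp add: mscale_def)

lemma mscale_sq: "a > 0 \<Longrightarrow> (mscale a \<delta> i \<alpha>)\<^sup>2 = kernel_coeff a (\<delta> i) \<alpha>"
  by (simp add: mscale_def less_imp_le[OF kernel_coeff_pos])

lemma l2_slice: assumes "g \<in> l2 (UNIV \<times> I)" shows "(\<lambda>\<alpha>. g (\<alpha>, i)) \<in> l2 UNIV"
proof (rule l2I)
  have "(\<lambda>p. (cmod (g p))\<^sup>2) summable_on range (\<lambda>\<alpha>. (\<alpha>, i))" by (rule l2_sq_summable[OF assms])
  then show "(\<lambda>\<alpha>. (cmod (g (\<alpha>, i)))\<^sup>2) summable_on UNIV"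
    by (subst (asm) summable_on_reindex) (auto simp: inj_on_def o_def)
qed simp

lemma l2_slices:
  assumes "finite I" "\<And>i. i \<in> I \<Longrightarrow> (\<lambda>\<alpha>. g (\<alpha>, i)) \<in> l2 UNIV" "\<And>\<alpha> i. i \<notin> I \<Longrightarrow> g (\<alpha>, i) = 0"
  shows "g \<in> l2 (UNIV \<times> I)"
proof (rule l2I)
  show "g p = 0" if "p \<notin> UNIV \<times> I" for p using that assms(3) by (cases p) auto
  have "(\<lambda>p. (cmod (g p))\<^sup>2) summable_on (\<Union>i\<in>I. range (\<lambda>\<alpha>. (\<alpha>, i)))"
  proof (rule summable_on_finite_union_disjoint)
    fix i assume "i \<in> I"
    then show "(\<lambda>p. (cmod (g p))\<^sup>2) summable_on range (\<lambda>\<alpha>. (\<alpha>, i))"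
      using l2_sq_summable[OF assms(2), of i UNIV] by (subst summable_on_reindex) (auto simp: inj_on_def o_def)
  qed (use assms in auto)
  also have "(\<Union>i\<in>I. range (\<lambda>\<alpha>. (\<alpha>, i))) = UNIV \<times> I" by auto
  finally show "(\<lambda>p. (cmod (g p))\<^sup>2) summable_on UNIV \<times> I" .
qed

lemma l2_inner_slices:
  assumes "finite I" "g \<in> l2 (UNIV \<times> I)" "h \<in> l2 (UNIV \<times> I)"
  shows "l2_inner g h = (\<Sum>i\<in>I. \<Sum>\<^sub>\<infinity>\<alpha>. g (\<alpha>, i) * cnj (h (\<alpha>, i)))"
proof -
  have s: "(\<lambda>p. g p * cnj (h p)) summable_on UNIV \<times> I" by (rule l2_inner_summable[OF assms(2,3)])
  have sw: "bij_betw prod.swap (I \<times> UNIV) (UNIV \<times> I)" by (rule bij_betw_byWitness[where f' = prod.swap]) auto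
  have "l2_inner g h = (\<Sum>\<^sub>\<infinity>p\<in>UNIV \<times> I. g p * cnj (h p))"
    unfolding l2_inner_def by (rule infsum_cong_neutral) (use l2_off[OF assms(2)] in auto)
  also have "\<dots> = (\<Sum>\<^sub>\<infinity>p\<in>I \<times> UNIV. g (prod.swap p) * cnj (h (prod.swap p)))"
    by (rule infsum_reindex_bij_betw[OF sw, symmetric])
  also have "\<dots> = (\<Sum>\<^sub>\<infinity>i\<in>I. \<Sum>\<^sub>\<infinity>\<alpha>. g (prod.swap (i, \<alpha>)) * cnj (h (prod.swap (i, \<alpha>))))"
  proof (rule infsum_Sigma_banach[symmetric])
    show "(\<lambda>p. g (prod.swap p) * cnj (h (prod.swap p))) summable_on I \<times> UNIV"
      using summable_on_reindex_bij_betw[OF sw, of "\<lambda>p. g p * cnj (h p)"] s by blast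
  qed
  finally show ?thesis using assms(1) by simp
qed

lemma mscale_mpow_l2: "\<lbrakk>a > 0; norm z < 1\<rbrakk> \<Longrightarrow> (\<lambda>\<alpha>. of_real (mscale a \<delta> i \<alpha>) * mpow z \<alpha>) \<in> l2 UNIV"
  using kernel_coeff_mpow_summable[of a z "\<delta> i"] by (intro l2I) (simp_all add: norm_mult power_mult_distrib mscale_sq)

lemma coeff_fun_summable:
  assumes "a > 0" "g \<in> l2 (UNIV \<times> I)" "norm z < 1"
  shows "(\<lambda>\<alpha>. norm (g (\<alpha>, i) * (of_real (mscale a \<delta> i \<alpha>) * mpow z \<alpha>))) summable_on UNIV"
  by (rule l2_mult_abs_summable[OF l2_slice[OF assms(2)] mscale_mpow_l2[OF assms(1,3)]])

lemma coeff_fun_add: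
  assumes "a > 0" "g \<in> l2 (UNIV \<times> I)" "h \<in> l2 (UNIV \<times> I)" "norm z < 1"
  shows "coeff_fun a \<delta> (g + h) i z = coeff_fun a \<delta> g i z + coeff_fun a \<delta> h i z"
  unfolding coeff_fun_def plus_fun_apply distrib_right
  by (rule infsum_add[OF Infinite_Sum.abs_summable_summable[OF coeff_fun_summable[OF assms(1,2,4)]]
        Infinite_Sum.abs_summable_summable[OF coeff_fun_summable[OF assms(1,3,4)]]])

lemma coeff_fun_diff:
  assumes "a > 0" "g \<in> l2 (UNIV \<times> I)" "h \<in> l2 (UNIV \<times> I)" "norm z < 1"
  shows "coeff_fun a \<delta> (g - h) i z = coeff_fun a \<delta> g i z - coeff_fun a \<delta> h i z"
  using coeff_fun_add[OF assms(1) l2_diff[OF assms(2,3)] assms(3,4), of \<delta> i] by simp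

lemma coeff_fun_scale: "coeff_fun a \<delta> (\<lambda>p. c * g p) i z = c * coeff_fun a \<delta> g i z"
  unfolding coeff_fun_def mult.assoc by (rule infsum_cmult_right')

lemma coeff_fun_zero_imp:
  fixes \<delta> :: "'i \<Rightarrow> 'd::finite \<Rightarrow> nat"
  assumes "a > 0" "g \<in> l2 (UNIV \<times> I)" "\<And>z. norm z < 1 \<Longrightarrow> coeff_fun a \<delta> g i z = 0"
  shows "g (\<alpha>, i) = 0"
proof -
  have "g (\<alpha>, i) * of_real (mscale a \<delta> i \<alpha>) = 0"
  proof (rule power_series_zero_coeffs_multi)
    fix z :: "complex ^ 'd" assume z: "norm z < 1"
    show "(\<lambda>\<alpha>. norm (g (\<alpha>, i) * of_real (mscale a \<delta> i \<alpha>) * mpow z \<alpha>)) summable_on UNIV"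
      using coeff_fun_summable[OF assms(1,2) z, of i \<delta>] by (simp only: mult.assoc)
    show "(\<Sum>\<^sub>\<infinity>\<alpha>. g (\<alpha>, i) * of_real (mscale a \<delta> i \<alpha>) * mpow z \<alpha>) = 0"
      using assms(3)[OF z] by (simp only: mult.assoc coeff_fun_def)
  qed
  then show ?thesis using mscale_pos[OF assms(1), of \<delta> i \<alpha>] by simp
qed

lemma bij_upd_Suc: "bij_betw (\<lambda>\<beta>. \<beta>(k := Suc (\<beta> k))) UNIV {\<alpha> :: 'd \<Rightarrow> nat. \<alpha> k \<noteq> 0}"
  by (rule bij_betw_byWitness[where f' = "\<lambda>\<alpha>. \<alpha>(k := \<alpha> k - 1)"]) (auto simp: fun_eq_iff)

lemma wshift_upd_Suc:
  "wshift a \<delta> k g (\<beta>(k := Suc (\<beta> k)), i) = g (\<beta>, i) * of_real (mscale a \<delta> i \<beta> / mscale a \<delta> i (\<beta>(k := Suc (\<beta> k))))"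
  by (simp add: wshift_def)

lemma coeff_fun_wshift:
  assumes "a > 0" shows "coeff_fun a \<delta> (wshift a \<delta> k g) i z = z $ k * coeff_fun a \<delta> g i z"
proof -
  let ?t = "\<lambda>\<alpha>. wshift a \<delta> k g (\<alpha>, i) * (of_real (mscale a \<delta> i \<alpha>) * mpow z \<alpha>)"
  have "coeff_fun a \<delta> (wshift a \<delta> k g) i z = (\<Sum>\<^sub>\<infinity>\<alpha>\<in>{\<alpha>. \<alpha> k \<noteq> 0}. ?t \<alpha>)"
    unfolding coeff_fun_def by (rule infsum_cong_neutral) (auto simp: wshift_def)
  also have "\<dots> = (\<Sum>\<^sub>\<infinity>\<beta>. ?t (\<beta>(k := Suc (\<beta> k))))"
    by (rule infsum_reindex_bij_betw[OF bij_upd_Suc, symmetric])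
  also have "\<dots> = (\<Sum>\<^sub>\<infinity>\<beta>. z $ k * (g (\<beta>, i) * (of_real (mscale a \<delta> i \<beta>) * mpow z \<beta>)))"
  proof (rule infsum_cong)
    fix \<beta> :: "'b \<Rightarrow> nat"
    show "?t (\<beta>(k := Suc (\<beta> k))) = z $ k * (g (\<beta>, i) * (of_real (mscale a \<delta> i \<beta>) * mpow z \<beta>))"
      using mscale_pos[OF assms, of \<delta> i "\<beta>(k := Suc (\<beta> k))"] unfolding wshift_upd_Suc mpow_upd_Suc by simp
  qed
  also have "\<dots> = z $ k * coeff_fun a \<delta> g i z" unfolding coeff_fun_def by (rule infsum_cmult_right')
  finally show ?thesis .
qed

text \<open>The squared weight at \<beta> is (\<delta> k + \<beta> k + 1) / (|\<delta>| + a +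
  |\<beta>|), with \<delta> the degree of the index i. It is at most 1 because a \<ge> 1, so the
  shift is a contraction.\<close>

lemma wshift_l2:
  assumes a: "a \<ge> 1" and I: "finite I" and g: "g \<in> l2 (UNIV \<times> I)" shows "wshift a \<delta> k g \<in> l2 (UNIV \<times> I)"
proof (rule l2_slices[OF I])
  fix i
  have le: "(mscale a \<delta> i \<beta> / mscale a \<delta> i (\<beta>(k := Suc (\<beta> k))))\<^sup>2 \<le> 1" for \<beta>
  proof -
    have *: "\<beta> k \<le> mlen \<beta>" "\<delta> i k \<le> mlen (\<delta> i)" by (auto simp: mlen_def intro: member_le_sum)
    have "kernel_coeff a (\<delta> i) \<beta> * 1 \<le> kernel_coeff a (\<delta> i) (\<beta>(k := Suc (\<beta> k)))"
      unfolding kernel_coeff_upd_Suc using kernel_coeff_pos[of a "\<delta> i" \<beta>] a *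
      by (intro mult_left_mono) (auto simp: field_simps)
    then show ?thesis using a kernel_coeff_pos[of a "\<delta> i"] by (simp add: power_divide mscale_sq)
  qed
  show "(\<lambda>\<alpha>. wshift a \<delta> k g (\<alpha>, i)) \<in> l2 UNIV"
  proof (rule l2I)
    have "(\<lambda>\<beta>. (cmod (wshift a \<delta> k g (\<beta>(k := Suc (\<beta> k)), i)))\<^sup>2) summable_on UNIV"
    proof (rule summable_on_comparison_test[OF l2_sq_summable[OF l2_slice[OF g]]])
      fix \<beta> :: "'b \<Rightarrow> nat"
      show "(cmod (wshift a \<delta> k g (\<beta>(k := Suc (\<beta> k)), i)))\<^sup>2 \<le> (cmod (g (\<beta>, i)))\<^sup>2"
        using mult_left_mono[OF le[of \<beta>], of "(cmod (g (\<beta>, i)))\<^sup>2"]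
        unfolding wshift_upd_Suc norm_mult norm_of_real power_mult_distrib power2_abs by simp
    qed simp
    then have "(\<lambda>\<alpha>. (cmod (wshift a \<delta> k g (\<alpha>, i)))\<^sup>2) summable_on {\<alpha>. \<alpha> k \<noteq> 0}"
      using summable_on_reindex_bij_betw[OF bij_upd_Suc, of "\<lambda>\<alpha>. (cmod (wshift a \<delta> k g (\<alpha>, i)))\<^sup>2" k] by simp
    also have "?this \<longleftrightarrow> (\<lambda>\<alpha>. (cmod (wshift a \<delta> k g (\<alpha>, i)))\<^sup>2) summable_on UNIV"
      by (rule summable_on_cong_neutral) (auto simp: wshift_def)
    finally show "(\<lambda>\<alpha>. (cmod (wshift a \<delta> k g (\<alpha>, i)))\<^sup>2) summable_on UNIV" .
  qed simp
next
  fix \<alpha> i assume "i \<notin> I"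
  then show "wshift a \<delta> k g (\<alpha>, i) = 0" using l2_off[OF g] by (simp add: wshift_def)
qed

section \<open>Hilbert modules with a diagonal kernel\<close>

text \<open>The family \<open>b\<close> is an orthonormal basis of the values in which every
  \<open>K z w\<close> is diagonal. Nothing about trees is kept, so the two modules to be compared
  may live over different vertex types.\<close>

locale diagonal_kernel =
  fixes a :: real and I :: "'i set" and \<delta> :: "'i \<Rightarrow> 'd::finite \<Rightarrow> nat"
    and b :: "'i \<Rightarrow> 'v \<Rightarrow> complex" and E :: "('v \<Rightarrow> complex) set" and A :: "'v set"
    and K :: "complex ^ 'd \<Rightarrow> complex ^ 'd \<Rightarrow> ('v \<Rightarrow> complex) \<Rightarrow> 'v \<Rightarrow> complex"
  assumes a: "a \<ge> 1" and I: "finite I" and E_l2: "E \<subseteq> l2 A"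
    and E_zero: "0 \<in> E" and E_add: "\<And>x y. \<lbrakk>x \<in> E; y \<in> E\<rbrakk> \<Longrightarrow> x + y \<in> E"
    and E_scale: "\<And>c x. x \<in> E \<Longrightarrow> (\<lambda>v. c * x v) \<in> E"
    and b_E: "\<And>i. i \<in> I \<Longrightarrow> b i \<in> E"
    and orthonormal: "\<And>i j. \<lbrakk>i \<in> I; j \<in> I\<rbrakk> \<Longrightarrow> l2_inner (b i) (b j) = (if i = j then 1 else 0)"
    and expand: "\<And>x. x \<in> E \<Longrightarrow> x = (\<lambda>v. \<Sum>i\<in>I. l2_inner x (b i) * b i v)"
    and K: "\<And>x z w. x \<in> E \<Longrightarrow> K z w x = (\<lambda>v. \<Sum>i\<in>I. kcoeff a (\<delta> i) z w * l2_inner x (b i) * b i v)"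
begin

abbreviation "W \<equiv> l2 (UNIV \<times> I) :: (('d \<Rightarrow> nat) \<times> 'i \<Rightarrow> complex) set"

definition comb :: "('i \<Rightarrow> complex) \<Rightarrow> 'v \<Rightarrow> complex" where
  "comb c = (\<lambda>v. \<Sum>i\<in>I. c i * b i v)"

definition \<Phi> :: "(('d \<Rightarrow> nat) \<times> 'i \<Rightarrow> complex) \<Rightarrow> complex ^ 'd \<Rightarrow> 'v \<Rightarrow> complex" where
  "\<Phi> g = (\<lambda>z. if z \<in> ball 0 1 then comb (\<lambda>i. coeff_fun a \<delta> g i z) else 0)"

lemma a_pos: "a > 0" using a by simp

lemma E_diff: "\<lbrakk>x \<in> E; y \<in> E\<rbrakk> \<Longrightarrow> x - y \<in> E"
  using E_add[OF _ E_scale[of y "-1"], of x] by (simp add: fun_diff_def plus_fun_def)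

lemma comb_alt: "comb c = (\<Sum>i\<in>I. (\<lambda>v. c i * b i v))"
  by (simp add: comb_def sum_fun_apply fun_eq_iff)

lemma sum_E: "\<lbrakk>\<And>i. i \<in> J \<Longrightarrow> f i \<in> E\<rbrakk> \<Longrightarrow> (\<Sum>i\<in>J. f i) \<in> E"
  by (induction J rule: infinite_finite_induct) (auto intro: E_zero E_add)

lemma comb_E: "comb c \<in> E"
  unfolding comb_alt by (intro sum_E E_scale b_E)

lemma inner_comb: assumes "x \<in> E" shows "l2_inner (comb c) x = (\<Sum>i\<in>I. c i * l2_inner (b i) x)"
  unfolding comb_alt using E_l2 assms b_E by (subst l2_inner_sum[of _ A]) (auto simp: l2_inner_scale intro: l2_scale)

lemma inner_comb_b: "i \<in> I \<Longrightarrow> l2_inner (comb c) (b i) = c i"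
  using I by (simp add: inner_comb b_E orthonormal if_distrib[of "\<lambda>x. _ * x"] cong: if_cong)

lemma \<Phi>_E: "\<Phi> g z \<in> E" by (simp add: \<Phi>_def comb_E E_zero)

lemma \<Phi>_inner: "\<lbrakk>norm z < 1; i \<in> I\<rbrakk> \<Longrightarrow> l2_inner (\<Phi> g z) (b i) = coeff_fun a \<delta> g i z"
  by (simp add: \<Phi>_def inner_comb_b)

lemma \<Phi>_add: "\<lbrakk>g \<in> W; h \<in> W\<rbrakk> \<Longrightarrow> \<Phi> (g + h) = \<Phi> g + \<Phi> h"
  by (auto simp: \<Phi>_def fun_eq_iff comb_def coeff_fun_add[OF a_pos] distrib_right sum.distrib simp del: plus_fun_apply)
    (simp_all add: comb_def)

lemma \<Phi>_scale: "\<Phi> (\<lambda>p. c * g p) = (\<lambda>z v. c * \<Phi> g z v)"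
  by (auto simp: \<Phi>_def fun_eq_iff comb_def coeff_fun_scale sum_distrib_left mult.assoc)

text \<open>The identity theorem for power series, applied to each coordinate of the basis. Without
  it the inner product of \<open>model\<close> would not be determined by the function.\<close>

lemma \<Phi>_inj: "inj_on \<Phi> W"
proof (rule inj_onI)
  fix g h assume gh: "g \<in> W" "h \<in> W" "\<Phi> g = \<Phi> h"
  show "g = h"
  proof
    fix p :: "('d \<Rightarrow> nat) \<times> 'i" obtain \<alpha> i where p: "p = (\<alpha>, i)" by (cases p)
    show "g p = h p"
    proof (cases "i \<in> I")
      case True
      have "(g - h) (\<alpha>, i) = 0"
      proof (rule coeff_fun_zero_imp[OF a_pos l2_diff[OF gh(1,2)]])
        fix z :: "complex ^ 'd" assume "norm z < 1"
        then show "coeff_fun a \<delta> (g - h) i z = 0"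
          using coeff_fun_diff[OF a_pos gh(1,2)] \<Phi>_inner[of z i g] \<Phi>_inner[of z i h] gh(3) True by simp
      qed
      then show ?thesis by (simp add: p)
    qed (use l2_off[OF gh(1), of p] l2_off[OF gh(2), of p] p in simp)
  qed
qed

text \<open>The Riesz representative of evaluation at \<open>w\<close> paired with \<open>x\<close>,
  in coefficients; it is also the coefficient family of the kernel section. That the two roles
  coincide is the reproducing property.\<close>

definition kernel_vec :: "complex ^ 'd \<Rightarrow> ('v \<Rightarrow> complex) \<Rightarrow> ('d \<Rightarrow> nat) \<times> 'i \<Rightarrow> complex" where
  "kernel_vec w x = (\<lambda>(\<alpha>, i). if i \<in> I then cnj (of_real (mscale a \<delta> i \<alpha>) * mpow w \<alpha>) * l2_inner x (b i) else 0)"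

lemma kernel_vec_W: assumes "norm w < 1" shows "kernel_vec w x \<in> W"
proof (rule l2_slices[OF I])
  fix i assume i: "i \<in> I"
  have "(\<lambda>\<alpha>. l2_inner x (b i) * cnj (of_real (mscale a \<delta> i \<alpha>) * mpow w \<alpha>)) \<in> l2 UNIV"
    by (intro l2_scale l2_cnj mscale_mpow_l2 a_pos assms)
  then show "(\<lambda>\<alpha>. kernel_vec w x (\<alpha>, i)) \<in> l2 UNIV" using i by (simp add: kernel_vec_def mult.commute)
qed (simp add: kernel_vec_def)

lemma coeff_fun_kernel_vec: assumes "i \<in> I" shows "coeff_fun a \<delta> (kernel_vec w x) i z = kcoeff a (\<delta> i) z w * l2_inner x (b i)"
proof -
  have *: "kernel_vec w x (\<alpha>, i) * (of_real (mscale a \<delta> i \<alpha>) * mpow z \<alpha>)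
    = of_real (kernel_coeff a (\<delta> i) \<alpha>) * mpow z \<alpha> * cnj (mpow w \<alpha>) * l2_inner x (b i)" for \<alpha>
    using assms mscale_sq[OF a_pos, of \<delta> i \<alpha>, symmetric] by (simp add: kernel_vec_def power2_eq_square)
  show ?thesis unfolding coeff_fun_def kcoeff_eq infsum_cmult_left'[symmetric] by (rule infsum_cong) (rule *)
qed

lemma \<Phi>_kernel_vec: assumes "x \<in> E" shows "\<Phi> (kernel_vec w x) = ksection (ball 0 1) K w x"
proof
  fix z show "\<Phi> (kernel_vec w x) z = ksection (ball 0 1) K w x z"
    using K[OF assms] by (auto simp: \<Phi>_def ksection_def comb_def coeff_fun_kernel_vec intro!: ext sum.cong)
qed

lemma inner_kernel_vec:
  assumes "g \<in> W" "norm w < 1" "x \<in> E" shows "l2_inner g (kernel_vec w x) = l2_inner (\<Phi> g w) x"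
proof -
  have "l2_inner g (kernel_vec w x) = (\<Sum>i\<in>I. \<Sum>\<^sub>\<infinity>\<alpha>. g (\<alpha>, i) * cnj (kernel_vec w x (\<alpha>, i)))"
    by (rule l2_inner_slices[OF I assms(1) kernel_vec_W[OF assms(2)]])
  also have "\<dots> = (\<Sum>i\<in>I. coeff_fun a \<delta> g i w * l2_inner (b i) x)"
  proof (rule sum.cong[OF refl])
    fix i assume i: "i \<in> I"
    have *: "g (\<alpha>, i) * cnj (kernel_vec w x (\<alpha>, i))
      = g (\<alpha>, i) * (of_real (mscale a \<delta> i \<alpha>) * mpow w \<alpha>) * l2_inner (b i) x" for \<alpha>
      using i by (simp add: kernel_vec_def l2_inner_commute[of "b i" x])
    show "(\<Sum>\<^sub>\<infinity>\<alpha>. g (\<alpha>, i) * cnj (kernel_vec w x (\<alpha>, i))) = coeff_fun a \<delta> g i w * l2_inner (b i) x"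
      unfolding coeff_fun_def infsum_cmult_left'[symmetric] by (rule infsum_cong) (rule *)
  qed
  also have "\<dots> = l2_inner (\<Phi> g w) x" using assms by (simp add: \<Phi>_def inner_comb)
  finally show ?thesis .
qed

definition model :: "(complex ^ 'd \<Rightarrow> 'v \<Rightarrow> complex) hspace" where
  "model = \<lparr>hcarrier = \<Phi> ` W, hinner = (\<lambda>f g. l2_inner (inv_into W \<Phi> f) (inv_into W \<Phi> g))\<rparr>"

lemma model_inner: "\<lbrakk>g \<in> W; h \<in> W\<rbrakk> \<Longrightarrow> hinner model (\<Phi> g) (\<Phi> h) = l2_inner g h"
  by (simp add: model_def inv_into_f_f[OF \<Phi>_inj])

lemma model_rkhs: "is_rkhs (ball 0 1) E K model"
  unfolding is_rkhs_def
proof (intro conjI ballI)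
  show "complex_hilbert_space (\<lambda>c h z v. c * h z v) model"
    by (rule hilbert_space_transport[OF l2_hilbert[of "UNIV \<times> I"] vector_space_fun2, of \<Phi>])
      (simp_all add: \<Phi>_add \<Phi>_scale model_inner, simp add: model_def)
next
  fix h z assume "h \<in> hcarrier model"
  then show "h z \<in> E" by (auto simp: model_def \<Phi>_E)
next
  fix h assume "h \<in> hcarrier model"
  then show "\<forall>z. z \<notin> ball 0 1 \<longrightarrow> h z = 0" by (auto simp: model_def \<Phi>_def)
next
  fix w x assume w: "w \<in> ball (0 :: complex ^ 'd) 1" and x: "x \<in> E"
  then have kernel_vec: "kernel_vec w x \<in> W" by (simp add: kernel_vec_W)
  then show "ksection (ball 0 1) K w x \<in> hcarrier model"
    by (simp add: model_def flip: \<Phi>_kernel_vec[OF x])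
  fix h assume "h \<in> hcarrier model"
  then obtain g where g: "g \<in> W" "h = \<Phi> g" by (auto simp: model_def)
  show "hinner model h (ksection (ball 0 1) K w x) = l2_inner (h w) x"
    using w g kernel_vec x by (simp add: model_inner inner_kernel_vec flip: \<Phi>_kernel_vec[OF x])
qed

text \<open>From here on any space with the reproducing property can be computed with through
  coefficients; \<open>rkhs_subset\<close> is used in both directions.\<close>

lemma rkhs_eq_model:
  assumes H: "is_rkhs (ball 0 1) E K H"
  shows "hcarrier H = \<Phi> ` W" and "\<lbrakk>g \<in> W; h \<in> W\<rbrakk> \<Longrightarrow> hinner H (\<Phi> g) (\<Phi> h) = l2_inner g h"
proof -
  have u: "hcarrier H1 \<subseteq> hcarrier H2 \<and> (\<forall>f\<in>hcarrier H1. \<forall>g\<in>hcarrier H1. hinner H2 f g = hinner H1 f g)"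
    if "is_rkhs (ball 0 1) E K H1" "is_rkhs (ball 0 1) E K H2" for H1 H2
    by (rule rkhs_subset[OF that E_l2 E_diff])
  have m: "hcarrier model = \<Phi> ` W" by (simp add: model_def)
  show "hcarrier H = \<Phi> ` W" using u[OF H model_rkhs] u[OF model_rkhs H] m by blast
  show "hinner H (\<Phi> g) (\<Phi> h) = l2_inner g h" if "g \<in> W" "h \<in> W"
    using u[OF model_rkhs H] m that model_inner[OF that] by simp
qed

lemma Mz_\<Phi>: "Mz k (\<Phi> g) = \<Phi> (wshift a \<delta> k g)"
  by (auto simp: Mz_def \<Phi>_def comb_def coeff_fun_wshift[OF a_pos] fun_eq_iff sum_distrib_left mult.assoc)

lemma wshift_W: "g \<in> W \<Longrightarrow> wshift a \<delta> k g \<in> W"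
  by (rule wshift_l2[OF a I])

end

text \<open>The coefficient space and the weighted shifts depend only on \<open>I\<close> and \<open>\<delta>\<close>, not on the basis.\<close>

lemma isomorphic_if_same_degrees:
  assumes "diagonal_kernel a I \<delta> b1 E1 A1 K1" "is_rkhs (ball 0 1) E1 K1 H1"
    and "diagonal_kernel a I \<delta> b2 E2 A2 K2" "is_rkhs (ball 0 1) E2 K2 H2"
  shows "hilbert_modules_isomorphic H1 H2"
proof -
  interpret D1: diagonal_kernel a I \<delta> b1 E1 A1 K1 by fact
  interpret D2: diagonal_kernel a I \<delta> b2 E2 A2 K2 by fact
  note C1 = D1.rkhs_eq_model[OF assms(2)]
  note C2 = D2.rkhs_eq_model[OF assms(4)]
  define U where "U h = D2.\<Phi> (inv_into D1.W D1.\<Phi> h)" for h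
  have U: "U (D1.\<Phi> g) = D2.\<Phi> g" if "g \<in> D1.W" for g
    using that by (simp add: U_def inv_into_f_f[OF D1.\<Phi>_inj])
  have "bij_betw U (hcarrier H1) (hcarrier H2)"
    unfolding C1(1) C2(1)
  proof (rule bij_betw_imageI)
    show "inj_on U (D1.\<Phi> ` D1.W)"
      by (rule inj_onI, elim imageE) (simp add: U inj_on_eq_iff[OF D2.\<Phi>_inj])
    show "U ` D1.\<Phi> ` D1.W = D2.\<Phi> ` D1.W" using U by (auto simp: image_image)
  qed
  moreover have "U (f + g) = U f + U g" if "f \<in> hcarrier H1" "g \<in> hcarrier H1" for f g
    using that unfolding C1(1) by (auto simp: U D1.\<Phi>_add[symmetric] D2.\<Phi>_add l2_add simp del: plus_fun_apply)
  moreover have "U (\<lambda>z v. c * f z v) = (\<lambda>z v. c * U f z v)" if "f \<in> hcarrier H1" for c f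
    using that unfolding C1(1) by (auto simp: U D1.\<Phi>_scale[symmetric] D2.\<Phi>_scale l2_scale)
  moreover have "hinner H2 (U f) (U g) = hinner H1 f g" if "f \<in> hcarrier H1" "g \<in> hcarrier H1" for f g
    using that unfolding C1(1) by (auto simp: U C1(2) C2(2))
  moreover have "U (Mz k h) = Mz k (U h)" if "h \<in> hcarrier H1" for k h
    using that unfolding C1(1) by (auto simp: U D1.Mz_\<Phi> D2.Mz_\<Phi> D1.wshift_W)
  ultimately show ?thesis unfolding hilbert_modules_isomorphic_def unitary_between_def by blast
qed

section \<open>Isomorphic modules have the same degrees\<close>

lemma kernel_coeff_upd_one: "kernel_coeff a \<delta> ((\<lambda>_. 0)(k := Suc 0)) = (real (mlen \<delta>) + a) / real (\<delta> k + 1)"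
  using kernel_coeff_upd_Suc[of a \<delta> "\<lambda>_. 0" k] by simp

lemma kernel_coeff_upd_two:
  "kernel_coeff a \<delta> ((\<lambda>_. 0)(k := Suc (Suc 0)))
    = (real (mlen \<delta>) + a) / real (\<delta> k + 1) * ((real (mlen \<delta>) + a + 1) / real (\<delta> k + 2))"
proof -
  have "mlen ((\<lambda>_. 0 :: nat)(k := Suc 0)) = 1" using mlen_upd_Suc[of "\<lambda>_. 0" k] by simp
  then show ?thesis using kernel_coeff_upd_Suc[of a \<delta> "(\<lambda>_. 0)(k := Suc 0)" k] by (simp add: kernel_coeff_upd_one)
qed

text \<open>The second-order coefficients give that \<open>\<delta> k - \<delta>' k\<close> is \<open>|\<delta>| - |\<delta>'|\<close> for each \<open>k\<close>; summing over \<open>k\<close>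
  settles \<open>d > 1\<close>. For \<open>d = 1\<close> the first-order coefficients decide, unless \<open>a = 1\<close>.\<close>

lemma kernel_coeff_determines_degree:
  fixes \<delta> \<delta>' :: "'d::finite \<Rightarrow> nat"
  assumes a: "a > 0" "a * CARD('d) \<noteq> 1"
    and one: "\<And>k. kernel_coeff (real a) \<delta> ((\<lambda>_. 0)(k := Suc 0)) = kernel_coeff (real a) \<delta>' ((\<lambda>_. 0)(k := Suc 0))"
    and two: "\<And>k. kernel_coeff (real a) \<delta> ((\<lambda>_. 0)(k := Suc (Suc 0))) = kernel_coeff (real a) \<delta>' ((\<lambda>_. 0)(k := Suc (Suc 0)))"
  shows "\<delta> = \<delta>'"
proof -
  define N N' where "N = real (mlen \<delta>) + real a" and "N' = real (mlen \<delta>') + real a"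
  have N: "N > 0" "N' > 0" using a by (simp_all add: N_def N'_def add_nonneg_pos)
  have e1: "N / real (\<delta> k + 1) = N' / real (\<delta>' k + 1)" for k
    using one[of k] unfolding kernel_coeff_upd_one N_def N'_def by simp
  have f1: "(real (\<delta> k) + 1) * N' = (real (\<delta>' k) + 1) * N" for k
    using e1[of k] by (simp add: field_simps)
  have f2: "(real (\<delta> k) + 2) * (N' + 1) = (real (\<delta>' k) + 2) * (N + 1)" for k
  proof -
    have "N' / real (\<delta>' k + 1) * ((N + 1) / real (\<delta> k + 2)) = N' / real (\<delta>' k + 1) * ((N' + 1) / real (\<delta>' k + 2))"
      using two[of k] unfolding kernel_coeff_upd_two N_def[symmetric] N'_def[symmetric] e1[of k] .
    then have "(N + 1) / real (\<delta> k + 2) = (N' + 1) / real (\<delta>' k + 2)"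
      using N unfolding mult_cancel_left by simp
    then show ?thesis by (simp add: field_simps)
  qed
  \<comment> \<open>Subtracting \<open>f1\<close> from \<open>f2\<close> cancels the products of
    unknowns and leaves a linear relation.\<close>
  have d: "real (\<delta> k) - real (\<delta>' k) = N - N'" for k
    using f1[of k] f2[of k] by (simp add: algebra_simps)
  have "(\<Sum>k\<in>UNIV. real (\<delta> k) - real (\<delta>' k)) = N - N'"
    by (simp add: N_def N'_def mlen_def sum_subtractf)
  then have s: "real CARD('d) * (N - N') = N - N'" unfolding d by simp
  have "N = N'"
  proof (cases "CARD('d) = 1")
    case False
    then show ?thesis using s by simp
  next
    case True
    then have a1: "a \<noteq> 1" using a by simp
    obtain k :: 'd where k: "UNIV = {k}" using True card_1_singletonE by blast
    then have m: "N = real (\<delta> k) + real a" "N' = real (\<delta>' k) + real a" 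
      unfolding N_def N'_def mlen_def k by simp_all
    have "(real (\<delta> k) - real (\<delta>' k)) * (real a - 1) = 0"
      using f1[of k] unfolding m by (simp add: algebra_simps)
    then show ?thesis using a1 m by simp
  qed
  then show ?thesis using d by (simp add: fun_eq_iff)
qed

section \<open>Compressions of the shifts to the constant functions\<close>

definition unit_vec :: "'p \<Rightarrow> 'p \<Rightarrow> complex" where
  "unit_vec p = (\<lambda>q. if q = p then 1 else 0)"

lemma unit_vec_l2: "p \<in> A \<Longrightarrow> unit_vec p \<in> l2 A"
  by (rule l2_finite_support[of "{p}"]) (auto simp: unit_vec_def)

lemma inner_unit_vec: "l2_inner g (\<lambda>q. c * unit_vec p q) = g p * cnj c"
  by (subst l2_inner_finite[of "{p}"]) (auto simp: unit_vec_def)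

lemma inner_unit_vec': "l2_inner g (unit_vec p) = g p"
  using inner_unit_vec[of g 1 p] by simp

lemma wshift_unit_vec:
  fixes \<delta> :: "'i \<Rightarrow> 'd::finite \<Rightarrow> nat"
  shows "wshift a \<delta> k (\<lambda>q. c * unit_vec (\<alpha>, i) q) = (\<lambda>q. (c * of_real (mscale a \<delta> i \<alpha> / mscale a \<delta> i (\<alpha>(k := Suc (\<alpha> k)))))
    * unit_vec (\<alpha>(k := Suc (\<alpha> k)), i) q)"
proof
  fix q :: "('d \<Rightarrow> nat) \<times> 'i" obtain \<beta> j where q: "q = (\<beta>, j)" by (cases q)
  show "wshift a \<delta> k (\<lambda>q. c * unit_vec (\<alpha>, i) q) q = (c * of_real (mscale a \<delta> i \<alpha> / mscale a \<delta> i (\<alpha>(k := Suc (\<alpha> k)))))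
    * unit_vec (\<alpha>(k := Suc (\<alpha> k)), i) q"
  proof (cases "\<beta> = \<alpha>(k := Suc (\<alpha> k)) \<and> j = i")
    case True
    then show ?thesis by (simp add: q wshift_def unit_vec_def)
  next
    case False
    have *: "\<beta> = \<alpha>(k := Suc (\<alpha> k))" if "\<beta>(k := \<beta> k - 1) = \<alpha>" "\<beta> k \<noteq> 0"
      using that(2) by (simp add: that(1)[symmetric])
    have "\<not> (\<beta> k \<noteq> 0 \<and> \<beta>(k := \<beta> k - 1) = \<alpha> \<and> j = i)" using False * by blast
    then have "wshift a \<delta> k (\<lambda>q. c * unit_vec (\<alpha>, i) q) q = 0"
      unfolding q wshift_def unit_vec_def by auto
    moreover have "unit_vec (\<alpha>(k := Suc (\<alpha> k)), i) q = 0"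
      using False unfolding q unit_vec_def by simp
    ultimately show ?thesis by simp
  qed
qed

text \<open>The diagonal entries of the compressions. Shifting a constant basis vector gives a
  multiple of one basis vector, so only the coefficient of \<open>g\<close> at (0, j) survives, and
  the weights telescope to the reciprocal of the normalising factor.\<close>

lemma wshift_inner_constant:
  fixes \<delta> :: "'i \<Rightarrow> 'd::finite \<Rightarrow> nat" and k :: 'd and j :: 'i
  assumes a: "a > 0"
  defines "e \<equiv> unit_vec (\<lambda>_. 0, j) :: ('d \<Rightarrow> nat) \<times> 'i \<Rightarrow> complex"
  shows "l2_inner (wshift a \<delta> k g) (wshift a \<delta> k e)
      = g (\<lambda>_. 0, j) / of_real (kernel_coeff a (\<delta> j) ((\<lambda>_. 0)(k := Suc 0)))"
    and "l2_inner (wshift a \<delta> k (wshift a \<delta> k g)) (wshift a \<delta> k (wshift a \<delta> k e))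
      = g (\<lambda>_. 0, j) / of_real (kernel_coeff a (\<delta> j) ((\<lambda>_. 0)(k := Suc (Suc 0))))"
proof -
  let ?s = "mscale a \<delta> j" let ?o = "(\<lambda>_. 0)(k := Suc 0) :: 'd \<Rightarrow> nat" let ?t = "(\<lambda>_. 0)(k := Suc (Suc 0)) :: 'd \<Rightarrow> nat"
  have pos: "?s ?o > 0" "?s ?t > 0" by (rule mscale_pos[OF a])+
  have sq: "of_real (kernel_coeff a (\<delta> j) \<alpha>) = complex_of_real (?s \<alpha>) * complex_of_real (?s \<alpha>)" for \<alpha>
    using mscale_sq[OF a, of \<delta> j \<alpha>, symmetric] by (simp add: power2_eq_square)
  have e1: "wshift a \<delta> k e = (\<lambda>q. of_real (1 / ?s ?o) * unit_vec (?o, j) q)"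
    using wshift_unit_vec[of a \<delta> k 1 "\<lambda>_. 0" j] by (simp add: e_def)
  have g1: "wshift a \<delta> k g (?o, j) = g (\<lambda>_. 0, j) * of_real (1 / ?s ?o)" for g
    using wshift_upd_Suc[of a \<delta> k g "\<lambda>_. 0" j] by simp
  show "l2_inner (wshift a \<delta> k g) (wshift a \<delta> k e) = g (\<lambda>_. 0, j) / of_real (kernel_coeff a (\<delta> j) ?o)"
    unfolding e1 inner_unit_vec g1 sq using pos by simp
  have e2: "wshift a \<delta> k (wshift a \<delta> k e) = (\<lambda>q. of_real (1 / ?s ?t) * unit_vec (?t, j) q)"
    using wshift_unit_vec[of a \<delta> k "of_real (1 / ?s ?o)" ?o j] pos unfolding e1 by simp
  have "wshift a \<delta> k (wshift a \<delta> k g) (?t, j) = g (\<lambda>_. 0, j) * of_real (1 / ?s ?t)"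
    using wshift_upd_Suc[of a \<delta> k "wshift a \<delta> k g" ?o j] pos by (simp add: g1)
  then show "l2_inner (wshift a \<delta> k (wshift a \<delta> k g)) (wshift a \<delta> k (wshift a \<delta> k e))
      = g (\<lambda>_. 0, j) / of_real (kernel_coeff a (\<delta> j) ?t)"
    unfolding e2 inner_unit_vec sq using pos by simp
qed

text \<open>A constant function is orthogonal to the range of each \<open>Mz k\<close>, and these ranges contain all
  monomials of positive degree; so an isomorphism maps constants to constants.\<close>

lemma isomorphism_maps_constants:
  fixes \<delta>1 :: "'i \<Rightarrow> 'd::finite \<Rightarrow> nat" and \<delta>2 :: "'j \<Rightarrow> 'd \<Rightarrow> nat"
  assumes D1: "diagonal_kernel a I1 \<delta>1 b1 E1 A1 K1" and D2: "diagonal_kernel a I2 \<delta>2 b2 E2 A2 K2"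
    and H1: "is_rkhs (ball 0 1) E1 K1 H1" and H2: "is_rkhs (ball 0 1) E2 K2 H2"
    and U: "unitary_between H1 H2 U" and Mz: "\<And>k h. h \<in> hcarrier H1 \<Longrightarrow> U (Mz k h) = Mz k (U h)"
    and i: "i \<in> I1"
  defines "\<Phi>1 \<equiv> diagonal_kernel.\<Phi> a I1 \<delta>1 b1" and "\<Phi>2 \<equiv> diagonal_kernel.\<Phi> a I2 \<delta>2 b2"
  obtains g where "g \<in> l2 (UNIV \<times> I2)" "U (\<Phi>1 (unit_vec (\<lambda>_. 0, i))) = \<Phi>2 g"
    "\<And>\<alpha> j. \<alpha> \<noteq> (\<lambda>_. 0) \<Longrightarrow> g (\<alpha>, j) = 0"
    "(\<Sum>j\<in>I2. (cmod (g (\<lambda>_. 0, j)))\<^sup>2) = 1"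
proof -
  interpret D1: diagonal_kernel a I1 \<delta>1 b1 E1 A1 K1 by fact
  interpret D2: diagonal_kernel a I2 \<delta>2 b2 E2 A2 K2 by fact
  note C1 = D1.rkhs_eq_model[OF H1, folded \<Phi>1_def] and C2 = D2.rkhs_eq_model[OF H2, folded \<Phi>2_def]
  let ?e = "unit_vec (\<lambda>_. 0, i)"
  have e: "?e \<in> D1.W" using i by (simp add: unit_vec_l2)
  have UB: "bij_betw U (hcarrier H1) (hcarrier H2)"
    and UI: "\<And>f g. \<lbrakk>f \<in> hcarrier H1; g \<in> hcarrier H1\<rbrakk> \<Longrightarrow> hinner H2 (U f) (U g) = hinner H1 f g"
    using U by (auto simp: unitary_between_def)
  have "U (\<Phi>1 ?e) \<in> hcarrier H2" using UB e C1(1) by (auto simp: bij_betw_def)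
  then obtain g where g: "g \<in> D2.W" "U (\<Phi>1 ?e) = \<Phi>2 g" unfolding C2(1) by auto
  have 0: "g (\<alpha>, j) = 0" if "\<alpha> \<noteq> (\<lambda>_. 0)" for \<alpha> j
  proof (cases "j \<in> I2")
    case True
    from that obtain k where k: "\<alpha> k \<noteq> 0" by auto
    define \<beta> where "\<beta> = \<alpha>(k := \<alpha> k - 1)"
    have \<alpha>: "\<alpha> = \<beta>(k := Suc (\<beta> k))" using k by (auto simp: \<beta>_def fun_eq_iff)
    \<comment> \<open>By surjectivity this normalised monomial is the image of some
      \<open>h\<close>. Its shift is then the image of \<open>Mz k h\<close>, which is orthogonal to
      the constant, and pairing with that shift reads off the coefficient of \<open>g\<close> at
      \<alpha>.\<close>
    define f where "f = unit_vec (\<beta>, j)"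
    have f: "f \<in> D2.W" using True by (simp add: f_def unit_vec_l2)
    then have "\<Phi>2 f \<in> U ` hcarrier H1" using UB C2(1) by (auto simp: bij_betw_def)
    then obtain h where h: "h \<in> hcarrier H1" "U h = \<Phi>2 f" by (metis imageE)
    then obtain h' where h': "h' \<in> D1.W" "h = \<Phi>1 h'" using C1(1) by auto
    have "l2_inner g (wshift a \<delta>2 k f) = hinner H2 (\<Phi>2 g) (\<Phi>2 (wshift a \<delta>2 k f))"
      using C2(2)[OF g(1) D2.wshift_W[OF f]] by simp
    also have "\<dots> = hinner H2 (U (\<Phi>1 ?e)) (U (Mz k h))"
      using Mz[OF h(1)] D2.Mz_\<Phi>[of k f] h(2) g(2) by (simp add: \<Phi>2_def)
    also have "\<dots> = hinner H1 (\<Phi>1 ?e) (Mz k h)"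
    proof (rule UI)
      show "\<Phi>1 ?e \<in> hcarrier H1" using e C1(1) by auto
      show "Mz k h \<in> hcarrier H1"
        using D1.Mz_\<Phi>[of k h'] D1.wshift_W[OF h'(1)] h'(2) C1(1) by (auto simp: \<Phi>1_def)
    qed
    also have "\<dots> = l2_inner ?e (wshift a \<delta>1 k h')"
      using D1.Mz_\<Phi>[of k h'] C1(2)[OF e D1.wshift_W[OF h'(1)]] h'(2) by (simp add: \<Phi>1_def)
    also have "\<dots> = 0"
      by (subst l2_inner_commute) (simp add: inner_unit_vec' wshift_def)
    finally have "l2_inner g (wshift a \<delta>2 k f) = 0" .
    moreover have "wshift a \<delta>2 k f = (\<lambda>q. of_real (mscale a \<delta>2 j \<beta> / mscale a \<delta>2 j \<alpha>) * unit_vec (\<alpha>, j) q)"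
      using wshift_unit_vec[of a \<delta>2 k 1 \<beta> j] unfolding \<alpha>[symmetric] by (simp add: f_def)
    ultimately have "g (\<alpha>, j) * cnj (of_real (mscale a \<delta>2 j \<beta> / mscale a \<delta>2 j \<alpha>)) = 0"
      by (simp only: inner_unit_vec)
    then show ?thesis using mscale_pos[OF D1.a_pos, of \<delta>2 j] by (simp add: less_imp_neq[symmetric])
  qed (use l2_off[OF g(1)] in auto)
  have "l2_inner ?e ?e = 1" unfolding inner_unit_vec' by (simp add: unit_vec_def)
  moreover have "hinner H2 (U (\<Phi>1 ?e)) (U (\<Phi>1 ?e)) = hinner H1 (\<Phi>1 ?e) (\<Phi>1 ?e)"
    using e C1(1) by (intro UI) auto
  ultimately have "l2_inner g g = 1" using C1(2)[OF e e] C2(2)[OF g(1) g(1)] g(2) by simp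
  moreover have "l2_inner g g = (\<Sum>p\<in>{\<lambda>_. 0 :: nat} \<times> I2. g p * cnj (g p))"
  proof (rule l2_inner_finite)
    fix p :: "('d \<Rightarrow> nat) \<times> 'j" assume "p \<notin> {\<lambda>_. 0} \<times> I2"
    then show "g p = 0 \<or> g p = 0" using 0[of "fst p" "snd p"] l2_off[OF g(1), of p] by (cases p) auto
  qed (use D2.I in simp)
  moreover have "\<dots> = complex_of_real (\<Sum>j\<in>I2. (cmod (g (\<lambda>_. 0, j)))\<^sup>2)"
  proof -
    have "{\<lambda>_. 0} \<times> I2 = Pair (\<lambda>_ :: 'd. 0 :: nat) ` I2" by auto
    then show ?thesis by (simp add: sum.reindex inj_on_def complex_norm_square del: of_real_power)
  qed
  ultimately have "complex_of_real (\<Sum>j\<in>I2. (cmod (g (\<lambda>_. 0, j)))\<^sup>2) = 1" by simp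
  then show ?thesis using that[OF g 0] by (metis of_real_eq_1_iff)
qed


text \<open>Supplies the column sums: a column of the matrix of a unitary is a conjugated row of the
  matrix of its inverse.\<close>

lemma unitary_between_inv:
  assumes H1: "complex_hilbert_space (\<lambda>c h z v. c * h z v) H1" and U: "unitary_between H1 H2 U"
  shows "unitary_between H2 H1 (inv_into (hcarrier H1) U)"
proof -
  interpret complex_hilbert_space "\<lambda>c h z v. c * h z v" H1 by (rule H1)
  let ?V = "inv_into C U"
  have B: "bij_betw U C (hcarrier H2)" and inj: "inj_on U C" using U by (auto simp: unitary_between_def bij_betw_def)
  have V: "?V (U f) = f" if "f \<in> C" for f using inj that by (rule inv_into_f_f)
  have img: "\<exists>f'\<in>C. f = U f'" if "f \<in> hcarrier H2" for f using B that by (auto simp: bij_betw_def)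
  show ?thesis
    unfolding unitary_between_def
  proof (intro conjI ballI allI)
    show "bij_betw ?V (hcarrier H2) C" by (rule bij_betw_inv_into[OF B])
  next
    fix f g assume "f \<in> hcarrier H2" "g \<in> hcarrier H2"
    then obtain f' g' where f: "f' \<in> C" "f = U f'" and g: "g' \<in> C" "g = U g'" using img by blast
    have "f + g = U (f' + g')" using U f g by (simp add: unitary_between_def)
    then show "?V (f + g) = ?V f + ?V g" using V[of "f' + g'"] V[OF f(1)] V[OF g(1)] f g by simp
    show "hinner H1 (?V f) (?V g) = hinner H2 f g"
      using U f g V[OF f(1)] V[OF g(1)] by (simp add: unitary_between_def)
  next
    fix c f assume "f \<in> hcarrier H2"
    then obtain f' where f: "f' \<in> C" "f = U f'" using img by blast
    have "(\<lambda>z v. c * f z v) = U (\<lambda>z v. c * f' z v)" using U f by (simp add: unitary_between_def)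
    then show "?V (\<lambda>z v. c * f z v) = (\<lambda>z v. c * ?V f z v)"
      using V[of "\<lambda>z v. c * f' z v"] V[OF f(1)] f carrier_intros(3)[OF f(1), of c] by simp
  qed
qed

text \<open>The matrix entries of the unitary between the constants vanish off equal degrees, so the
  numbers of indices of a given degree are both the sum of the squared moduli of a block.\<close>

lemma same_degrees_if_isomorphic:
  fixes \<delta>1 :: "'i \<Rightarrow> 'd::finite \<Rightarrow> nat" and \<delta>2 :: "'j \<Rightarrow> 'd \<Rightarrow> nat"
  assumes D1: "diagonal_kernel (real a) I1 \<delta>1 b1 E1 A1 K1" and D2: "diagonal_kernel (real a) I2 \<delta>2 b2 E2 A2 K2"
    and H1: "is_rkhs (ball 0 1) E1 K1 H1" and H2: "is_rkhs (ball 0 1) E2 K2 H2"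
    and iso: "hilbert_modules_isomorphic H1 H2"
    and a: "a * CARD('d) \<noteq> 1"
  shows "card {i \<in> I1. \<delta>1 i = d} = card {j \<in> I2. \<delta>2 j = d}"
proof -
  interpret D1: diagonal_kernel "real a" I1 \<delta>1 b1 E1 A1 K1 by fact
  interpret D2: diagonal_kernel "real a" I2 \<delta>2 b2 E2 A2 K2 by fact
  interpret H1: complex_hilbert_space "\<lambda>c h z v. c * h z v" H1 using H1 by (simp add: is_rkhs_def)
  note C1 = D1.rkhs_eq_model[OF H1] and C2 = D2.rkhs_eq_model[OF H2]
  have a0: "a > 0" using D1.a by simp
  obtain U where U: "unitary_between H1 H2 U" and Mz: "\<And>k h. h \<in> hcarrier H1 \<Longrightarrow> U (Mz k h) = Mz k (U h)"
    using iso by (auto simp: hilbert_modules_isomorphic_def)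
  have UB: "bij_betw U (hcarrier H1) (hcarrier H2)"
    and UI: "\<And>f g. \<lbrakk>f \<in> hcarrier H1; g \<in> hcarrier H1\<rbrakk> \<Longrightarrow> hinner H2 (U f) (U g) = hinner H1 f g"
    using U by (auto simp: unitary_between_def)
  define V where "V = inv_into (hcarrier H1) U"
  have V: "unitary_between H2 H1 V" unfolding V_def by (rule unitary_between_inv[OF H1.complex_hilbert_space_axioms U])
  have VC: "V h \<in> hcarrier H1" and UV: "U (V h) = h" if "h \<in> hcarrier H2" for h
    using UB that unfolding V_def by (auto simp: bij_betw_def inv_into_into f_inv_into_f)
  have VU: "V (U h) = h" if "h \<in> hcarrier H1" for h
    using UB that unfolding V_def by (auto simp: bij_betw_def)
  have MzC1: "Mz k h \<in> hcarrier H1" if "h \<in> hcarrier H1" for k h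
    using that D1.Mz_\<Phi> D1.wshift_W unfolding C1(1) by auto
  have MzV: "V (Mz k h) = Mz k (V h)" if "h \<in> hcarrier H2" for k h
    using VU[OF MzC1[OF VC[OF that], of k]] Mz[OF VC[OF that], of k] UV[OF that] by simp
  define x where "x i = D1.\<Phi> (unit_vec (\<lambda>_. 0, i))" for i
  define y where "y j = D2.\<Phi> (unit_vec (\<lambda>_. 0, j))" for j
  have eW1: "unit_vec (\<lambda>_. 0, i) \<in> D1.W" if "i \<in> I1" for i using that by (simp add: unit_vec_l2)
  have eW2: "unit_vec (\<lambda>_. 0, j) \<in> D2.W" if "j \<in> I2" for j using that by (simp add: unit_vec_l2)
  have xC: "x i \<in> hcarrier H1" if "i \<in> I1" for i using eW1[OF that] C1(1) by (auto simp: x_def)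
  have yC: "y j \<in> hcarrier H2" if "j \<in> I2" for j using eW2[OF that] C2(1) by (auto simp: y_def)
  define u where "u i j = hinner H2 (U (x i)) (y j)" for i j
  have u_alt: "hinner H1 (V (y j)) (x i) = cnj (u i j)" if "i \<in> I1" "j \<in> I2" for i j
    using UI[OF xC[OF that(1)] VC[OF yC[OF that(2)]]] UV[OF yC[OF that(2)]]
      H1.inner_commute[OF xC[OF that(1)] VC[OF yC[OF that(2)]]] by (simp add: u_def)
  have row: "(\<Sum>j\<in>I2. (cmod (u i j))\<^sup>2) = 1" if i: "i \<in> I1" for i
  proof (rule isomorphism_maps_constants[OF D1 D2 H1 H2 U Mz i, folded x_def])
    fix g assume g: "g \<in> D2.W" "U (x i) = D2.\<Phi> g" "(\<Sum>j\<in>I2. (cmod (g (\<lambda>_. 0, j)))\<^sup>2) = 1"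
    have "u i j = g (\<lambda>_. 0, j)" if "j \<in> I2" for j
      using C2(2)[OF g(1) eW2[OF that]] by (simp add: u_def y_def g(2) inner_unit_vec')
    then show ?thesis using g(3) by simp
  qed
  have column: "(\<Sum>i\<in>I1. (cmod (u i j))\<^sup>2) = 1" if j: "j \<in> I2" for j
  proof (rule isomorphism_maps_constants[OF D2 D1 H2 H1 V MzV j, folded y_def])
    fix g assume g: "g \<in> D1.W" "V (y j) = D1.\<Phi> g" "(\<Sum>i\<in>I1. (cmod (g (\<lambda>_. 0, i)))\<^sup>2) = 1"
    have "cnj (u i j) = g (\<lambda>_. 0, i)" if "i \<in> I1" for i
      using C1(2)[OF g(1) eW1[OF that]] by (simp add: u_alt[OF that j, symmetric] x_def g(2) inner_unit_vec')
    then have "cmod (u i j) = cmod (g (\<lambda>_. 0, i))" if "i \<in> I1" for i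
      using that by (metis complex_mod_cnj)
    then show ?thesis using g(3) by simp
  qed
  have deg: "\<delta>1 i = \<delta>2 j" if i: "i \<in> I1" and j: "j \<in> I2" and ne: "u i j \<noteq> 0" for i j
  proof (rule kernel_coeff_determines_degree[OF a0 a])
    fix k :: 'd
    let ?\<kappa> = "\<lambda>\<delta> n. of_real (kernel_coeff (real a) \<delta> ((\<lambda>_. 0)(k := n)))"
    have \<kappa>0: "?\<kappa> \<delta> n \<noteq> 0" for \<delta> n using kernel_coeff_pos[of "real a" \<delta>] a0 by (simp add: less_imp_neq[symmetric])
    have "U (x i) \<in> hcarrier H2" using UB xC[OF i] by (auto simp: bij_betw_def)
    then obtain g where g: "g \<in> D2.W" "U (x i) = D2.\<Phi> g" unfolding C2(1) by auto
    obtain h where h: "h \<in> D1.W" "V (y j) = D1.\<Phi> h" using VC[OF yC[OF j]] unfolding C1(1) by auto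
    have gu: "g (\<lambda>_. 0, j) = u i j"
      using C2(2)[OF g(1) eW2[OF j]] by (simp add: u_def y_def g(2) inner_unit_vec')
    have hu: "cnj (h (\<lambda>_. 0, i)) = u i j"
      using C1(2)[OF h(1) eW1[OF i]] u_alt[OF i j] by (simp add: x_def h(2) inner_unit_vec')
    let ?s1 = "wshift (real a) \<delta>1 k" and ?s2 = "wshift (real a) \<delta>2 k"
    let ?e1 = "unit_vec (\<lambda>_. 0, i) :: ('d \<Rightarrow> nat) \<times> 'i \<Rightarrow> complex"
    let ?e2 = "unit_vec (\<lambda>_. 0, j) :: ('d \<Rightarrow> nat) \<times> 'j \<Rightarrow> complex"
    note ar = iffD2[OF of_nat_0_less_iff a0]
    \<comment> \<open>Correspondence of coefficient families under \<open>U\<close>. It is preserved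
      by shifts and respects inner products, so the first- and second-order comparisons run in the
      same way.\<close>
    define R where "R p q \<longleftrightarrow> p \<in> D1.W \<and> q \<in> D2.W \<and> U (D1.\<Phi> p) = D2.\<Phi> q" for p q
    have R_shift: "R (?s1 p) (?s2 q)" if "R p q" for p q
      using that Mz[of "D1.\<Phi> p" k] C1(1) by (auto simp: R_def D1.wshift_W D2.wshift_W D1.Mz_\<Phi> D2.Mz_\<Phi>)
    have R_inner: "l2_inner q q' = l2_inner p p'" if "R p q" "R p' q'" for p q p' q'
      using that UI[of "D1.\<Phi> p" "D1.\<Phi> p'"] C1 C2 by (auto simp: R_def)
    have R: "R ?e1 g" "R h ?e2"
      using g h eW1[OF i] eW2[OF j] UV[OF yC[OF j]] by (simp_all add: R_def x_def y_def)
    \<comment> \<open>The matrix entry \<open>u i j\<close> is seen from both sides: the left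
      pairing divides it by the coefficient of \<open>\<delta>2 j\<close>, the right one by that of
      \<open>\<delta>1 i\<close>. If the entry is nonzero, the two coefficients agree.\<close>
    note 1 = R_inner[OF R_shift[OF R(1)] R_shift[OF R(2)]]
    note 2 = R_inner[OF R_shift[OF R_shift[OF R(1)]] R_shift[OF R_shift[OF R(2)]]]
    have "u i j / ?\<kappa> (\<delta>2 j) (Suc 0) = u i j / ?\<kappa> (\<delta>1 i) (Suc 0)"
      using 1 wshift_inner_constant(1)[OF ar, of \<delta>2 k g j] wshift_inner_constant(1)[OF ar, of \<delta>1 k h i]
        l2_inner_commute[of "?s1 ?e1" "?s1 h"] gu hu by simp
    then show "kernel_coeff (real a) (\<delta>1 i) ((\<lambda>_. 0)(k := Suc 0)) = kernel_coeff (real a) (\<delta>2 j) ((\<lambda>_. 0)(k := Suc 0))"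
      using ne \<kappa>0 by (simp add: divide_inverse)
    have "u i j / ?\<kappa> (\<delta>2 j) (Suc (Suc 0)) = u i j / ?\<kappa> (\<delta>1 i) (Suc (Suc 0))"
      using 2 wshift_inner_constant(2)[OF ar, of \<delta>2 k g j] wshift_inner_constant(2)[OF ar, of \<delta>1 k h i]
        l2_inner_commute[of "?s1 (?s1 ?e1)" "?s1 (?s1 h)"] gu hu by simp
    then show "kernel_coeff (real a) (\<delta>1 i) ((\<lambda>_. 0)(k := Suc (Suc 0))) = kernel_coeff (real a) (\<delta>2 j) ((\<lambda>_. 0)(k := Suc (Suc 0)))"
      using ne \<kappa>0 by (simp add: divide_inverse)
  qed
  let ?J1 = "{i \<in> I1. \<delta>1 i = d}" and ?J2 = "{j \<in> I2. \<delta>2 j = d}"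
  have "real (card ?J1) = (\<Sum>i\<in>?J1. \<Sum>j\<in>I2. (cmod (u i j))\<^sup>2)" using row by simp
  also have "\<dots> = (\<Sum>i\<in>?J1. \<Sum>j\<in>?J2. (cmod (u i j))\<^sup>2)"
    using D2.I deg by (intro sum.cong refl sum.mono_neutral_right) auto
  also have "\<dots> = (\<Sum>j\<in>?J2. \<Sum>i\<in>?J1. (cmod (u i j))\<^sup>2)" by (rule sum.swap)
  also have "\<dots> = (\<Sum>j\<in>?J2. \<Sum>i\<in>I1. (cmod (u i j))\<^sup>2)"
    using D1.I deg by (intro sum.cong refl sum.mono_neutral_left) auto
  also have "\<dots> = real (card ?J2)" using column by simp
  finally show ?thesis by simp
qed

section \<open>Generations of a rooted directed tree\<close>

locale dtree =
  fixes G :: "'a pair_pre_digraph"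
  assumes directed_tree: "directed_tree G" and locally_finite: "locally_finite G"
begin

abbreviation "r \<equiv> tree_root G"

lemma rooted: "rooted_directed_tree G" and leafless: "u \<in> pverts G \<Longrightarrow> Chi G u \<noteq> {}"
  using directed_tree by (auto simp: directed_tree_def)

sublocale pair_wf_digraph G using rooted by (simp add: rooted_directed_tree_def)

lemma arc_verts: "(u, w) \<in> parcs G \<Longrightarrow> u \<in> pverts G \<and> w \<in> pverts G"
  using in_arcsD1 in_arcsD2 by blast

lemma parent_unique: "(p, u) \<in> parcs G \<Longrightarrow> (q, u) \<in> parcs G \<Longrightarrow> p = q"
  using rooted arc_verts[of p u] unfolding rooted_directed_tree_def by blast

lemma ex1_root: "\<exists>!r. r \<in> pverts G \<and> \<not> (\<exists>p. (p, r) \<in> parcs G)"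
  using rooted by (simp add: rooted_directed_tree_def)

lemma root_vert: "r \<in> pverts G" and root_no_parent: "(p, r) \<notin> parcs G"
  using theI'[OF ex1_root] by (auto simp: tree_root_def)

lemma parent_exists: "u \<in> pverts G \<Longrightarrow> u \<noteq> r \<Longrightarrow> \<exists>p. (p, u) \<in> parcs G"
  using ex1_root root_vert root_no_parent by blast

lemma par_eq: "(p, u) \<in> parcs G \<Longrightarrow> par G u = p"
  unfolding par_def by (rule the_equality) (auto intro: parent_unique)

lemma par_arc: "u \<in> pverts G \<Longrightarrow> u \<noteq> r \<Longrightarrow> (par G u, u) \<in> parcs G"
  using parent_exists par_eq by fastforce

text \<open>Connectedness only provides an undirected path. Along it directed reachability persists:
  a step against an arc leads to the parent, and by uniqueness of parents the directed path already
  passes through that vertex just before the end.\<close>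

lemma reachable_root: assumes "u \<in> pverts G" shows "(r, u) \<in> (parcs G)\<^sup>*"
proof -
  let ?S = "mk_symmetric (with_proj G)"
  have "Digraph_Component.connected (with_proj G)"
    using rooted by (auto simp: rooted_directed_tree_def Digraph_Component.tree_def)
  then have "(r, u) \<in> rtrancl_on (pverts G) (parcs ?S)"
    using root_vert assms
    by (auto simp: Digraph_Component.connected_def strongly_connected_def mk_symmetric_def reachable_def)
  then show ?thesis
  proof (induction rule: rtrancl_on_induct)
    case (step y z)
    then have "(y, z) \<in> parcs G \<or> (z, y) \<in> parcs G" by (auto simp: mk_symmetric_def)
    then show ?case
    proof
      assume "(z, y) \<in> parcs G"
      moreover from this have "y \<noteq> r" using root_no_parent by auto
      then obtain q where "(r, q) \<in> (parcs G)\<^sup>*" "(q, y) \<in> parcs G"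
        using step.IH by (metis rtranclE)
      ultimately show ?thesis using parent_unique by metis
    qed (use step.IH in auto)
  qed auto
qed

text \<open>A walk from the root can only be retraced through unique parents, and it has to stop at
  the one vertex that has none.\<close>

lemma relpow_root_unique: "\<lbrakk>(r, u) \<in> parcs G ^^ m; (r, u) \<in> parcs G ^^ n\<rbrakk> \<Longrightarrow> m = n"
proof (induction m arbitrary: n u)
  case 0
  then show ?case using root_no_parent by (cases n) (auto elim: relcompE)
next
  case (Suc m)
  obtain q where q: "(r, q) \<in> parcs G ^^ m" "(q, u) \<in> parcs G" using Suc.prems(1) by auto
  have "n \<noteq> 0" using Suc.prems q root_no_parent by (cases n) auto
  then obtain k where k: "n = Suc k" by (cases n) auto
  obtain q' where "(r, q') \<in> parcs G ^^ k" "(q', u) \<in> parcs G" using Suc.prems(2) k by auto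
  then show ?case using Suc.IH[OF q(1), of k] q(2) parent_unique k by metis
qed

lemma awalk_relpow: "awalk u p v \<Longrightarrow> (u, v) \<in> parcs G ^^ length p"
proof (induction p arbitrary: u)
  case (Cons e p)
  then have e: "(u, snd e) \<in> parcs G" and p: "awalk (snd e) p v" by (auto simp: awalk_Cons_iff)
  show ?case using relpow_Suc_I2[OF e Cons.IH[OF p]] by (simp only: length_Cons)
qed (simp add: awalk_def)

text \<open>Connects \<open>depth\<close>, a definite description over paths without repetition,
  with powers of the arc relation. All walks from the root to a vertex have equal length, so passing
  to a path without repetition does not change it.\<close>

lemma depth_eq: assumes "(r, u) \<in> parcs G ^^ n" shows "depth G u = n"
proof -
  have u: "u \<in> pverts G" using assms root_vert arc_verts by (cases n) auto
  have "r \<rightarrow>\<^sup>*\<^bsub>G\<^esub> u"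
    using assms
  proof (induction n arbitrary: u)
    case 0
    then show ?case using root_vert by simp
  next
    case (Suc n)
    then obtain q where "r \<rightarrow>\<^sup>*\<^bsub>G\<^esub> q" "(q, u) \<in> parcs G" by auto
    then show ?case by (meson reachable_adj_trans with_proj_simps(3))
  qed
  then obtain p where p: "awalk r p u" unfolding reachable_awalk by blast
  have "apath r (awalk_to_apath p) u" by (rule apath_awalk_to_apath[OF p])
  moreover have "length q = n" if "apath r q u" for q
    using relpow_root_unique[OF awalk_relpow assms] that by (auto simp: apath_def)
  ultimately show ?thesis unfolding depth_def by (intro the_equality) blast+
qed

lemma relpow_depth: assumes "u \<in> pverts G" shows "(r, u) \<in> parcs G ^^ depth G u"
  using reachable_root[OF assms] depth_eq unfolding rtrancl_power by auto

lemma depth_root: "depth G r = 0" by (rule depth_eq) simp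

lemma depth_child: assumes "(u, w) \<in> parcs G" shows "depth G w = Suc (depth G u)"
  by (rule depth_eq) (use relpow_depth[of u] arc_verts[OF assms] assms in auto)

lemma depth_0_iff: "u \<in> pverts G \<Longrightarrow> depth G u = 0 \<longleftrightarrow> u = r"
  using relpow_depth[of u] depth_root by auto

lemma generation_0: "generation 0 G = {r}"
  using depth_0_iff root_vert by (auto simp: generation_def)

lemma generation_Suc: "generation (Suc n) G = (\<Union>p\<in>generation n G. Chi G p)"
proof (intro equalityI subsetI)
  fix u assume "u \<in> generation (Suc n) G"
  then have u: "u \<in> pverts G" "depth G u = Suc n" by (auto simp: generation_def)
  then have "u \<noteq> r" using depth_root by auto
  from par_arc[OF u(1) this] show "u \<in> (\<Union>p\<in>generation n G. Chi G p)"
    using depth_child u arc_verts by (fastforce simp: generation_def Chi_def)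
qed (auto simp: generation_def Chi_def depth_child dest: arc_verts)

lemma finite_generation: "finite (generation n G)"
proof (induction n)
  case (Suc n)
  then show ?case unfolding generation_Suc
    using locally_finite by (auto simp: locally_finite_def generation_def)
qed (simp add: generation_0)

lemma finite_Chi: "u \<in> pverts G \<Longrightarrow> finite (Chi G u)"
  using locally_finite by (simp add: locally_finite_def)

lemma card_Chi_pos: "u \<in> pverts G \<Longrightarrow> card (Chi G u) > 0"
  using finite_Chi leafless by (simp add: card_gt_0_iff)

text \<open>Leaflessness makes the truncated \<open>card (Chi G p) - 1\<close> exact. In particular
  generations never shrink, so later truncated differences of their sizes are exact too.\<close>

lemma card_generation_Suc:
  "card (generation (Suc n) G) = card (generation n G) + (\<Sum>p\<in>generation n G. card (Chi G p) - 1)"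
proof -
  have "card (generation (Suc n) G) = (\<Sum>p\<in>generation n G. card (Chi G p))"
    unfolding generation_Suc
  proof (rule card_UN_disjoint[OF finite_generation])
    show "\<forall>p\<in>generation n G. finite (Chi G p)" using finite_Chi by (simp add: generation_def)
  qed (auto simp: Chi_def dest: parent_unique)
  also have "\<dots> = (\<Sum>p\<in>generation n G. 1 + (card (Chi G p) - 1))"
    by (intro sum.cong refl) (use card_Chi_pos in \<open>force simp: generation_def\<close>)
  finally show ?thesis unfolding sum.distrib by simp
qed

lemma mem_sib: "u \<in> pverts G \<Longrightarrow> u \<noteq> r \<Longrightarrow> u \<in> sib G u"
  using par_arc by (simp add: sib_def Chi_def)

end


section \<open>Products of trees\<close>

locale dtree_family =
  fixes T :: "'d::finite \<Rightarrow> 'a pair_pre_digraph"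
  assumes trees: "\<And>j. directed_tree (T j)" "\<And>j. locally_finite (T j)"
begin

sublocale dtree "T j" for j by unfold_locales (rule trees)+

abbreviation "gen j n \<equiv> generation n (T j)"

lemma mem_pV: "v \<in> pV T \<longleftrightarrow> (\<forall>j. v j \<in> pverts (T j))"
  by (simp add: dcprod_def Let_def)

lemma mem_Phi: "v \<in> Phi T F \<longleftrightarrow> v \<in> pV T \<and> (\<forall>j. v j \<noteq> tree_root (T j) \<longleftrightarrow> j \<in> F)"
  by (auto simp: Phi_def)

lemma mem_Phi_depth: "v \<in> pV T \<Longrightarrow> v \<in> Phi T F \<longleftrightarrow> F = {j. pdepth T v j \<noteq> 0}"
  by (auto simp: mem_Phi pdepth_def mem_pV depth_0_iff)

lemma Phi_arc: "u \<in> Phi T F \<Longrightarrow> j \<in> F \<Longrightarrow> (par (T j) (u j), u j) \<in> parcs (T j)"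
  by (intro par_arc) (auto simp: mem_Phi mem_pV)

text \<open>In terms of parents the sibling relation is visibly an equivalence on
  \<open>Phi T F\<close>, which the definition through \<open>sib\<close> hides.\<close>

lemma mem_sibF:
  assumes "u \<in> Phi T F"
  shows "w \<in> sibF T F u \<longleftrightarrow> w \<in> Phi T F \<and> (\<forall>j\<in>F. par (T j) (w j) = par (T j) (u j))"
proof
  assume w: "w \<in> sibF T F u"
  have "(par (T j) (u j), w j) \<in> parcs (T j)" if "j \<in> F" for j
    using w that by (auto simp: sibF_def sib_def Chi_def)
  then show "w \<in> Phi T F \<and> (\<forall>j\<in>F. par (T j) (w j) = par (T j) (u j))"
    using w assms par_eq root_no_parent by (fastforce simp: sibF_def mem_Phi)
next
  assume w: "w \<in> Phi T F \<and> (\<forall>j\<in>F. par (T j) (w j) = par (T j) (u j))"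
  then have "(par (T j) (u j), w j) \<in> parcs (T j)" if "j \<in> F" for j
    using Phi_arc[of w F j] that by simp
  moreover have "w j = u j" if "j \<notin> F" for j using w assms that mem_Phi by metis
  ultimately show "w \<in> sibF T F u" using w by (auto simp: sibF_def sib_def Chi_def mem_Phi)
qed

lemma sibF_pdepth: "u \<in> Phi T F \<Longrightarrow> w \<in> sibF T F u \<Longrightarrow> pdepth T w = pdepth T u"
proof
  fix j assume u: "u \<in> Phi T F" and w: "w \<in> sibF T F u"
  show "pdepth T w j = pdepth T u j"
  proof (cases "j \<in> F")
    case True
    then show ?thesis
      using depth_child[OF Phi_arc[OF u True]] depth_child[OF Phi_arc[of w F j]] w mem_sibF[OF u]
      by (simp add: pdepth_def)
  next
    case False
    then show ?thesis using w by (simp add: pdepth_def sibF_def)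
  qed
qed

text \<open>The common source of the sums in (ii) and (iii). A sibling class at depth \<alpha> is
  determined by its tuple of parents, which is arbitrary in the generations
  \<open>\<alpha> j - 1\<close>; the sum over representatives becomes a sum over a product set and
  factorises. The depth forces \<open>F\<close>.\<close>

lemma sum_transversal:
  assumes \<Omega>: "transversal T \<Omega>"
  shows "(\<Sum>u | u \<in> \<Omega> F \<and> pdepth T u = \<alpha>. \<Prod>j\<in>F. card (sib (T j) (u j)) - 1)
    = (if F = {j. \<alpha> j \<noteq> 0}
       then \<Prod>j\<in>F. card (gen j (\<alpha> j)) - card (gen j (\<alpha> j - 1)) else 0)"
proof (cases "F = {j. \<alpha> j \<noteq> 0}")
  case False
  have \<Omega>Phi: "\<Omega> F \<subseteq> Phi T F" using \<Omega> by (auto simp: transversal_def)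
  have "F = {j. \<alpha> j \<noteq> 0}" if "u \<in> \<Omega> F" "pdepth T u = \<alpha>" for u
    using \<Omega>Phi that mem_Phi mem_Phi_depth[of u F] by blast
  then have "{u. u \<in> \<Omega> F \<and> pdepth T u = \<alpha>} = {}" using False by blast
  then show ?thesis using False by (simp only: sum.empty if_False)
next
  case True
  have \<Omega>Phi: "u \<in> Phi T F" if "u \<in> \<Omega> F" for u using \<Omega> that by (auto simp: transversal_def)
  have \<Omega>1: "\<exists>!w. w \<in> \<Omega> F \<and> w \<in> sibF T F u" if "u \<in> Phi T F" for u using \<Omega> that by (simp add: transversal_def)
  let ?U = "{u. u \<in> \<Omega> F \<and> pdepth T u = \<alpha>}"
  let ?P = "PiE F (\<lambda>j. gen j (\<alpha> j - 1))"
  define m where "m u = restrict (\<lambda>j. par (T j) (u j)) F" for u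
  have "bij_betw m ?U ?P"
  proof (rule bij_betw_imageI)
    show "inj_on m ?U"
    proof (rule inj_onI)
      fix u w assume u: "u \<in> ?U" and w: "w \<in> ?U" and eq: "m u = m w"
      have "par (T j) (w j) = par (T j) (u j)" if "j \<in> F" for j
        using fun_cong[OF eq, of j] that by (simp add: m_def)
      then have "w \<in> sibF T F u" "u \<in> sibF T F u" using u w \<Omega>Phi by (simp_all add: mem_sibF)
      then show "u = w" using \<Omega>1[OF \<Omega>Phi, of u] u w by blast
    qed
    show "m ` ?U = ?P"
    proof (intro equalityI subsetI)
      fix p assume "p \<in> m ` ?U"
      then obtain u where u: "u \<in> \<Omega> F" "pdepth T u = \<alpha>" "p = m u" by auto
      have "par (T j) (u j) \<in> gen j (\<alpha> j - 1)" if "j \<in> F" for j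
        using depth_child[OF Phi_arc[OF \<Omega>Phi[OF u(1)] that]] arc_verts[OF Phi_arc[OF \<Omega>Phi[OF u(1)] that]] u(2)
        by (auto simp: generation_def pdepth_def)
      then show "p \<in> ?P" by (auto simp: u(3) m_def)
    next
      fix p assume p: "p \<in> ?P"
      then have pv: "p j \<in> pverts (T j)" "depth (T j) (p j) = \<alpha> j - 1" if "j \<in> F" for j
        using that by (auto simp: generation_def PiE_def Pi_def)
      \<comment> \<open>Leaflessness provides a child of each \<open>p j\<close>; the element of the
        transversal in the class of \<open>v\<close> then has \<open>p\<close> as its tuple of
        parents.\<close>
      define v where "v j = (if j \<in> F then SOME w. w \<in> Chi (T j) (p j) else tree_root (T j))" for j
      have arc: "(p j, v j) \<in> parcs (T j)" if "j \<in> F" for j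
        using someI_ex[of "\<lambda>w. w \<in> Chi (T j) (p j)"] leafless[OF pv(1)[OF that]] that by (auto simp: v_def Chi_def)
      have "v j \<in> pverts (T j)" for j
        using arc[of j] arc_verts root_vert by (cases "j \<in> F") (auto simp: v_def)
      moreover have "v j \<noteq> tree_root (T j) \<longleftrightarrow> j \<in> F" for j
        using arc[of j] root_no_parent by (cases "j \<in> F") (auto simp: v_def)
      ultimately have v: "v \<in> Phi T F" by (simp add: mem_Phi mem_pV)
      obtain w where w: "w \<in> \<Omega> F" "w \<in> sibF T F v" using \<Omega>1[OF v] by blast
      have "pdepth T w j = \<alpha> j" for j
      proof (cases "j \<in> F")
        case j: True
        then show ?thesis
          using sibF_pdepth[OF v w(2)] depth_child[OF arc[OF j]] pv(2)[OF j] True by (simp add: pdepth_def)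
      next
        case j: False
        then show ?thesis using sibF_pdepth[OF v w(2)] True by (auto simp: pdepth_def v_def depth_root)
      qed
      moreover have "m w = p"
      proof
        fix j show "m w j = p j"
        proof (cases "j \<in> F")
          case True
          then have "par (T j) (w j) = par (T j) (v j)" using iffD1[OF mem_sibF[OF v] w(2)] by blast
          also have "\<dots> = p j" by (rule par_eq[OF arc[OF True]])
          finally show ?thesis using True by (simp add: m_def)
        next
          case False
          then show ?thesis using PiE_arb[OF p False] by (simp add: m_def)
        qed
      qed
      ultimately show "p \<in> m ` ?U" using w(1) by blast
    qed
  qed
  then have "(\<Sum>p\<in>?P. \<Prod>j\<in>F. card (Chi (T j) (p j)) - 1) = (\<Sum>u\<in>?U. \<Prod>j\<in>F. card (Chi (T j) (m u j)) - 1)"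
    by (rule sum.reindex_bij_betw[symmetric])
  also have "\<dots> = (\<Sum>u\<in>?U. \<Prod>j\<in>F. card (sib (T j) (u j)) - 1)"
    by (intro sum.cong prod.cong refl) (simp add: m_def sib_def)
  finally have "(\<Sum>u\<in>?U. \<Prod>j\<in>F. card (sib (T j) (u j)) - 1) = (\<Prod>j\<in>F. \<Sum>p\<in>gen j (\<alpha> j - 1). card (Chi (T j) p) - 1)"
    by (simp add: prod_sum_PiE finite_generation)
  also have "\<dots> = (\<Prod>j\<in>F. card (gen j (\<alpha> j)) - card (gen j (\<alpha> j - 1)))"
  proof (rule prod.cong[OF refl])
    fix j assume "j \<in> F"
    then have "\<alpha> j = Suc (\<alpha> j - 1)" using True by simp
    then show "(\<Sum>p\<in>gen j (\<alpha> j - 1). card (Chi (T j) p) - 1)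
      = card (gen j (\<alpha> j)) - card (gen j (\<alpha> j - 1))"
      using card_generation_Suc[of "\<alpha> j - 1" j] by simp
  qed
  finally show ?thesis using True by simp
qed

end

section \<open>Bases of finite-dimensional function spaces\<close>

lemma cdim_eq_card:
  fixes b :: "'i \<Rightarrow> 'v \<Rightarrow> complex"
  assumes I: "finite I" and bM: "\<And>i. i \<in> I \<Longrightarrow> b i \<in> M"
    and spans: "\<And>x. x \<in> M \<Longrightarrow> \<exists>c. x = (\<Sum>i\<in>I. (\<lambda>v. c i * b i v))"
    and indep: "\<And>c i. \<lbrakk>(\<Sum>i\<in>I. (\<lambda>v. c i * b i v)) = 0; i \<in> I\<rbrakk> \<Longrightarrow> c i = 0"
  shows "cdim M = card I"
proof -
  interpret vector_space "\<lambda>(c::complex) f (v::'v). c * f v" by (rule vector_space_fun)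
  have inj: "inj_on b I"
  proof (rule inj_onI, rule ccontr)
    fix i j assume ij: "i \<in> I" "j \<in> I" "b i = b j" "i \<noteq> j"
    define c where "c k = (if k = i then 1 else 0) - (if k = j then 1 else (0::complex))" for k
    have "(\<Sum>k\<in>I. c k * b k v) = 0" for v
    proof -
      have "c k * b k v = (if k = i then b k v else 0) - (if k = j then b k v else 0)" for k
        by (simp add: c_def)
      then show ?thesis using ij I by (simp add: sum_subtractf)
    qed
    then have "(\<Sum>k\<in>I. (\<lambda>v. c k * b k v)) = 0" by (simp add: fun_eq_iff sum_fun_apply)
    then have "c i = 0" using indep ij by blast
    then show False using ij(4) by (simp add: c_def)
  qed
  show ?thesis unfolding cdim_def
  proof (rule dim_unique[of "b ` I"])
    show "b ` I \<subseteq> M" using bM by auto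
    show "M \<subseteq> span (b ` I)"
    proof
      fix x assume "x \<in> M"
      then obtain c where "x = (\<Sum>i\<in>I. (\<lambda>v. c i * b i v))" using spans by blast
      then show "x \<in> span (b ` I)" by (simp only:) (intro span_sum span_scale span_base imageI)
    qed
    show "card (b ` I) = card I" by (rule card_image[OF inj])
    show "independent (b ` I)"
    proof
      assume "dependent (b ` I)"
      then obtain u w where u: "w \<in> b ` I" "u w \<noteq> 0" "(\<Sum>w\<in>b ` I. (\<lambda>v. u w * w v)) = 0"
        using dependent_finite[of "b ` I"] I by auto
      have "(\<Sum>i\<in>I. (\<lambda>v. u (b i) * b i v)) = 0" using u(3) by (simp add: sum.reindex[OF inj])
      then show False using indep[of "\<lambda>i. u (b i)"] u by auto
    qed
  qed
qed

text \<open>A maximal orthonormal family is a basis, since normalising the defect of an expansion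
  would extend it.\<close>

lemma orthonormal_basis_exists:
  fixes M :: "('v \<Rightarrow> complex) set"
  assumes S: "finite S" and MS: "\<And>x v. \<lbrakk>x \<in> M; v \<notin> S\<rbrakk> \<Longrightarrow> x v = 0"
    and zero: "0 \<in> M" and add: "\<And>x y. \<lbrakk>x \<in> M; y \<in> M\<rbrakk> \<Longrightarrow> x + y \<in> M"
    and scale: "\<And>c x. x \<in> M \<Longrightarrow> (\<lambda>v. c * x v) \<in> M"
  obtains e where "\<And>i. i < cdim M \<Longrightarrow> e i \<in> M"
    "\<And>i j. \<lbrakk>i < cdim M; j < cdim M\<rbrakk> \<Longrightarrow> l2_inner (e i) (e j) = (if i = j then 1 else 0)"
    "\<And>x. x \<in> M \<Longrightarrow> x = (\<Sum>i<cdim M. (\<lambda>v. l2_inner x (e i) * e i v))"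
proof -
  interpret vector_space "\<lambda>(c::complex) f (v::'v). c * f v" by (rule vector_space_fun)
  have Ml2: "x \<in> l2 S" if "x \<in> M" for x using MS that S by (intro l2_finite_support[OF S]) auto
  have sumM: "(\<Sum>i\<in>J. f i) \<in> M" if "\<And>i. i \<in> J \<Longrightarrow> f i \<in> M" for J :: "nat set" and f
    using that by (induction J rule: infinite_finite_induct) (auto intro: zero add)
  define ON where "ON n e \<longleftrightarrow> (\<forall>i<n. e i \<in> M) \<and> (\<forall>i<n. \<forall>j<n. l2_inner (e i) (e j) = (if i = j then 1 else 0))"
    for n :: nat and e :: "nat \<Rightarrow> 'v \<Rightarrow> complex"
  have coeff: "l2_inner (\<Sum>i<n. (\<lambda>v. c i * e i v)) (e j) = c j" if e: "ON n e" and j: "j < n" for n e c j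
  proof -
    have eM: "e i \<in> M" if "i < n" for i using e that by (simp add: ON_def)
    have "l2_inner (\<Sum>i<n. (\<lambda>v. c i * e i v)) (e j) = (\<Sum>i<n. l2_inner (\<lambda>v. c i * e i v) (e j))"
      by (rule l2_inner_sum[of _ S]) (use eM j in \<open>auto intro: Ml2 scale\<close>)
    also have "\<dots> = (\<Sum>i<n. if i = j then c i else 0)"
      by (intro sum.cong refl) (use e j in \<open>auto simp: l2_inner_scale ON_def\<close>)
    finally show ?thesis using j by simp
  qed
  have indep: "c j = 0" if "ON n e" "(\<Sum>i<n. (\<lambda>v. c i * e i v)) = 0" "j < n" for n e c j
    using coeff[OF that(1,3), of c] that(2) by (simp add: l2_inner_finite[of "{}"])
  \<comment> \<open>An orthonormal family is independent in the span of the card S point masses.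
    This bound is what makes a longest family exist.\<close>
  have bound: "n \<le> card S" if e: "ON n e" for n e
  proof -
    define N where "N = range (\<lambda>c. \<Sum>i<n. (\<lambda>v. c i * e i v))"
    have "cdim N = card {..<n}"
    proof (rule cdim_eq_card)
      fix i assume "i \<in> {..<n}"
      then have "e i = (\<Sum>k<n. (\<lambda>v. (if k = i then 1 else 0) * e k v))"
        by (auto simp: fun_eq_iff sum_fun_apply if_distrib[of "\<lambda>x. x * _"] cong: if_cong)
      then show "e i \<in> N" unfolding N_def by (rule range_eqI[of _ _ "\<lambda>k. if k = i then 1 else 0"])
    qed (use indep[OF e] in \<open>auto simp: N_def\<close>)
    moreover have "N \<subseteq> span (unit_vec ` S)"
    proof
      fix x assume "x \<in> N"
      then have "x \<in> M" using e by (auto simp: N_def ON_def intro!: sumM scale)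
      then have "x = (\<Sum>s\<in>S. (\<lambda>v. x s * unit_vec s v))"
        using MS S by (auto simp: fun_eq_iff sum_fun_apply unit_vec_def if_distrib[of "\<lambda>y. _ * y"] cong: if_cong)
      also have "\<dots> \<in> span (unit_vec ` S)" by (intro span_sum span_scale span_base) auto
      finally show "x \<in> span (unit_vec ` S)" .
    qed
    then have "cdim N \<le> card (unit_vec ` S :: ('v \<Rightarrow> complex) set)"
      unfolding cdim_def using S by (intro dim_le_card) auto
    ultimately show ?thesis using card_image_le[OF S, of "unit_vec :: 'v \<Rightarrow> 'v \<Rightarrow> complex"] by simp
  qed
  have "ON 0 e" for e by (simp add: ON_def)
  then obtain n where n: "\<exists>e. ON n e" "\<And>m. \<exists>e. ON m e \<Longrightarrow> m \<le> n"
    using ex_has_greatest_nat[of "\<lambda>n. \<exists>e. ON n e" 0 id "Suc (card S)"] bound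
    by (auto simp: less_Suc_eq_le)
  obtain e where e: "ON n e" using n(1) by blast
  have eM: "e i \<in> M" if "i < n" for i using e that by (simp add: ON_def)
  have expand: "x = (\<Sum>i<n. (\<lambda>v. l2_inner x (e i) * e i v))" if x: "x \<in> M" for x
  proof (rule ccontr)
    define p where "p = (\<Sum>i<n. (\<lambda>v. l2_inner x (e i) * e i v))"
    define y where "y = x + (\<lambda>v. (-1) * p v)"
    assume "x \<noteq> (\<Sum>i<n. (\<lambda>v. l2_inner x (e i) * e i v))"
    then have "y \<noteq> 0" by (auto simp: y_def p_def fun_eq_iff)
    have pM: "p \<in> M" unfolding p_def by (intro sumM scale eM) auto
    have yM: "y \<in> M" unfolding y_def by (intro add x scale pM)
    have ye: "l2_inner y (e j) = 0" if "j < n" for j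
      unfolding y_def using l2_inner_add[OF Ml2[OF x] Ml2[OF scale[OF pM, of "-1"]] Ml2[OF eM[OF that]]]
        coeff[OF e that, of "\<lambda>i. l2_inner x (e i)", folded p_def]
      by (simp only: l2_inner_scale) simp
    define t where "t = sqrt (\<Sum>\<^sub>\<infinity>v. (cmod (y v))\<^sup>2)"
    have "l2_inner y y \<noteq> 0" using l2_inner_definite[OF Ml2[OF yM]] \<open>y \<noteq> 0\<close> by blast
    then have t: "t \<noteq> 0" "l2_inner y y = complex_of_real t * complex_of_real t"
      unfolding t_def l2_inner_self by (simp_all add: infsum_nonneg flip: of_real_mult)
    define w where "w = (\<lambda>v. of_real (1 / t) * y v)"
    define e' where "e' = e(n := w)"
    have wM: "w \<in> M" unfolding w_def by (rule scale[OF yM])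
    have wl: "l2_inner w f = of_real (1 / t) * l2_inner y f" for f
      unfolding w_def by (rule l2_inner_scale)
    have wr: "l2_inner f w = of_real (1 / t) * l2_inner f y" for f
      unfolding l2_inner_commute[of f w] l2_inner_commute[of f y] wl
      by (simp only: complex_cnj_mult complex_cnj_complex_of_real)
    have ey: "l2_inner (e j) y = 0" if "j < n" for j
      using ye[OF that] l2_inner_commute[of "e j" y] by simp
    have "ON (Suc n) e'"
      unfolding ON_def
    proof (intro conjI allI impI)
      fix i assume "i < Suc n"
      then show "e' i \<in> M" using eM wM by (auto simp: e'_def)
    next
      fix i j assume "i < Suc n" "j < Suc n"
      then consider "i < n" "j < n" | "i = n" "j < n" | "i < n" "j = n" | "i = n" "j = n" by linarith
      then show "l2_inner (e' i) (e' j) = (if i = j then 1 else 0)"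
      proof cases
        case 1
        then show ?thesis using e by (simp add: e'_def ON_def)
      next
        case 2
        then show ?thesis by (simp add: e'_def wl ye)
      next
        case 3
        then show ?thesis by (simp add: e'_def wr ey)
      next
        case 4
        then show ?thesis using t by (simp add: e'_def wl wr)
      qed
    qed
    then show False using n(2)[of "Suc n"] by auto
  qed
  have "cdim M = card {..<n}"
  proof (rule cdim_eq_card[of _ e])
    show "\<exists>c. x = (\<Sum>i<n. (\<lambda>v. c i * e i v))" if "x \<in> M" for x
      by (rule exI[of _ "\<lambda>i. l2_inner x (e i)"]) (rule expand[OF that])
  qed (use eM indep[OF e] in auto)
  then have "cdim M = n" by simp
  then show ?thesis using that[of e] eM e expand unfolding ON_def by blast
qed

text \<open>If the maps \<open>r j\<close> are idempotent, such a function is determined by its values at the points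
  with no coordinate \<open>j \<in> F\<close> fixed by \<open>r j\<close>, and these values are arbitrary.\<close>

definition fibre_zero :: "'d set \<Rightarrow> ('d \<Rightarrow> 'a set) \<Rightarrow> ('d \<Rightarrow> 'a \<Rightarrow> 'a) \<Rightarrow> (('d \<Rightarrow> 'a) \<Rightarrow> complex) set" where
  "fibre_zero F A r = {f. (\<forall>v. (\<exists>j. v j \<notin> A j) \<longrightarrow> f v = 0) \<and>
     (\<forall>j\<in>F. \<forall>x. (\<forall>i. x i \<in> A i) \<longrightarrow> (\<Sum>w | w \<in> A j \<and> r j w = r j (x j). f (x(j := w))) = 0)}"

lemma fibre_zero_sum:
  "\<lbrakk>f \<in> fibre_zero F A r; j \<in> F; \<forall>i. x i \<in> A i\<rbrakk> \<Longrightarrow> (\<Sum>w | w \<in> A j \<and> r j w = r j (x j). f (x(j := w))) = 0"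
  unfolding fibre_zero_def by blast

lemma fibre_zero_off: "f \<in> fibre_zero F A r \<Longrightarrow> v j \<notin> A j \<Longrightarrow> f v = 0"
  unfolding fibre_zero_def by blast

text \<open>Used twice: with a constant \<open>r j\<close> for one sibling class, where each
  coordinate is a single fibre, and with a representative of each sibling set for all classes of a
  given depth.\<close>

lemma cdim_fibre_zero:
  fixes A :: "'d::finite \<Rightarrow> 'a set"
  assumes A: "\<And>j. finite (A j)" and r: "\<And>j w. \<lbrakk>j \<in> F; w \<in> A j\<rbrakk> \<Longrightarrow> r j w \<in> A j \<and> r j (r j w) = r j w"
  shows "cdim (fibre_zero F A r) = (\<Prod>j\<in>UNIV. card (if j \<in> F then {w \<in> A j. r j w \<noteq> w} else A j))"
proof -
  define B where "B j = (if j \<in> F then {w \<in> A j. r j w \<noteq> w} else A j)" for j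
  define P where "P = PiE UNIV B"
  \<comment> \<open>For j in \<open>F\<close> the factor is the point mass at \<open>w\<close> minus
    the one at \<open>r j w\<close>; both points lie in the same fibre by idempotence, so every
    fibre sum is zero. The basis vectors are tensor products of these factors.\<close>
  define h where "h j w x = (if j \<in> F then (if x = w then 1 else 0) - (if x = r j w then 1 else 0)
    else if x = w then 1 else (0::complex))" for j w x
  define e where "e b = (\<lambda>v. \<Prod>j\<in>UNIV. h j (b j) (v j))" for b
  have finP: "finite P" unfolding P_def by (intro finite_PiE) (auto simp: B_def A)
  have PD: "b \<in> P \<longleftrightarrow> (\<forall>j. b j \<in> B j)" for b by (auto simp: P_def)
  have BA: "w \<in> A j" if "w \<in> B j" for j w using that by (auto simp: B_def split: if_splits)
  have eZ: "e b \<in> fibre_zero F A r" if b: "b \<in> P" for b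
    unfolding fibre_zero_def
  proof (intro CollectI conjI allI impI ballI)
    fix v assume "\<exists>j. v j \<notin> A j"
    then obtain j where j: "v j \<notin> A j" by blast
    have "b j \<in> A j" using b BA by (auto simp: PD)
    then have "h j (b j) (v j) = 0" using r[of j "b j"] j by (auto simp: h_def)
    then show "e b v = 0" unfolding e_def by (intro prod_zero) auto
  next
    fix j x assume j: "j \<in> F" and x: "\<forall>i. x i \<in> A i"
    let ?S = "{w. w \<in> A j \<and> r j w = r j (x j)}"
    have fS: "finite ?S" using A by simp
    have bA: "b j \<in> A j" using b BA by (auto simp: PD)
    have "(\<Sum>w\<in>?S. e b (x(j := w))) = (\<Sum>w\<in>?S. (\<Prod>i\<in>UNIV - {j}. h i (b i) (x i)) * h j (b j) w)"
    proof (rule sum.cong[OF refl])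
      fix w
      have "e b (x(j := w)) = h j (b j) w * (\<Prod>i\<in>UNIV - {j}. h i (b i) ((x(j := w)) i))"
        unfolding e_def by (subst prod.remove[of UNIV j]) auto
      also have "(\<Prod>i\<in>UNIV - {j}. h i (b i) ((x(j := w)) i)) = (\<Prod>i\<in>UNIV - {j}. h i (b i) (x i))"
        by (intro prod.cong) auto
      finally show "e b (x(j := w)) = (\<Prod>i\<in>UNIV - {j}. h i (b i) (x i)) * h j (b j) w" by (simp only: mult.commute)
    qed
    also have "\<dots> = (\<Prod>i\<in>UNIV - {j}. h i (b i) (x i)) * (\<Sum>w\<in>?S. h j (b j) w)"
      by (simp only: sum_distrib_left)
    also have "(\<Sum>w\<in>?S. h j (b j) w) = 0"
      using j fS bA r[OF j bA] by (auto simp: h_def sum_subtractf)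
    finally show "(\<Sum>w\<in>?S. e b (x(j := w))) = 0" by (simp del: fun_upd_apply)
  qed
  have eP: "e b b' = (if b = b' then 1 else 0)" if b: "b \<in> P" "b' \<in> P" for b b'
  proof -
    have "h j (b j) (b' j) = (if b j = b' j then 1 else 0)" for j
    proof (cases "j \<in> F")
      case True
      have "b j \<in> B j" "b' j \<in> B j" using b by (auto simp: PD)
      then have "b j \<in> A j" "r j (b' j) \<noteq> b' j" using True by (auto simp: B_def)
      then have "b' j \<noteq> r j (b j)" using r[OF True, of "b j"] by metis
      then show ?thesis using True by (auto simp: h_def)
    qed (auto simp: h_def)
    then have *: "e b b' = (\<Prod>j\<in>UNIV. if b j = b' j then 1 else 0)" by (simp add: e_def)
    show ?thesis
    proof (cases "b = b'")
      case False
      then obtain j where "b j \<noteq> b' j" by auto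
      then show ?thesis using False unfolding * by (auto intro!: prod_zero)
    next
      case True
      then show ?thesis unfolding * by simp
    qed
  qed
  \<comment> \<open>At a coordinate fixed by \<open>r j\<close> the value is minus the sum over the
    rest of the fibre. Every other point of the fibre is sent to \<open>v j\<close> and so is not
    fixed, which lowers the number of fixed coordinates by one.\<close>
  have zero: "f v = 0" if f: "f \<in> fibre_zero F A r" and fP: "\<And>b. b \<in> P \<Longrightarrow> f b = 0" for f v
  proof (induction "card {j \<in> F. r j (v j) = v j}" arbitrary: v rule: less_induct)
    case less
    show ?case
    proof (cases "\<forall>j. v j \<in> A j")
      case False
      then show ?thesis using f by (auto simp: fibre_zero_def)
    next
      case vA: True
      show ?thesis
      proof (cases "\<exists>j\<in>F. r j (v j) = v j")
        case False
        then have "v \<in> P" using vA by (auto simp: PD B_def)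
        then show ?thesis by (rule fP)
      next
        case True
        then obtain j where j: "j \<in> F" "r j (v j) = v j" by blast
        let ?S = "{w. w \<in> A j \<and> r j w = r j (v j)}"
        have "0 = (\<Sum>w\<in>?S. f (v(j := w)))" by (rule fibre_zero_sum[OF f j(1) vA, symmetric])
        also have "\<dots> = f (v(j := v j)) + (\<Sum>w\<in>?S - {v j}. f (v(j := w)))"
          by (rule sum.remove) (use A vA in auto)
        also have "(\<Sum>w\<in>?S - {v j}. f (v(j := w))) = 0"
        proof (rule sum.neutral, rule ballI)
          fix w assume w: "w \<in> ?S - {v j}"
          show "f (v(j := w)) = 0"
          proof (rule less.hyps)
            have "{i \<in> F. r i ((v(j := w)) i) = (v(j := w)) i} \<subset> {i \<in> F. r i (v i) = v i}"
              using w j by (auto split: if_splits)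
            then show "card {i \<in> F. r i ((v(j := w)) i) = (v(j := w)) i} < card {i \<in> F. r i (v i) = v i}"
              by (intro psubset_card_mono) auto
          qed
        qed
        finally show ?thesis by simp
      qed
    qed
  qed
  have "cdim (fibre_zero F A r) = card P"
  proof (rule cdim_eq_card[of P e])
    show "\<exists>c. x = (\<Sum>b\<in>P. (\<lambda>v. c b * e b v))" if x: "x \<in> fibre_zero F A r" for x
    \<comment> \<open>Restricted to \<open>P\<close> the vectors \<open>e b\<close> are point
      masses, so the coefficient of \<open>e b\<close> has to be the value of \<open>x\<close> at b.
      The defect of this expansion vanishes on \<open>P\<close> and hence everywhere.\<close>
    proof (intro exI[of _ x] ext)
      fix v
      let ?f = "\<lambda>v. x v - (\<Sum>b\<in>P. x b * e b v)"
      have "?f v = 0"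
      proof (rule zero)
        show "?f \<in> fibre_zero F A r"
          unfolding fibre_zero_def
        proof (intro CollectI conjI allI impI ballI)
          fix v assume "\<exists>j. v j \<notin> A j"
          then obtain j where "v j \<notin> A j" by blast
          then have "x v = 0" "\<And>b. b \<in> P \<Longrightarrow> e b v = 0"
            by (auto intro: fibre_zero_off[OF x] fibre_zero_off[OF eZ])
          then show "?f v = 0" by simp
        next
          fix j y assume j: "j \<in> F" and y: "\<forall>i. y i \<in> A i"
          let ?S = "{w. w \<in> A j \<and> r j w = r j (y j)}"
          have "(\<Sum>w\<in>?S. ?f (y(j := w))) = (\<Sum>w\<in>?S. x (y(j := w))) - (\<Sum>b\<in>P. x b * (\<Sum>w\<in>?S. e b (y(j := w))))"
            by (simp only: sum_subtractf sum_distrib_left sum.swap[of _ P])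
          also have "(\<Sum>w\<in>?S. x (y(j := w))) = 0" by (rule fibre_zero_sum[OF x j y])
          also have "(\<Sum>b\<in>P. x b * (\<Sum>w\<in>?S. e b (y(j := w)))) = 0"
            by (rule sum.neutral) (use fibre_zero_sum[OF eZ j y] in simp)
          finally show "(\<Sum>w\<in>?S. ?f (y(j := w))) = 0" by (simp only: diff_zero)
        qed
        show "?f b = 0" if "b \<in> P" for b
        proof -
          have "(\<Sum>b'\<in>P. x b' * e b' b) = (\<Sum>b'\<in>P. if b' = b then x b' else 0)"
            by (intro sum.cong refl) (simp add: eP that)
          then show ?thesis using finP that by simp
        qed
      qed
      then show "x v = (\<Sum>b\<in>P. (\<lambda>v. x b * e b v)) v" by (simp add: sum_fun_apply)
    qed
    show "c b = 0" if "(\<Sum>b\<in>P. (\<lambda>v. c b * e b v)) = 0" "b \<in> P" for c b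
    proof -
      have "0 = (\<Sum>b'\<in>P. c b' * e b' b)" using fun_cong[OF that(1), of b] by (simp add: sum_fun_apply)
      also have "\<dots> = (\<Sum>b'\<in>P. if b' = b then c b' else 0)"
        by (intro sum.cong refl) (simp add: eP that(2))
      finally show ?thesis using finP that(2) by simp
    qed
  qed (use finP eZ in auto)
  then show ?thesis by (simp add: P_def card_PiE B_def)
qed

section \<open>The joint kernel\<close>

locale tree_product = dtree_family T for T :: "'d::finite \<Rightarrow> 'a pair_pre_digraph" +
  fixes a :: real
  assumes a: "a \<ge> 1" and branching: "finite_joint_branching_index T"
begin

lemma pChi_eq: "v \<in> pV T \<Longrightarrow> pChi T j v = (\<lambda>c. v(j := c)) ` Chi (T j) (v j)"
proof (intro equalityI subsetI)
  fix w assume v: "v \<in> pV T" and "w \<in> pChi T j v"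
  then have "w = v(j := w j)" "w j \<in> Chi (T j) (v j)" by (auto simp: pChi_def fun_eq_iff)
  then show "w \<in> (\<lambda>c. v(j := c)) ` Chi (T j) (v j)" by blast
next
  fix w assume v: "v \<in> pV T" and "w \<in> (\<lambda>c. v(j := c)) ` Chi (T j) (v j)"
  then show "w \<in> pChi T j v" by (auto simp: pChi_def mem_pV Chi_def dest: arc_verts)
qed

lemma inj_upd: "inj_on (\<lambda>c. v(j := c)) C"
  by (rule inj_onI) (metis fun_upd_eqD)

lemma finite_pChi: "v \<in> pV T \<Longrightarrow> finite (pChi T j v)"
  by (simp add: pChi_eq finite_Chi mem_pV)

lemma card_pChi: "v \<in> pV T \<Longrightarrow> card (pChi T j v) = card (Chi (T j) (v j))"
  by (simp add: pChi_eq card_image[OF inj_upd])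

lemma sum_pChi: "v \<in> pV T \<Longrightarrow> (\<Sum>w\<in>pChi T j v. f w) = (\<Sum>c\<in>Chi (T j) (v j). f (v(j := c)))"
  by (simp add: pChi_eq sum.reindex[OF inj_upd])

definition parent :: "'d \<Rightarrow> ('d \<Rightarrow> 'a) \<Rightarrow> 'd \<Rightarrow> 'a" where
  "parent j w = w(j := par (T j) (w j))"

lemma parent_pChi: "w \<in> pChi T j v \<Longrightarrow> parent j w = v"
  by (auto simp: pChi_def parent_def fun_eq_iff Chi_def par_eq)

lemma pChi_parent: "\<lbrakk>w \<in> pV T; w j \<noteq> tree_root (T j)\<rbrakk> \<Longrightarrow> parent j w \<in> pV T \<and> w \<in> pChi T j (parent j w)"
  using par_arc[of "w j" j] arc_verts[of "par (T j) (w j)" "w j" j]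
  by (auto simp: parent_def pChi_def mem_pV Chi_def)

lemma pChi_pV: "w \<in> pChi T j v \<Longrightarrow> w \<in> pV T \<and> w j \<noteq> tree_root (T j)"
  using root_no_parent by (auto simp: pChi_def Chi_def)

text \<open>Indexed by the parent, whereas \<open>wt\<close> takes the child; equality of the
  weights of siblings thus becomes visible.\<close>

definition \<omega> :: "'d \<Rightarrow> ('d \<Rightarrow> 'a) \<Rightarrow> real" where
  "\<omega> j v = 1 / sqrt (real (card (pChi T j v))) * sqrt ((real (pdepth T v j) + 1) / (real (mlen (pdepth T v)) + a))"

lemma wt_eq: "w \<in> pChi T j v \<Longrightarrow> wt a T j w = \<omega> j v"
  using parent_pChi[of w j v] by (simp add: wt_def \<omega>_def parent_def Let_def)

lemma card_pChi_pos: "v \<in> pV T \<Longrightarrow> card (pChi T j v) > 0"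
  using card_Chi_pos by (simp add: card_pChi mem_pV)

lemma \<omega>_pos: "v \<in> pV T \<Longrightarrow> \<omega> j v > 0"
  unfolding \<omega>_def using card_pChi_pos[of v j] a
  by (intro mult_pos_pos divide_pos_pos) (auto intro!: divide_pos_pos add_nonneg_pos)

text \<open>The left side is the squared norm of the j-th shift applied to the basis vector at
  \<open>v\<close>. Images of distinct basis vectors have disjoint supports, so this is
  contractivity of the shift.\<close>

lemma \<omega>_sq: assumes "v \<in> pV T" shows "real (card (pChi T j v)) * (\<omega> j v)\<^sup>2 \<le> 1"
proof -
  have "pdepth T v j \<le> mlen (pdepth T v)" unfolding mlen_def by (rule member_le_sum) auto
  then have "(real (pdepth T v j) + 1) / (real (mlen (pdepth T v)) + a) \<le> 1"
    using a by (simp add: field_simps)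
  then show ?thesis using card_pChi_pos[OF assms, of j] a
    by (simp add: \<omega>_def power_mult_distrib power_divide)
qed

text \<open>Parents are unique, so a sum over vertices with a non-root coordinate j can be regrouped
  by families of siblings.\<close>

lemma bij_parent: "bij_betw snd (Sigma (pV T) (pChi T j)) {w \<in> pV T. w j \<noteq> tree_root (T j)}"
  by (rule bij_betw_byWitness[where f' = "\<lambda>w. (parent j w, w)"])
    (auto simp: parent_pChi pChi_parent dest: pChi_pV)

lemma mshift_pChi: assumes "v \<in> pV T" "w \<in> pChi T j v" shows "mshift a T j g w = g v * of_real (\<omega> j v)"
proof -
  have "{v. v \<in> pV T \<and> w \<in> pChi T j v} = {v}" using assms parent_pChi by blast
  then show ?thesis using wt_eq[OF assms(2)] by (simp add: mshift_def)
qed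

lemma mshift_zero: "\<not> (w \<in> pV T \<and> w j \<noteq> tree_root (T j)) \<Longrightarrow> mshift a T j g w = 0"
proof -
  assume "\<not> (w \<in> pV T \<and> w j \<noteq> tree_root (T j))"
  then have "{v. v \<in> pV T \<and> w \<in> pChi T j v} = {}" using pChi_pV by blast
  then show ?thesis unfolding mshift_def by (simp only: sum.empty)
qed

section \<open>The adjoint of the multishift\<close>

definition mshift_adj :: "'d \<Rightarrow> (('d \<Rightarrow> 'a) \<Rightarrow> complex) \<Rightarrow> ('d \<Rightarrow> 'a) \<Rightarrow> complex" where
  "mshift_adj j f v = (if v \<in> pV T then of_real (\<omega> j v) * (\<Sum>w\<in>pChi T j v. f w) else 0)"

lemma summable_Sigma_children:
  assumes f: "f \<in> l2 (pV T)" shows "(\<lambda>p. (cmod (f (snd p)))\<^sup>2) summable_on Sigma (pV T) (pChi T j)"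
  using summable_on_reindex_bij_betw[OF bij_parent[of j], of "\<lambda>w. (cmod (f w))\<^sup>2"] l2_sq_summable[OF f] by blast

lemma mshift_adj_l2: assumes f: "f \<in> l2 (pV T)" shows "mshift_adj j f \<in> l2 (pV T)"
proof (rule l2I)
  have "(\<lambda>v. \<Sum>\<^sub>\<infinity>w\<in>pChi T j v. (cmod (f w))\<^sup>2) summable_on pV T"
    using summable_on_Sigma_banach[of "\<lambda>v w. (cmod (f w))\<^sup>2" "pV T" "pChi T j"] summable_Sigma_children[OF f, of j]
    by (simp add: case_prod_unfold)
  then show "(\<lambda>v. (cmod (mshift_adj j f v))\<^sup>2) summable_on pV T"
  proof (rule summable_on_comparison_test)
    fix v assume v: "v \<in> pV T"
    let ?S = "pChi T j v"
    have "(cmod (\<Sum>w\<in>?S. f w))\<^sup>2 \<le> (\<Sum>w\<in>?S. 1 * cmod (f w))\<^sup>2" by (intro power_mono) (auto intro: norm_sum)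
    also have "\<dots> \<le> (\<Sum>w\<in>?S. 1\<^sup>2) * (\<Sum>w\<in>?S. (cmod (f w))\<^sup>2)" by (rule Cauchy_Schwarz_ineq_sum)
    finally have "(cmod (\<Sum>w\<in>?S. f w))\<^sup>2 \<le> real (card ?S) * (\<Sum>w\<in>?S. (cmod (f w))\<^sup>2)" by simp
    then have "(\<omega> j v)\<^sup>2 * (cmod (\<Sum>w\<in>?S. f w))\<^sup>2 \<le> (\<omega> j v)\<^sup>2 * (real (card ?S) * (\<Sum>w\<in>?S. (cmod (f w))\<^sup>2))"
      by (rule mult_left_mono) simp
    also have "\<dots> = (real (card ?S) * (\<omega> j v)\<^sup>2) * (\<Sum>w\<in>?S. (cmod (f w))\<^sup>2)" by (simp only: mult_ac)
    also have "\<dots> \<le> 1 * (\<Sum>w\<in>?S. (cmod (f w))\<^sup>2)" by (intro mult_right_mono \<omega>_sq v sum_nonneg) auto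
    finally show "(cmod (mshift_adj j f v))\<^sup>2 \<le> (\<Sum>\<^sub>\<infinity>w\<in>?S. (cmod (f w))\<^sup>2)"
      using v by (simp add: mshift_adj_def norm_mult power_mult_distrib finite_pChi)
  qed simp
qed (simp add: mshift_adj_def)

lemma mshift_adj:
  assumes f: "f \<in> l2 (pV T)" and g: "g \<in> l2 (pV T)"
  shows "l2_inner (mshift a T j g) f = l2_inner g (mshift_adj j f)"
proof -
  let ?S = "Sigma (pV T) (pChi T j)"
  let ?t = "\<lambda>p. g (fst p) * of_real (\<omega> j (fst p)) * cnj (f (snd p))"
  \<comment> \<open>Domination for the double sum: over the children of \<open>v\<close> this term
    adds up to at most the squared modulus of \<open>g v\<close>. Together with the summable squares
    of \<open>f\<close> it justifies regrouping the inner product by parents.\<close>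
  have s1: "(\<lambda>p. (cmod (g (fst p)))\<^sup>2 * (\<omega> j (fst p))\<^sup>2) summable_on ?S"
  proof (rule summable_on_SigmaI)
    fix v assume v: "v \<in> pV T"
    show "((\<lambda>w. (cmod (g (fst (v, w))))\<^sup>2 * (\<omega> j (fst (v, w)))\<^sup>2) has_sum
      (real (card (pChi T j v)) * ((cmod (g v))\<^sup>2 * (\<omega> j v)\<^sup>2))) (pChi T j v)"
      by (rule has_sum_finiteI[OF finite_pChi[OF v]]) simp
  next
    show "(\<lambda>v. real (card (pChi T j v)) * ((cmod (g v))\<^sup>2 * (\<omega> j v)\<^sup>2)) summable_on pV T"
    proof (rule summable_on_comparison_test[OF l2_sq_summable[OF g]])
      fix v assume v: "v \<in> pV T"
      show "real (card (pChi T j v)) * ((cmod (g v))\<^sup>2 * (\<omega> j v)\<^sup>2) \<le> (cmod (g v))\<^sup>2"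
        using mult_left_mono[OF \<omega>_sq[OF v, of j], of "(cmod (g v))\<^sup>2"] by (simp add: mult_ac)
    qed simp
  qed simp
  have "(\<lambda>p. norm (?t p)) summable_on ?S"
  proof (rule summable_on_comparison_test[OF summable_on_add[OF s1 summable_Sigma_children[OF f, of j]]])
    fix p
    let ?x = "cmod (g (fst p)) * \<bar>\<omega> j (fst p)\<bar>" and ?y = "cmod (f (snd p))"
    have "0 \<le> ?x * ?y" by simp
    then have "?x * ?y \<le> ?x\<^sup>2 + ?y\<^sup>2" using sum_squares_bound[of ?x ?y] by linarith
    then show "norm (?t p) \<le> (cmod (g (fst p)))\<^sup>2 * (\<omega> j (fst p))\<^sup>2 + (cmod (f (snd p)))\<^sup>2"
      by (simp add: norm_mult power_mult_distrib)
  qed simp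
  then have sum: "?t summable_on ?S" by (rule Infinite_Sum.abs_summable_summable)
  have "l2_inner (mshift a T j g) f = (\<Sum>\<^sub>\<infinity>w\<in>{w \<in> pV T. w j \<noteq> tree_root (T j)}. mshift a T j g w * cnj (f w))"
    unfolding l2_inner_def by (rule infsum_cong_neutral) (auto simp: mshift_zero)
  also have "\<dots> = (\<Sum>\<^sub>\<infinity>p\<in>?S. mshift a T j g (snd p) * cnj (f (snd p)))"
    by (rule infsum_reindex_bij_betw[OF bij_parent, symmetric])
  also have "\<dots> = (\<Sum>\<^sub>\<infinity>p\<in>?S. ?t p)" by (rule infsum_cong) (auto simp: mshift_pChi)
  also have "\<dots> = (\<Sum>\<^sub>\<infinity>v\<in>pV T. \<Sum>\<^sub>\<infinity>w\<in>pChi T j v. ?t (v, w))"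
    by (rule infsum_Sigma_banach[OF sum, symmetric])
  also have "\<dots> = (\<Sum>\<^sub>\<infinity>v\<in>pV T. g v * cnj (mshift_adj j f v))"
    by (rule infsum_cong) (simp add: finite_pChi mshift_adj_def sum_distrib_left mult.assoc)
  also have "\<dots> = l2_inner g (mshift_adj j f)"
    unfolding l2_inner_def by (rule infsum_cong_neutral) (auto simp: mshift_adj_def)
  finally show ?thesis .
qed

text \<open>Resolves the definite description: the candidate satisfies the adjoint equation, and
  pairing with point masses shows that nothing else does.\<close>

lemma l2_adjoint_mshift: assumes f: "f \<in> l2 (pV T)" shows "l2_adjoint (pV T) (mshift a T j) f = mshift_adj j f"
  unfolding l2_adjoint_def
proof (rule the_equality)
  show "mshift_adj j f \<in> l2 (pV T) \<and> (\<forall>g\<in>l2 (pV T). l2_inner (mshift a T j g) f = l2_inner g (mshift_adj j f))"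
    using mshift_adj_l2[OF f] mshift_adj[OF f] by blast
  fix h assume h: "h \<in> l2 (pV T) \<and> (\<forall>g\<in>l2 (pV T). l2_inner (mshift a T j g) f = l2_inner g h)"
  show "h = mshift_adj j f"
  proof
    fix v show "h v = mshift_adj j f v"
    proof (cases "v \<in> pV T")
      case True
      then have "l2_inner (unit_vec v) h = l2_inner (unit_vec v) (mshift_adj j f)"
        using h mshift_adj[OF f unit_vec_l2[OF True]] unit_vec_l2[OF True] by auto
      then have "cnj (l2_inner h (unit_vec v)) = cnj (l2_inner (mshift_adj j f) (unit_vec v))"
        unfolding l2_inner_commute[of "unit_vec v"] .
      then show ?thesis by (simp add: inner_unit_vec')
    qed (use h l2_off[of h "pV T" v] in \<open>simp add: mshift_adj_def\<close>)
  qed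
qed

text \<open>As the weights are constant on siblings, they drop out of the description of the joint kernel.\<close>

definition sibling_zero :: "(('d \<Rightarrow> 'a) \<Rightarrow> complex) set" where
  "sibling_zero = {f. (\<forall>v. v \<notin> pV T \<longrightarrow> f v = 0) \<and> (\<forall>j. \<forall>v\<in>pV T. (\<Sum>c\<in>Chi (T j) (v j). f (v(j := c))) = 0)}"

text \<open>A finite set carrying every function of the joint kernel; it makes the joint kernel
  finite dimensional and its inner products finite sums.\<close>

definition branch_support :: "('d \<Rightarrow> 'a) set" where
  "branch_support = {v \<in> pV T. \<forall>j. v j \<noteq> tree_root (T j) \<longrightarrow> par (T j) (v j) \<in> branching_vertices (T j)}"

lemma finite_branch_support: "finite branch_support"
proof -
  have "\<exists>B. \<forall>j. \<forall>u\<in>branching_vertices (T j). depth (T j) u \<le> B j"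
    using branching by (intro choice) (auto simp: finite_joint_branching_index_def bdd_above_def)
  then obtain B where B: "\<And>j u. u \<in> branching_vertices (T j) \<Longrightarrow> depth (T j) u \<le> B j" by blast
  \<comment> \<open>\<open>B j\<close> bounds the depth of branching vertices, which are the parents
    of the coordinates in question; hence the successor.\<close>
  have "branch_support \<subseteq> PiE UNIV (\<lambda>j. \<Union>n\<le>Suc (B j). gen j n)"
  proof
    fix v assume v: "v \<in> branch_support"
    have "depth (T j) (v j) \<le> Suc (B j)" for j
    proof (cases "v j = tree_root (T j)")
      case False
      then show ?thesis using v B[of "par (T j) (v j)" j] depth_child[OF par_arc[of "v j" j]]
        by (auto simp: branch_support_def mem_pV)
    qed (simp add: depth_root)
    then show "v \<in> PiE UNIV (\<lambda>j. \<Union>n\<le>Suc (B j). gen j n)"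
      using v by (auto simp: branch_support_def mem_pV generation_def)
  qed
  moreover have "finite (PiE UNIV (\<lambda>j. \<Union>n\<le>Suc (B j). gen j n))"
    by (intro finite_PiE) (auto simp: finite_generation)
  ultimately show ?thesis by (rule finite_subset)
qed

text \<open>An only child is alone in its sibling sum, so the value there is zero.\<close>

lemma sibling_zero_support: assumes f: "f \<in> sibling_zero" and v: "v \<notin> branch_support" shows "f v = 0"
proof (cases "v \<in> pV T")
  case True
  then obtain j where j: "v j \<noteq> tree_root (T j)" "par (T j) (v j) \<notin> branching_vertices (T j)"
    using v by (auto simp: branch_support_def)
  let ?p = "par (T j) (v j)"
  have arc: "(?p, v j) \<in> parcs (T j)" using par_arc j True by (simp add: mem_pV)
  then have C: "Chi (T j) ?p = {v j}" using j(2) arc_verts by (fastforce simp: branching_vertices_def Chi_def)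
  have "parent j v \<in> pV T" using pChi_parent[OF True j(1)] by simp
  then have "(\<Sum>c\<in>Chi (T j) (parent j v j). f ((parent j v)(j := c))) = 0" using f by (simp add: sibling_zero_def)
  then show ?thesis by (simp add: parent_def C)
qed (use f in \<open>simp add: sibling_zero_def\<close>)

lemma branch_support_pV: "branch_support \<subseteq> pV T" by (auto simp: branch_support_def)

lemma sibling_zero_l2: "f \<in> sibling_zero \<Longrightarrow> f \<in> l2 (pV T)"
  using l2_finite_support[OF finite_branch_support _ branch_support_pV] sibling_zero_support by blast

lemma joint_kernel_eq: "joint_kernel a T = sibling_zero"
proof (intro equalityI subsetI)
  fix f assume "f \<in> joint_kernel a T"
  then have f: "f \<in> l2 (pV T)" and 0: "mshift_adj j f = 0" for j
    by (auto simp: joint_kernel_def l2_adjoint_mshift)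
  have "(\<Sum>c\<in>Chi (T j) (v j). f (v(j := c))) = 0" if v: "v \<in> pV T" for j v
    using fun_cong[OF 0[of j], of v] v \<omega>_pos[OF v, of j] sum_pChi[OF v, of f j] by (simp add: mshift_adj_def)
  then show "f \<in> sibling_zero" using l2_off[OF f] by (simp add: sibling_zero_def)
next
  fix f assume f: "f \<in> sibling_zero"
  have "mshift_adj j f = 0" for j using f sum_pChi[of _ f j] by (auto simp: mshift_adj_def fun_eq_iff sibling_zero_def)
  then show "f \<in> joint_kernel a T" using sibling_zero_l2[OF f] by (simp add: joint_kernel_def l2_adjoint_mshift)
qed

end

section \<open>Diagonal form of the kernel and dimensions\<close>

context tree_product
begin

section \<open>The spaces \<open>Lsp\<close> and the kernel on the joint kernel\<close>

definition sibling_factor :: "'d set \<Rightarrow> ('d \<Rightarrow> 'a) \<Rightarrow> 'd \<Rightarrow> 'a set" where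
  "sibling_factor F u j = (if j \<in> F then sib (T j) (u j) else {u j})"

lemma Phi_pV: "u \<in> Phi T F \<Longrightarrow> u \<in> pV T" by (simp add: mem_Phi)

lemma sib_verts: "\<lbrakk>u \<in> Phi T F; j \<in> F; c \<in> sib (T j) (u j)\<rbrakk> \<Longrightarrow> c \<in> pverts (T j)"
  by (auto simp: sib_def Chi_def dest: arc_verts)

lemma sibF_Asib: "u \<in> Phi T F \<Longrightarrow> w \<in> sibF T F u \<longleftrightarrow> (\<forall>j. w j \<in> sibling_factor F u j)"
  unfolding sibF_def sibling_factor_def mem_pV mem_Collect_eq
  using sib_verts[of u F] Phi_pV[of u F] unfolding mem_pV by (metis empty_iff insert_iff)

lemma finite_Asib: "u \<in> Phi T F \<Longrightarrow> finite (sibling_factor F u j)"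
  using Phi_arc[of u F j] arc_verts finite_Chi by (auto simp: sibling_factor_def sib_def)

lemma finite_sibF: assumes u: "u \<in> Phi T F" shows "finite (sibF T F u)"
proof -
  have "sibF T F u = PiE UNIV (sibling_factor F u)" using sibF_Asib[OF u] by auto
  then show ?thesis using finite_Asib[OF u] by (simp add: finite_PiE)
qed

lemma weighted_sibling_sum:
  assumes u: "u \<in> Phi T F" and j: "j \<in> F" and v: "v \<in> sibF T F u"
  shows "(\<Sum>w\<in>psib T j (v(j := u j)). f w * complex_of_real (wt a T j w))
    = of_real (\<omega> j (v(j := par (T j) (u j)))) * (\<Sum>c\<in>sib (T j) (u j). f (v(j := c)))"
    and "v(j := par (T j) (u j)) \<in> pV T"
proof -
  let ?p = "v(j := par (T j) (u j))"
  show p: "?p \<in> pV T"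
    using v arc_verts[OF Phi_arc[OF u j]] by (auto simp: sibF_def mem_pV)
  have "psib T j (v(j := u j)) = pChi T j ?p" by (auto simp: psib_def pChi_def sib_def)
  then have "(\<Sum>w\<in>psib T j (v(j := u j)). f w * complex_of_real (wt a T j w))
    = (\<Sum>w\<in>pChi T j ?p. of_real (\<omega> j ?p) * f w)"
    by (simp add: wt_eq mult.commute)
  also have "\<dots> = of_real (\<omega> j ?p) * (\<Sum>w\<in>pChi T j ?p. f w)" by (simp only: sum_distrib_left)
  also have "(\<Sum>w\<in>pChi T j ?p. f w) = (\<Sum>c\<in>sib (T j) (u j). f (v(j := c)))"
    using sum_pChi[OF p, of f j] by (simp add: sib_def)
  finally show "(\<Sum>w\<in>psib T j (v(j := u j)). f w * complex_of_real (wt a T j w))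
    = of_real (\<omega> j ?p) * (\<Sum>c\<in>sib (T j) (u j). f (v(j := c)))" .
qed

text \<open>Outside \<open>F\<close> the coordinates are roots already, so \<open>vrestr\<close>
  alters at most coordinate j, which is overwritten at once.\<close>

lemma vrestr_upd:
  assumes u: "u \<in> Phi T F" and j: "j \<in> F" and v: "v \<in> sibF T F u"
  shows "(vrestr T (F - {j}) v)(j := u j) = v(j := u j)"
proof
  fix i
  have "v i = tree_root (T i)" if "i \<notin> F" using v u that by (auto simp: sibF_def Phi_def)
  then show "((vrestr T (F - {j}) v)(j := u j)) i = (v(j := u j)) i"
    by (auto simp: vrestr_def proot_def)
qed

text \<open>Positive weights that are constant on siblings can be cancelled from the defining
  equations. The constant map to \<open>u j\<close> declares all siblings in coordinate j to be one
  fibre, whence the trivial condition \<open>u j = u j\<close> in the fibre sums.\<close>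

lemma Lsp_eq:
  assumes u: "u \<in> Phi T F" shows "Lsp a T u F = fibre_zero F (sibling_factor F u) (\<lambda>j _. u j)"
proof -
  have l2: "f \<in> l2 (sibF T F u) \<longleftrightarrow> (\<forall>v. (\<exists>j. v j \<notin> sibling_factor F u j) \<longrightarrow> f v = 0)" for f :: "('d \<Rightarrow> 'a) \<Rightarrow> complex"
    using l2_off[of f "sibF T F u"] l2_finite_support[OF finite_sibF[OF u], of f "sibF T F u"] sibF_Asib[OF u]
    by (metis order_refl)
  have "(\<forall>x\<in>sibFG T F (F - {j}) u. (\<Sum>w\<in>psib T j (x(j := u j)). f w * complex_of_real (wt a T j w)) = 0)
    \<longleftrightarrow> (\<forall>x. (\<forall>i. x i \<in> sibling_factor F u i) \<longrightarrow> (\<Sum>w | w \<in> sibling_factor F u j \<and> u j = u j. f (x(j := w))) = 0)"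
    if j: "j \<in> F" for j and f :: "('d \<Rightarrow> 'a) \<Rightarrow> complex"
  proof -
    have "(\<Sum>w\<in>psib T j ((vrestr T (F - {j}) v)(j := u j)). f w * complex_of_real (wt a T j w)) = 0
      \<longleftrightarrow> (\<Sum>w | w \<in> sibling_factor F u j \<and> u j = u j. f (v(j := w))) = 0" if v: "v \<in> sibF T F u" for v
    proof -
      have "\<omega> j (v(j := par (T j) (u j))) \<noteq> 0"
        using \<omega>_pos[OF weighted_sibling_sum(2)[OF u j v], of j] by simp
      then show ?thesis
        unfolding vrestr_upd[OF u j v] weighted_sibling_sum(1)[OF u j v] using j by (simp add: sibling_factor_def)
    qed
    then have "(\<forall>x\<in>sibFG T F (F - {j}) u. (\<Sum>w\<in>psib T j (x(j := u j)). f w * complex_of_real (wt a T j w)) = 0)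
      \<longleftrightarrow> (\<forall>v\<in>sibF T F u. (\<Sum>w | w \<in> sibling_factor F u j \<and> u j = u j. f (v(j := w))) = 0)"
      unfolding sibFG_def ball_simps by blast
    then show ?thesis unfolding Ball_def sibF_Asib[OF u] .
  qed
  then show ?thesis unfolding Lsp_def fibre_zero_def l2 by (intro Collect_cong conj_cong ball_cong refl) blast
qed

text \<open>For j in \<open>F\<close> a class contains, with each of its vertices, all siblings of
  that vertex in direction j; cutting off outside the class therefore leaves these sibling sums
  complete.\<close>

lemma restrict_sibF:
  assumes u: "u \<in> Phi T F" and x: "x \<in> sibling_zero"
  shows "(\<lambda>v. if v \<in> sibF T F u then x v else 0) \<in> Lsp a T u F"
  unfolding Lsp_eq[OF u] fibre_zero_def
proof (intro CollectI conjI allI impI ballI)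
  fix v assume "\<exists>j. v j \<notin> sibling_factor F u j"
  then show "(if v \<in> sibF T F u then x v else 0) = 0" using sibF_Asib[OF u, of v] by auto
next
  fix j y assume j: "j \<in> F" and y: "\<forall>i. y i \<in> sibling_factor F u i"
  let ?p = "y(j := par (T j) (u j))"
  have yF: "y \<in> sibF T F u" using y sibF_Asib[OF u] by blast
  have A: "{w. w \<in> sibling_factor F u j \<and> u j = u j} = Chi (T j) (?p j)" using j by (simp add: sibling_factor_def sib_def)
  have in_sibF: "y(j := w) \<in> sibF T F u" if "w \<in> Chi (T j) (?p j)" for w
    using y that A sibF_Asib[OF u, of "y(j := w)"] by auto
  have "(\<Sum>w\<in>Chi (T j) (?p j). if y(j := w) \<in> sibF T F u then x (y(j := w)) else 0)
    = (\<Sum>w\<in>Chi (T j) (?p j). x (?p(j := w)))"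
    by (intro sum.cong refl) (simp only: in_sibF if_True fun_upd_upd)
  also have "\<dots> = 0" using x weighted_sibling_sum(2)[OF u j yF] unfolding sibling_zero_def by blast
  finally show "(\<Sum>w | w \<in> sibling_factor F u j \<and> u j = u j. if y(j := w) \<in> sibF T F u then x (y(j := w)) else 0) = 0"
    unfolding A .
qed

lemma fibre_zero_diff:
  assumes "f \<in> fibre_zero F A \<rho>" "g \<in> fibre_zero F A \<rho>" shows "f - g \<in> fibre_zero F A \<rho>"
  using assms unfolding fibre_zero_def by (auto simp: sum_subtractf)

text \<open>Within the joint kernel the projection is mere truncation: the truncated function
  already lies in \<open>Lsp\<close>, and the remainder vanishes on the whole class.\<close>

lemma l2_proj_Lsp:
  assumes u: "u \<in> Phi T F" and x: "x \<in> sibling_zero"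
  shows "l2_proj (Lsp a T u F) x = (\<lambda>v. if v \<in> sibF T F u then x v else 0)" (is "_ = ?y")
  unfolding l2_proj_def
proof (rule the_equality)
  have L2: "f \<in> l2 (sibF T F u)" if "f \<in> Lsp a T u F" for f using that by (simp add: Lsp_def)
  have orth: "l2_inner (x - ?y) g = 0" if "g \<in> Lsp a T u F" for g
    using l2_off[OF L2[OF that]] by (subst l2_inner_finite[of "{}"]) auto
  then show "?y \<in> Lsp a T u F \<and> (\<forall>g\<in>Lsp a T u F. l2_inner (x - ?y) g = 0)"
    using restrict_sibF[OF u x] by blast
  fix y assume y: "y \<in> Lsp a T u F \<and> (\<forall>g\<in>Lsp a T u F. l2_inner (x - y) g = 0)"
  have d: "?y - y \<in> Lsp a T u F"
    using y restrict_sibF[OF u x] unfolding Lsp_eq[OF u] by (blast intro: fibre_zero_diff)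
  have xl: "x \<in> l2 (pV T)" by (rule sibling_zero_l2[OF x])
  have sub: "f \<in> l2 (pV T)" if "f \<in> Lsp a T u F" for f
    using L2[OF that] l2_finite_support[OF finite_sibF[OF u], of f "pV T"] l2_off[of f "sibF T F u"]
    by (auto simp: sibF_def)
  have "l2_inner ((x - y) - (x - ?y)) (?y - y) = l2_inner (x - y) (?y - y) - l2_inner (x - ?y) (?y - y)"
    by (rule l2_inner_diff[of _ "pV T" _ _ "pV T"])
      (use xl y sub restrict_sibF[OF u x] d in \<open>auto intro: l2_diff simp del: minus_apply\<close>)
  also have "\<dots> = 0" using y orth d by simp
  also have "(x - y) - (x - ?y) = ?y - y" by (simp only: diff_diff_eq2 diff_add_cancel) simp
  finally have "?y - y = 0" using l2_inner_definite[OF L2[OF d]] by blast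
  then show "y = ?y" by (simp only: right_minus_eq)
qed

text \<open>Sibling classes partition the vertices, so at each vertex at most one term of the double
  sum is nonzero. Depth is constant on a class, hence the representative can be replaced by the
  vertex itself.\<close>

lemma da_kernel_eq:
  assumes \<Omega>: "transversal T \<Omega>" and x: "x \<in> sibling_zero"
  shows "da_kernel a T \<Omega> z w x = (\<lambda>v. kcoeff a (pdepth T v) z w * x v)"
proof
  fix v
  have \<Omega>Phi: "u \<in> Phi T F" if "u \<in> \<Omega> F" for u F using \<Omega> that by (auto simp: transversal_def)
  have da: "da_kernel a T \<Omega> z w x v
    = (\<Sum>F\<in>UNIV. \<Sum>\<^sub>\<infinity>u\<in>\<Omega> F. if v \<in> sibF T F u then kcoeff a (pdepth T u) z w * x v else 0)"
    unfolding da_kernel_def by (intro sum.cong infsum_cong refl) (simp add: l2_proj_Lsp[OF \<Omega>Phi x])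
  show "da_kernel a T \<Omega> z w x v = kcoeff a (pdepth T v) z w * x v"
  proof (cases "v \<in> pV T")
    case False
    then have "x v = 0" using x by (simp add: sibling_zero_def)
    then show ?thesis unfolding da by (simp cong: if_cong)
  next
    case True
    define F0 where "F0 = {j. pdepth T v j \<noteq> 0}"
    have v: "v \<in> Phi T F0" using mem_Phi_depth[OF True] by (simp add: F0_def)
    obtain u0 where u0: "u0 \<in> \<Omega> F0" "u0 \<in> sibF T F0 v" and unique: "\<And>u. \<lbrakk>u \<in> \<Omega> F0; u \<in> sibF T F0 v\<rbrakk> \<Longrightarrow> u = u0"
      using \<Omega> v unfolding transversal_def by blast
    have iff: "v \<in> sibF T F u \<longleftrightarrow> F = F0 \<and> u = u0" if u: "u \<in> \<Omega> F" for u F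
    proof
      assume vs: "v \<in> sibF T F u"
      then have "v \<in> Phi T F" using mem_sibF[OF \<Omega>Phi[OF u]] by blast
      then have F: "F = F0" using mem_Phi_depth[OF True] by (simp add: F0_def)
      have "u \<in> sibF T F0 v" using vs mem_sibF[OF \<Omega>Phi[OF u]] mem_sibF[OF v] \<Omega>Phi[OF u] unfolding F by metis
      then show "F = F0 \<and> u = u0" using unique u F by blast
    next
      assume "F = F0 \<and> u = u0"
      then show "v \<in> sibF T F u" using u0 v mem_sibF[OF v] mem_sibF[OF \<Omega>Phi[OF u0(1)]] by metis
    qed
    have "(\<Sum>\<^sub>\<infinity>u\<in>\<Omega> F. if v \<in> sibF T F u then kcoeff a (pdepth T u) z w * x v else 0)
      = (if F = F0 then kcoeff a (pdepth T v) z w * x v else 0)" for F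
    proof (cases "F = F0")
      case True
      have "(\<Sum>\<^sub>\<infinity>u\<in>\<Omega> F. if v \<in> sibF T F u then kcoeff a (pdepth T u) z w * x v else 0)
        = (\<Sum>\<^sub>\<infinity>u\<in>{u0}. kcoeff a (pdepth T u) z w * x v)"
        by (rule infsum_cong_neutral) (use iff u0 True in auto)
      also have "\<dots> = kcoeff a (pdepth T v) z w * x v" using sibF_pdepth[OF v u0(2)] by simp
      finally show ?thesis using True by simp
    next
      case False
      have "(\<Sum>\<^sub>\<infinity>u\<in>\<Omega> F. if v \<in> sibF T F u then kcoeff a (pdepth T u) z w * x v else 0) = 0"
        by (rule infsum_0) (use iff False in auto)
      then show ?thesis using False by simp
    qed
    then show ?thesis unfolding da by simp
  qed
qed

section \<open>Splitting of the joint kernel by depth\<close>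

definition sibling_zero_at :: "('d \<Rightarrow> nat) \<Rightarrow> (('d \<Rightarrow> 'a) \<Rightarrow> complex) set" where
  "sibling_zero_at \<delta> = {f \<in> sibling_zero. \<forall>v. pdepth T v \<noteq> \<delta> \<longrightarrow> f v = 0}"

text \<open>Chosen through the parent, so that siblings share it. This encodes the partition of a
  generation into sibling sets as an idempotent map, as \<open>fibre_zero\<close> expects.\<close>

definition rep :: "'d \<Rightarrow> 'a \<Rightarrow> 'a" where
  "rep j w = (SOME c. c \<in> Chi (T j) (par (T j) w))"

lemma rep_arc: "(p, w) \<in> parcs (T j) \<Longrightarrow> (p, rep j w) \<in> parcs (T j)"
  using someI_ex[of "\<lambda>c. c \<in> Chi (T j) p"] leafless[of p j] arc_verts[of p w j] par_eq[of p w j]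
  by (auto simp: rep_def Chi_def)

lemma rep_eq_iff:
  assumes "(p, w) \<in> parcs (T j)" "(q, x) \<in> parcs (T j)" shows "rep j w = rep j x \<longleftrightarrow> p = q"
proof
  assume "rep j w = rep j x"
  then show "p = q" using rep_arc[OF assms(1)] rep_arc[OF assms(2)] parent_unique by metis
qed (use par_eq[OF assms(1)] par_eq[OF assms(2)] in \<open>simp add: rep_def\<close>)

lemma generation_arc:
  assumes "w \<in> gen j n" "n \<noteq> 0" shows "(par (T j) w, w) \<in> parcs (T j)"
  using assms depth_root[of j] by (intro par_arc) (auto simp: generation_def)

lemma rep_fibre:
  assumes "x \<in> gen j n" "n \<noteq> 0"
  shows "{w. w \<in> gen j n \<and> rep j w = rep j x} = Chi (T j) (par (T j) x)"
proof (intro equalityI subsetI)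
  fix w assume "w \<in> {w. w \<in> gen j n \<and> rep j w = rep j x}"
  then show "w \<in> Chi (T j) (par (T j) x)"
    using generation_arc[of w n j] generation_arc[OF assms] rep_eq_iff assms(2) by (auto simp: Chi_def)
next
  fix w assume w: "w \<in> Chi (T j) (par (T j) x)"
  then have arc: "(par (T j) x, w) \<in> parcs (T j)" by (simp add: Chi_def)
  have "w \<in> gen j n"
    using depth_child[OF arc] depth_child[OF generation_arc[OF assms]] arc_verts[OF arc] assms(1)
    by (simp add: generation_def)
  then show "w \<in> {w. w \<in> gen j n \<and> rep j w = rep j x}"
    using rep_eq_iff[OF arc generation_arc[OF assms]] by simp
qed

lemma pdepth_eq_iff: "v \<in> pV T \<Longrightarrow> pdepth T v = \<delta> \<longleftrightarrow> (\<forall>j. v j \<in> gen j (\<delta> j))"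
  by (auto simp: pdepth_def generation_def mem_pV fun_eq_iff)

lemma sibling_zero_at_eq: "sibling_zero_at \<delta> = fibre_zero {j. \<delta> j \<noteq> 0} (\<lambda>j. gen j (\<delta> j)) rep"
proof (intro equalityI subsetI)
  fix f assume f: "f \<in> sibling_zero_at \<delta>"
  show "f \<in> fibre_zero {j. \<delta> j \<noteq> 0} (\<lambda>j. gen j (\<delta> j)) rep"
    unfolding fibre_zero_def
  proof (intro CollectI conjI allI impI ballI)
    fix v assume "\<exists>j. v j \<notin> gen j (\<delta> j)"
    then show "f v = 0" using f pdepth_eq_iff[of v \<delta>] by (auto simp: sibling_zero_at_def sibling_zero_def)
  next
    fix j x assume j: "j \<in> {j. \<delta> j \<noteq> 0}" and x: "\<forall>i. x i \<in> gen i (\<delta> i)"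
    let ?p = "x(j := par (T j) (x j))"
    have p: "?p \<in> pV T"
      using x j arc_verts[OF generation_arc[of "x j" "\<delta> j" j]] by (auto simp: mem_pV generation_def)
    have "(\<Sum>c\<in>Chi (T j) (?p j). f (?p(j := c))) = 0" using f p unfolding sibling_zero_at_def sibling_zero_def by blast
    then show "(\<Sum>w | w \<in> gen j (\<delta> j) \<and> rep j w = rep j (x j). f (x(j := w))) = 0"
      using rep_fibre[of "x j" "\<delta> j" j] x j by simp
  qed
next
  fix f assume f: "f \<in> fibre_zero {j. \<delta> j \<noteq> 0} (\<lambda>j. gen j (\<delta> j)) rep"
  have off: "f v = 0" if "\<not> (v \<in> pV T \<and> pdepth T v = \<delta>)" for v
  proof -
    have "\<exists>j. v j \<notin> gen j (\<delta> j)"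
      using that pdepth_eq_iff[of v \<delta>] by (auto simp: mem_pV generation_def)
    then show ?thesis using fibre_zero_off[OF f] by blast
  qed
  \<comment> \<open>If some term is nonzero, that child has depth \<delta>, hence so do all its
    siblings, and the sum is one of the given fibre sums; otherwise the sum is trivially
    zero.\<close>
  have "(\<Sum>c\<in>Chi (T j) (v j). f (v(j := c))) = 0" if v: "v \<in> pV T" for j v
  proof (cases "\<exists>c\<in>Chi (T j) (v j). f (v(j := c)) \<noteq> 0")
    case False
    then show ?thesis by (simp add: sum.neutral)
  next
    case True
    then obtain c where c: "c \<in> Chi (T j) (v j)" "f (v(j := c)) \<noteq> 0" by blast
    let ?x = "v(j := c)"
    have x: "?x \<in> pV T" "pdepth T ?x = \<delta>" using off[of ?x] c(2) by blast+
    have arc: "(v j, c) \<in> parcs (T j)" using c(1) by (simp add: Chi_def)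
    have d: "\<delta> j \<noteq> 0" using depth_child[OF arc] x(2) by (auto simp: pdepth_def)
    have gen: "\<forall>i. ?x i \<in> gen i (\<delta> i)" using pdepth_eq_iff[OF x(1)] x(2) by blast
    have "{w. w \<in> gen j (\<delta> j) \<and> rep j w = rep j (?x j)} = Chi (T j) (v j)"
      using rep_fibre[OF gen[rule_format, of j] d] par_eq[OF arc] by simp
    moreover have "j \<in> {j. \<delta> j \<noteq> 0}" using d by simp
    ultimately show ?thesis using fibre_zero_sum[where x = ?x and j = j, OF f _ gen] by (simp only: fun_upd_upd)
  qed
  then show "f \<in> sibling_zero_at \<delta>" using off by (auto simp: sibling_zero_at_def sibling_zero_def)
qed

text \<open>Each vertex of the previous generation has exactly one representative among its
  children.\<close>

lemma card_non_representatives: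
  assumes "n \<noteq> 0"
  shows "card {w \<in> gen j n. rep j w \<noteq> w} = card (gen j n) - card (gen j (n - 1))"
proof -
  have "bij_betw (par (T j)) {w \<in> gen j n. rep j w = w} (gen j (n - 1))"
  proof (rule bij_betw_imageI)
    show "inj_on (par (T j)) {w \<in> gen j n. rep j w = w}"
    proof (rule inj_onI)
      fix w x assume "w \<in> {w \<in> gen j n. rep j w = w}" "x \<in> {w \<in> gen j n. rep j w = w}"
        and "par (T j) w = par (T j) x"
      moreover from this have "rep j w = rep j x" unfolding rep_def by simp
      ultimately show "w = x" by simp
    qed
    show "par (T j) ` {w \<in> gen j n. rep j w = w} = gen j (n - 1)"
    proof (intro equalityI subsetI)
      fix p assume "p \<in> par (T j) ` {w \<in> gen j n. rep j w = w}"
      then obtain w where w: "w \<in> gen j n" "p = par (T j) w" by auto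
      show "p \<in> gen j (n - 1)"
        using depth_child[OF generation_arc[OF w(1) assms]] arc_verts[OF generation_arc[OF w(1) assms]] w
        by (auto simp: generation_def)
    next
      fix p assume p: "p \<in> gen j (n - 1)"
      then have "p \<in> pverts (T j)" by (simp add: generation_def)
      then obtain c where c: "(p, c) \<in> parcs (T j)" using leafless[of p j] by (auto simp: Chi_def)
      have rc: "(p, rep j c) \<in> parcs (T j)" by (rule rep_arc[OF c])
      have "rep j (rep j c) = rep j c" using rep_eq_iff[OF rc c] by simp
      moreover have "rep j c \<in> gen j n"
        using depth_child[OF rc] arc_verts[OF rc] p assms by (simp add: generation_def)
      ultimately show "p \<in> par (T j) ` {w \<in> gen j n. rep j w = w}"
        using par_eq[OF rc] by (intro image_eqI[of _ _ "rep j c"]) auto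
    qed
  qed
  then have "card {w \<in> gen j n. rep j w = w} = card (gen j (n - 1))"
    by (rule bij_betw_same_card)
  moreover have "{w \<in> gen j n. rep j w \<noteq> w} = gen j n - {w \<in> gen j n. rep j w = w}"
    by auto
  ultimately show ?thesis using finite_generation by (simp add: card_Diff_subset)
qed

text \<open>The multiplicity of the degree \<delta>. A coordinate with \<open>\<delta> j = 0\<close>
  is left out: its generation is the root alone and contributes a factor 1.\<close>

definition growth :: "('d \<Rightarrow> nat) \<Rightarrow> nat" where
  "growth \<delta> = (\<Prod>j | \<delta> j \<noteq> 0. card (gen j (\<delta> j)) - card (gen j (\<delta> j - 1)))"

lemma cdim_sibling_zero_at: "cdim (sibling_zero_at \<delta>) = growth \<delta>"
proof -
  have "cdim (sibling_zero_at \<delta>) = (\<Prod>j\<in>UNIV. card (if j \<in> {j. \<delta> j \<noteq> 0}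
      then {w \<in> gen j (\<delta> j). rep j w \<noteq> w} else gen j (\<delta> j)))"
    unfolding sibling_zero_at_eq
  proof (rule cdim_fibre_zero[OF finite_generation])
    fix j w assume j: "j \<in> {j. \<delta> j \<noteq> 0}" and w: "w \<in> gen j (\<delta> j)"
    have arc: "(par (T j) w, w) \<in> parcs (T j)" using generation_arc[OF w] j by simp
    have "rep j (rep j w) = rep j w" using rep_eq_iff[OF rep_arc[OF arc] arc] by simp
    moreover have "rep j w \<in> gen j (\<delta> j)"
      using rep_fibre[OF w] rep_arc[OF arc] j by (auto simp: Chi_def)
    ultimately show "rep j w \<in> gen j (\<delta> j) \<and> rep j (rep j w) = rep j w" by simp
  qed
  also have "\<dots> = (\<Prod>j\<in>UNIV. if \<delta> j \<noteq> 0
      then card (gen j (\<delta> j)) - card (gen j (\<delta> j - 1)) else 1)"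
    by (intro prod.cong refl) (auto simp: card_non_representatives generation_0)
  also have "\<dots> = growth \<delta>"
    unfolding growth_def by (simp only: prod.inter_filter[OF finite, symmetric]) simp
  finally show ?thesis .
qed

lemma cdim_Lsp: assumes u: "u \<in> Phi T F" shows "cdim (Lsp a T u F) = (\<Prod>j\<in>F. card (sib (T j) (u j)) - 1)"
proof -
  have mem: "u j \<in> sib (T j) (u j)" if "j \<in> F" for j using u that by (intro mem_sib) (auto simp: mem_Phi mem_pV)
  have "cdim (Lsp a T u F) = (\<Prod>j\<in>UNIV. card (if j \<in> F then {w \<in> sibling_factor F u j. u j \<noteq> w} else sibling_factor F u j))"
    unfolding Lsp_eq[OF u]
    by (rule cdim_fibre_zero[OF finite_Asib[OF u]]) (use mem in \<open>simp add: sibling_factor_def\<close>)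
  also have "\<dots> = (\<Prod>j\<in>UNIV. if j \<in> F then card (sib (T j) (u j)) - 1 else 1)"
  proof (intro prod.cong refl)
    fix j
    have "{w \<in> sibling_factor F u j. u j \<noteq> w} = sib (T j) (u j) - {u j}" if "j \<in> F" using that by (auto simp: sibling_factor_def)
    then show "card (if j \<in> F then {w \<in> sibling_factor F u j. u j \<noteq> w} else sibling_factor F u j)
      = (if j \<in> F then card (sib (T j) (u j)) - 1 else 1)"
      using mem[of j] by (auto simp: sibling_factor_def)
  qed
  also have "\<dots> = (\<Prod>j | j \<in> F. card (sib (T j) (u j)) - 1)" by (simp only: prod.inter_filter[OF finite, symmetric]) simp
  finally show ?thesis by simp
qed

text \<open>Reduces (ii) to equality of growth functions: for each \<alpha> only its own support can
  give a nonzero sum.\<close>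

lemma sum_cdim_Lsp:
  assumes \<Omega>: "transversal T \<Omega>"
  shows "(\<Sum>u | u \<in> \<Omega> F \<and> pdepth T u = \<alpha>. cdim (Lsp a T u F)) = (if F = {j. \<alpha> j \<noteq> 0} then growth \<alpha> else 0)"
proof -
  have "(\<Sum>u | u \<in> \<Omega> F \<and> pdepth T u = \<alpha>. cdim (Lsp a T u F))
    = (\<Sum>u | u \<in> \<Omega> F \<and> pdepth T u = \<alpha>. \<Prod>j\<in>F. card (sib (T j) (u j)) - 1)"
  proof (rule sum.cong[OF refl])
    fix u assume "u \<in> {u. u \<in> \<Omega> F \<and> pdepth T u = \<alpha>}"
    then have "u \<in> Phi T F" using \<Omega> by (auto simp: transversal_def)
    then show "cdim (Lsp a T u F) = (\<Prod>j\<in>F. card (sib (T j) (u j)) - 1)" by (rule cdim_Lsp)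
  qed
  then show ?thesis unfolding sum_transversal[OF \<Omega>] growth_def by simp
qed

lemma sibling_zero_add: "\<lbrakk>x \<in> sibling_zero; y \<in> sibling_zero\<rbrakk> \<Longrightarrow> x + y \<in> sibling_zero"
  by (simp add: sibling_zero_def sum.distrib)

lemma sibling_zero_scale: "x \<in> sibling_zero \<Longrightarrow> (\<lambda>v. c * x v) \<in> sibling_zero"
  by (simp add: sibling_zero_def flip: sum_distrib_left)

lemma pdepth_upd: "c \<in> Chi (T j) (v j) \<Longrightarrow> pdepth T (v(j := c)) = (pdepth T v)(j := Suc (pdepth T v j))"
  by (auto simp: pdepth_def fun_eq_iff Chi_def depth_child)

text \<open>All children of a vertex in direction j have the same depth, so truncation to one depth
  either keeps a sibling sum entirely or removes it.\<close>

lemma restrict_pdepth: assumes x: "x \<in> sibling_zero" shows "(\<lambda>v. if pdepth T v = \<delta> then x v else 0) \<in> sibling_zero_at \<delta>"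
proof -
  have "(\<Sum>c\<in>Chi (T j) (v j). if pdepth T (v(j := c)) = \<delta> then x (v(j := c)) else 0) = 0" if v: "v \<in> pV T" for j v
  proof -
    have "(\<Sum>c\<in>Chi (T j) (v j). if pdepth T (v(j := c)) = \<delta> then x (v(j := c)) else 0)
      = (\<Sum>c\<in>Chi (T j) (v j). if (pdepth T v)(j := Suc (pdepth T v j)) = \<delta> then x (v(j := c)) else 0)"
      by (intro sum.cong refl) (simp only: pdepth_upd)
    also have "\<dots> = 0"
    proof (cases "(pdepth T v)(j := Suc (pdepth T v j)) = \<delta>")
      case True
      have "(\<Sum>c\<in>Chi (T j) (v j). x (v(j := c))) = 0" using x v unfolding sibling_zero_def by blast
      then show ?thesis using True by simp
    next
      case False
      then show ?thesis by (simp only: if_False sum.neutral_const)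
    qed
    finally show ?thesis .
  qed
  then show ?thesis using x by (simp add: sibling_zero_at_def sibling_zero_def)
qed

text \<open>Joins orthonormal bases of the parts at the various depths, which have disjoint
  supports. The labels record only degree and position, so that they do not depend on the tree
  beyond the multiplicities.\<close>

lemma diagonal_kernel_exists:
  assumes \<Omega>: "transversal T \<Omega>"
  obtains b where "diagonal_kernel a {(\<delta>, k). k < cdim (sibling_zero_at \<delta>)} fst b (joint_kernel a T) (pV T) (da_kernel a T \<Omega>)"
proof -
  let ?m = "\<lambda>\<delta>. cdim (sibling_zero_at \<delta>)"
  have "\<forall>\<delta>. \<exists>e. (\<forall>i<?m \<delta>. e i \<in> sibling_zero_at \<delta>)
      \<and> (\<forall>i<?m \<delta>. \<forall>j<?m \<delta>. l2_inner (e i) (e j) = (if i = j then 1 else 0))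
      \<and> (\<forall>x\<in>sibling_zero_at \<delta>. x = (\<Sum>i<?m \<delta>. (\<lambda>v. l2_inner x (e i) * e i v)))" (is "\<forall>\<delta>. ?P \<delta>")
  proof
    fix \<delta>
    show "?P \<delta>"
    proof (rule orthonormal_basis_exists[of branch_support "sibling_zero_at \<delta>"])
      show "x v = 0" if "x \<in> sibling_zero_at \<delta>" "v \<notin> branch_support" for x v
        using that sibling_zero_support by (simp add: sibling_zero_at_def)
      show "0 \<in> sibling_zero_at \<delta>" by (simp add: sibling_zero_at_def sibling_zero_def)
      show "x + y \<in> sibling_zero_at \<delta>" if "x \<in> sibling_zero_at \<delta>" "y \<in> sibling_zero_at \<delta>" for x y
        using that sibling_zero_add by (simp add: sibling_zero_at_def)
      show "(\<lambda>v. c * x v) \<in> sibling_zero_at \<delta>" if "x \<in> sibling_zero_at \<delta>" for c x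
        using that sibling_zero_scale by (simp add: sibling_zero_at_def)
    qed (use finite_branch_support in blast)+
  qed
  from choice[OF this] obtain e where e: "\<And>\<delta> i. i < ?m \<delta> \<Longrightarrow> e \<delta> i \<in> sibling_zero_at \<delta>"
    and on: "\<And>\<delta> i j. \<lbrakk>i < ?m \<delta>; j < ?m \<delta>\<rbrakk> \<Longrightarrow> l2_inner (e \<delta> i) (e \<delta> j) = (if i = j then 1 else 0)"
    and ex: "\<And>\<delta> x. x \<in> sibling_zero_at \<delta> \<Longrightarrow> x = (\<Sum>i<?m \<delta>. (\<lambda>v. l2_inner x (e \<delta> i) * e \<delta> i v))"
    by blast
  define I where "I = {(\<delta>, k). k < ?m \<delta>}"
  define b where "b i = e (fst i) (snd i)" for i
  have b: "b i \<in> sibling_zero_at (fst i)" if "i \<in> I" for i using that e by (auto simp: I_def b_def)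
  have finI: "finite I"
  proof (rule finite_subset)
    \<comment> \<open>A basis vector has norm one and so is nonzero somewhere on
      \<open>branch_support\<close>; only the finitely many depths occurring there carry
      indices.\<close>
    show "I \<subseteq> Sigma (pdepth T ` branch_support) (\<lambda>\<delta>. {..<?m \<delta>})"
    proof
      fix i assume i: "i \<in> I"
      obtain \<delta> k where ik: "i = (\<delta>, k)" "k < ?m \<delta>" using i by (auto simp: I_def)
      have "e \<delta> k \<noteq> 0" using on[OF ik(2) ik(2)] by (auto simp: l2_inner_finite[of "{}"])
      then obtain v where "e \<delta> k v \<noteq> 0" by (auto simp: fun_eq_iff)
      then have "v \<in> branch_support" "pdepth T v = \<delta>" using e[OF ik(2)] sibling_zero_support by (auto simp: sibling_zero_at_def)
      then show "i \<in> Sigma (pdepth T ` branch_support) (\<lambda>\<delta>. {..<?m \<delta>})" using ik by auto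
    qed
  qed (simp add: finite_branch_support)
  \<comment> \<open>One identity serves twice: \<phi> = 1 gives the basis expansion, and
    \<open>kcoeff\<close> as a function of the degree gives the kernel. At \<open>v\<close> only
    basis vectors of degree \<open>pdepth T v\<close> can be nonzero.\<close>
  have weighted: "(\<Sum>i\<in>I. \<phi> (fst i) * l2_inner x (b i) * b i v) = \<phi> (pdepth T v) * x v"
    if x: "x \<in> sibling_zero" for x \<phi> v
  proof -
    define \<delta> where "\<delta> = pdepth T v"
    define y where "y = (\<lambda>v. if pdepth T v = \<delta> then x v else 0)"
    have y: "y \<in> sibling_zero_at \<delta>" unfolding y_def by (rule restrict_pdepth[OF x])
    have ip: "l2_inner x (e \<delta> k) = l2_inner y (e \<delta> k)" if "k < ?m \<delta>" for k
      unfolding l2_inner_def by (rule infsum_cong) (use e[OF that] in \<open>auto simp: y_def sibling_zero_at_def\<close>)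
    have "(\<Sum>i\<in>I. \<phi> (fst i) * l2_inner x (b i) * b i v) = (\<Sum>i\<in>Pair \<delta> ` {..<?m \<delta>}. \<phi> (fst i) * l2_inner x (b i) * b i v)"
    proof (rule sum.mono_neutral_right[OF finI])
      show "\<forall>i\<in>I - Pair \<delta> ` {..<?m \<delta>}. \<phi> (fst i) * l2_inner x (b i) * b i v = 0"
      proof
        fix i assume i: "i \<in> I - Pair \<delta> ` {..<?m \<delta>}"
        then have "fst i \<noteq> \<delta>" by (auto simp: I_def)
        then have "b i v = 0" using b[of i] i by (auto simp: sibling_zero_at_def \<delta>_def)
        then show "\<phi> (fst i) * l2_inner x (b i) * b i v = 0" by simp
      qed
    qed (auto simp: I_def)
    also have "\<dots> = (\<Sum>k<?m \<delta>. \<phi> \<delta> * (l2_inner y (e \<delta> k) * e \<delta> k v))"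
      by (simp add: sum.reindex inj_on_def b_def ip mult.assoc)
    also have "\<dots> = \<phi> \<delta> * (\<Sum>k<?m \<delta>. (\<lambda>v. l2_inner y (e \<delta> k) * e \<delta> k v)) v"
      by (simp only: sum_distrib_left sum_fun_apply)
    also have "\<dots> = \<phi> \<delta> * x v" unfolding ex[OF y, symmetric] by (simp add: y_def \<delta>_def)
    finally show ?thesis by (simp add: \<delta>_def)
  qed
  have "diagonal_kernel a I fst b (joint_kernel a T) (pV T) (da_kernel a T \<Omega>)"
    unfolding joint_kernel_eq
  proof
    show "a \<ge> 1" by (rule a)
    show "finite I" by (rule finI)
    show "sibling_zero \<subseteq> l2 (pV T)" using sibling_zero_l2 by blast
    show "0 \<in> sibling_zero" by (simp add: sibling_zero_def)
    show "x + y \<in> sibling_zero" if "x \<in> sibling_zero" "y \<in> sibling_zero" for x y using that by (rule sibling_zero_add)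
    show "(\<lambda>v. c * x v) \<in> sibling_zero" if "x \<in> sibling_zero" for c x using that by (rule sibling_zero_scale)
    show "b i \<in> sibling_zero" if "i \<in> I" for i using b[OF that] by (simp add: sibling_zero_at_def)
    show "l2_inner (b i) (b j) = (if i = j then 1 else 0)" if "i \<in> I" "j \<in> I" for i j
    proof (cases "fst i = fst j")
      case True
      then show ?thesis using that on by (auto simp: b_def I_def prod_eq_iff)
    next
      case False
      then have "b i v = 0 \<or> b j v = 0" for v
        using b[OF that(1)] b[OF that(2)] unfolding sibling_zero_at_def mem_Collect_eq by metis
      then show ?thesis using False by (auto simp: l2_inner_finite[of "{}"])
    qed
    show "x = (\<lambda>v. \<Sum>i\<in>I. l2_inner x (b i) * b i v)" if "x \<in> sibling_zero" for x
      using weighted[OF that, of "\<lambda>_. 1"] by simp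
    show "da_kernel a T \<Omega> z w x = (\<lambda>v. \<Sum>i\<in>I. kcoeff a (fst i) z w * l2_inner x (b i) * b i v)"
      if "x \<in> sibling_zero" for x z w
      using weighted[OF that, of "\<lambda>\<delta>. kcoeff a \<delta> z w"] da_kernel_eq[OF \<Omega> that] by simp
  qed
  then show ?thesis using that unfolding I_def by blast
qed

section \<open>Counting siblings along one coordinate\<close>

lemma card_psib: assumes u: "u \<in> Phi T {l}" shows "card (psib T l u) = card (sib (T l) (u l))"
proof -
  have "psib T l u = (\<lambda>c. u(l := c)) ` sib (T l) (u l)"
  proof (intro equalityI subsetI)
    fix w assume "w \<in> psib T l u"
    then have "w = u(l := w l)" "w l \<in> sib (T l) (u l)" by (auto simp: psib_def fun_eq_iff)
    then show "w \<in> (\<lambda>c. u(l := c)) ` sib (T l) (u l)" by blast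
  next
    fix w assume "w \<in> (\<lambda>c. u(l := c)) ` sib (T l) (u l)"
    then show "w \<in> psib T l u" using sib_verts[OF u, of l] Phi_pV[OF u] by (auto simp: psib_def mem_pV)
  qed
  then show ?thesis by (simp add: card_image[OF inj_upd])
qed

text \<open>Carries the class count for a single coordinate over to integers; truncated and integer
  differences agree because sibling sets are nonempty and generations never shrink.\<close>

lemma sum_card_psib:
  assumes \<Omega>: "transversal T \<Omega>"
  shows "(\<Sum>u | u \<in> \<Omega> {l} \<and> pdepth T u = (\<lambda>j. if j = l then n else 0). int (card (psib T l u)) - 1)
    = int (card (gen l n)) - int (card (gen l (n - 1)))"
proof -
  let ?\<alpha> = "\<lambda>j. if j = l then n else 0"
  let ?U = "{u. u \<in> \<Omega> {l} \<and> pdepth T u = ?\<alpha>}"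
  have "int (card (psib T l u)) - 1 = int (\<Prod>j\<in>{l}. card (sib (T j) (u j)) - 1)" if "u \<in> ?U" for u
  proof -
    have u: "u \<in> Phi T {l}" using \<Omega> that by (auto simp: transversal_def)
    have "sib (T l) (u l) = Chi (T l) (par (T l) (u l))" by (simp add: sib_def)
    then have "card (sib (T l) (u l)) > 0"
      using card_Chi_pos[of "par (T l) (u l)" l] arc_verts[OF Phi_arc[OF u, of l]] by simp
    then show ?thesis by (simp add: card_psib[OF u] of_nat_diff)
  qed
  then have "(\<Sum>u\<in>?U. int (card (psib T l u)) - 1) = int (\<Sum>u\<in>?U. \<Prod>j\<in>{l}. card (sib (T j) (u j)) - 1)"
    unfolding of_nat_sum by (intro sum.cong refl) blast
  also have "\<dots> = int (if {l} = {j. ?\<alpha> j \<noteq> 0}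
      then \<Prod>j\<in>{l}. card (gen j (?\<alpha> j)) - card (gen j (?\<alpha> j - 1)) else 0)"
    by (simp only: sum_transversal[OF \<Omega>])
  also have "\<dots> = int (card (gen l n)) - int (card (gen l (n - 1)))"
  proof (cases n)
    \<comment> \<open>The support of the zero degree is empty and differs from {l}, so the left side
      is 0. On the right \<open>n - 1\<close> is again 0, and the difference vanishes.\<close>
    case 0
    then show ?thesis by simp
  next
    case (Suc m)
    then have "{j. ?\<alpha> j \<noteq> 0} = {l}" by auto
    then show ?thesis using Suc card_generation_Suc[of m l] by simp
  qed
  finally show ?thesis .
qed

lemma card_generation_0: "card (gen l 0) = 1"
  by (simp add: generation_0)

lemma growth_single:
  "growth (\<lambda>j. if j = l then Suc n else 0) = card (gen l (Suc n)) - card (gen l n)"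
proof -
  have "{j. (if j = l then Suc n else 0) \<noteq> 0} = {l}" by auto
  then show ?thesis by (simp add: growth_def)
qed

end

section \<open>The classification theorem\<close>

theorem theorem1p4:
  fixes a :: nat
    and T1 :: "'d::finite \<Rightarrow> 'a pair_pre_digraph"
    and T2 :: "'d \<Rightarrow> 'b pair_pre_digraph"
    and \<Omega>1 :: "'d set \<Rightarrow> ('d \<Rightarrow> 'a) set"
    and \<Omega>2 :: "'d set \<Rightarrow> ('d \<Rightarrow> 'b) set"
    and H1 :: "(complex ^ 'd \<Rightarrow> ('d \<Rightarrow> 'a) \<Rightarrow> complex) hspace"
    and H2 :: "(complex ^ 'd \<Rightarrow> ('d \<Rightarrow> 'b) \<Rightarrow> complex) hspace"
  assumes "a > 0" and "a * CARD('d) \<noteq> 1"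
    and "\<And>j. directed_tree (T1 j)" and "\<And>j. directed_tree (T2 j)"
    and "\<And>j. locally_finite (T1 j)" and "\<And>j. locally_finite (T2 j)"
    and "finite_joint_branching_index T1" and "finite_joint_branching_index T2"
    and "transversal T1 \<Omega>1" and "transversal T2 \<Omega>2"
    and "is_da_space (real a) T1 \<Omega>1 H1" and "is_da_space (real a) T2 \<Omega>2 H2"
  defines "(stmt_i :: bool) \<equiv> hilbert_modules_isomorphic H1 H2"
    and "(stmt_ii :: bool) \<equiv> \<forall>(\<alpha> :: 'd \<Rightarrow> nat) F.
           (\<Sum>u | u \<in> \<Omega>1 F \<and> pdepth T1 u = \<alpha>. cdim (Lsp (real a) T1 u F)) =
           (\<Sum>v | v \<in> \<Omega>2 F \<and> pdepth T2 v = \<alpha>. cdim (Lsp (real a) T2 v F))"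
    and "(stmt_iii :: bool) \<equiv> \<forall>(n :: nat) (l :: 'd).
           (\<Sum>u | u \<in> \<Omega>1 {l} \<and> pdepth T1 u = (\<lambda>j. if j = l then n else 0).
              (int (card (psib T1 l u)) - 1)) =
           (\<Sum>u | u \<in> \<Omega>2 {l} \<and> pdepth T2 u = (\<lambda>j. if j = l then n else 0).
              (int (card (psib T2 l u)) - 1))"
    and "(stmt_iv :: bool) \<equiv> \<forall>(n :: nat) (l :: 'd).
           card (generation n (T1 l)) = card (generation n (T2 l))"
  shows "(stmt_i \<longleftrightarrow> stmt_ii) \<and> (stmt_ii \<longleftrightarrow> stmt_iii) \<and> (stmt_iii \<longleftrightarrow> stmt_iv)"
proof -
  have a1: "real a \<ge> 1" using assms(1) by simp
  interpret P1: tree_product T1 "real a" by unfold_locales (use assms a1 in auto)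
  interpret P2: tree_product T2 "real a" by unfold_locales (use assms a1 in auto)
  have iv_growth: "P1.growth \<delta> = P2.growth \<delta>" if stmt_iv for \<delta>
    using that unfolding stmt_iv_def P1.growth_def P2.growth_def by simp
  have i: "stmt_i \<longleftrightarrow> (\<forall>\<delta>. P1.growth \<delta> = P2.growth \<delta>)"
  proof -
    obtain b1 where D1: "diagonal_kernel (real a) {(\<delta>, k). k < P1.growth \<delta>} fst b1
        (joint_kernel (real a) T1) (pV T1) (da_kernel (real a) T1 \<Omega>1)"
      using P1.diagonal_kernel_exists[OF assms(9)] unfolding P1.cdim_sibling_zero_at by blast
    obtain b2 where D2: "diagonal_kernel (real a) {(\<delta>, k). k < P2.growth \<delta>} fst b2
        (joint_kernel (real a) T2) (pV T2) (da_kernel (real a) T2 \<Omega>2)"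
      using P2.diagonal_kernel_exists[OF assms(10)] unfolding P2.cdim_sibling_zero_at by blast
    have H1: "is_rkhs (ball 0 1) (joint_kernel (real a) T1) (da_kernel (real a) T1 \<Omega>1) H1"
      and H2: "is_rkhs (ball 0 1) (joint_kernel (real a) T2) (da_kernel (real a) T2 \<Omega>2) H2"
      using assms(11,12) by (simp_all add: is_da_space_def)
    have block: "card {i \<in> {(\<delta>, k). k < m \<delta>}. fst i = \<delta>} = m \<delta>" for m :: "('d \<Rightarrow> nat) \<Rightarrow> nat" and \<delta>
    proof -
      have "{i \<in> {(\<delta>, k). k < m \<delta>}. fst i = \<delta>} = Pair \<delta> ` {..<m \<delta>}" by auto
      then show ?thesis by (simp add: card_image inj_on_def)
    qed
    show ?thesis
    proof
      assume stmt_i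
      then show "\<forall>\<delta>. P1.growth \<delta> = P2.growth \<delta>"
        using same_degrees_if_isomorphic[OF D1 D2 H1 H2 _ assms(2)] unfolding block stmt_i_def by blast
    next
      assume "\<forall>\<delta>. P1.growth \<delta> = P2.growth \<delta>"
      \<comment> \<open>Equality as functions makes the two index sets the same set, so both kernels
        share their labels and the degree map \<open>fst\<close>.\<close>
      then have "P2.growth = P1.growth" by auto
      then show stmt_i
        using isomorphic_if_same_degrees[OF D1 H1 _ H2] D2 unfolding stmt_i_def by metis
    qed
  qed
  have ii: "stmt_ii \<longleftrightarrow> (\<forall>\<delta>. P1.growth \<delta> = P2.growth \<delta>)"
    unfolding stmt_ii_def P1.sum_cdim_Lsp[OF assms(9)] P2.sum_cdim_Lsp[OF assms(10)] by auto
  \<comment> \<open>Degrees supported on one coordinate suffice: they give the increments of each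
    tree, and generation sizes add up from the single root.\<close>
  have growth_iv: stmt_iv if "\<forall>\<delta>. P1.growth \<delta> = P2.growth \<delta>"
  proof -
    have "card (generation n (T1 l)) = card (generation n (T2 l))" for n l
    proof (induction n)
      case 0
      then show ?case by (simp add: P1.card_generation_0 P2.card_generation_0)
    next
      case (Suc n)
      have "card (generation (Suc n) (T1 l)) - card (generation n (T1 l)) = card (generation (Suc n) (T2 l)) - card (generation n (T2 l))"
        using that P1.growth_single[of l n] P2.growth_single[of l n] by simp
      then show ?case using Suc P1.card_generation_Suc[of n l] P2.card_generation_Suc[of n l] by simp
    qed
    then show ?thesis by (simp add: stmt_iv_def)
  qed
  have iii: "stmt_iii \<longleftrightarrow> stmt_iv"
  proof
    assume iii: stmt_iii
    have "card (generation n (T1 l)) = card (generation n (T2 l))" for n l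
    proof (induction n)
      case 0
      then show ?case by (simp add: P1.card_generation_0 P2.card_generation_0)
    next
      case (Suc n)
      have "int (card (generation (Suc n) (T1 l))) - int (card (generation (Suc n - 1) (T1 l)))
        = int (card (generation (Suc n) (T2 l))) - int (card (generation (Suc n - 1) (T2 l)))"
        using iii unfolding stmt_iii_def P1.sum_card_psib[OF assms(9)] P2.sum_card_psib[OF assms(10)] by blast
      then show ?case using Suc by simp
    qed
    then show stmt_iv by (simp add: stmt_iv_def)
  next
    assume stmt_iv
    then show stmt_iii
      unfolding stmt_iii_def stmt_iv_def P1.sum_card_psib[OF assms(9)] P2.sum_card_psib[OF assms(10)] by simp
  qed
  show ?thesis using i ii iii iv_growth growth_iv by blast
qed

end
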